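(* Let $\mathcal{L}$ be a conditional oriented matroid on a finite ground set $\mathcal{I}$. Then there are canonical isomorphisms \begin{align*} \operatorname{GR}(\mathcal{L}) &\cong R_{1}\big/(I_{\mathcal{L},1}+J_{\mathcal{L},1}),\\ \operatorname{gr} \operatorname{GR}(\mathcal{L}) &\cong R_{0}\big/(I_{\mathcal{L},0}+ J_{\mathcal{L},0}),\\ \operatorname{Rees} \operatorname{GR}(\mathcal{L}) &\cong R\big/(I_{\mathcal{L}} + J_{\mathcal{L}}), \end{align*} given by sending each $e_i^{\pm}$ to the image of the corresponding Heaviside function $h_i^\pm$ (in the Rees algebra, to $u h_i^\pm$).
   Context: A signed set on $\mathcal{I}$ is a pair $X=(X^+,X^-)$ of disjoint subsets of $\mathcal{I}$; its support is $\underline{X}=X^+\cup X^-$; write $X_i=\pm$ if $i\in X^\pm$ and $X_i=0$ otherwise; $-X:=(X^-,X^+)$. $\operatorname{Sep}(X,Y):=\{i\mid X_i=-Y_i\neq0\}$. The composition $X\circ Y$ has $(X\circ Y)_i=X_i$ if $X_i\neq0$ and $Y_i$ otherwise. A conditional oriented matroid is a (possibly empty) collection $\mathcal{L}$ of signed sets (covectors) such that (FS) if $X,Y\in\mathcal{L}$ then $X\circ -Y\in\mathcal{L}$; and (SE) if $X,Y\in\mathcal{L}$ and $i\in\operatorname{Sep}(X,Y)$ then there is $Z\in\mathcal{L}$ with $Z_i=0$ and $Z_j=(X\circ Y)_j$ for all $j\notin\operatorname{Sep}(X,Y)$. A circuit is a signed set $X$ such that $X\circ Y\neq Y$ for every $Y\in\mathcal{L}$,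 and which is support-minimal with this property (for every signed set $Z$ with $\underline{Z}\subsetneq\underline{X}$ there is $Y\in\mathcal{L}$ with $Z\circ Y=Y$); $\mathcal{C}$ denotes the set of circuits. Let $\tau\subset\mathcal{L}$ be the set of covectors nonzero in every coordinate. $\operatorname{GR}(\mathcal{L})$ is the ring of functions $\tau\to\mathbb{Z}$; Heaviside functions $h_i^+(X)=1$ if $X_i=+$, $0$ if $X_i=-$, and $h_i^-=1-h_i^+$. $F_k(\mathcal{L})$ is the subgroup generated by polynomial expressions of degree at most $k$ in the Heaviside functions; $\operatorname{gr}$ and $\operatorname{Rees}=\bigoplus_k u^kF_k\subset \operatorname{GR}(\mathcal{L})\otimes\mathbb{Z}[u]$ are taken with respect to this filtration, with $\deg u=2$. $R:=\mathbb{Z}[u,e_i^+,e_i^-]_{i\in\mathcal{I}}/\langle e_i^+e_i^-,\ e_i^++e_i^--u \mid i\in\mathcal{I}\rangle$, all generators of degree 2. For a signed set $X$, $e_X:=\prod_{i\in X^+}e_i^+\prod_{i\in X^-}(-e_i^-)\in R$ and $f_X\in R$ is the element with $uf_X=e_X-e_{-X}$ (written $f_X=(e_X-e_{-X})/u$). $I_{\mathcal{L}}:=\langle e_X\mid X\in\mathcal{C}\rangle$ and $J_{\mathcal{L}}:=\langle f_X\mid X\in\mathcal{C}\text{ and }-X\in\mathcal{C}\rangle$. For $m\in\{0,1\}$, $R_m:=R/\langle u-m\rangle$ and $I_{\mathcal{L},m},J_{\mathcal{L},m}$ are the images of $I_{\mathcal{L}},J_{\mathcal{L}}$ in $R_m$.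 *)

theory Defs
  imports
    "HOL-Algebra.QuotRing"
    "HOL-Algebra.UnivPoly"
    "HOL-Algebra.Generated_Groups"
    "HOL-Library.Poly_Mapping"
begin

section \<open>Signed sets and conditional oriented matroids\<close>

text \<open>A signed set \<open>X = (X\<^sup>+, X\<^sup>-)\<close> is a pair of sets.\<close>

type_synonym 'a signed = "'a set \<times> 'a set"

definition signed_set :: "'a set \<Rightarrow> 'a signed \<Rightarrow> bool" where
  "signed_set I X \<longleftrightarrow> fst X \<subseteq> I \<and> snd X \<subseteq> I \<and> fst X \<inter> snd X = {}"

definition supp :: "'a signed \<Rightarrow> 'a set" where
  "supp X = fst X \<union> snd X"

definition sign_at :: "'a signed \<Rightarrow> 'a \<Rightarrow> int" where
  "sign_at X i = (if i \<in> fst X then 1 else if i \<in> snd X then -1 else 0)"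

definition opp :: "'a signed \<Rightarrow> 'a signed" where
  "opp X = (snd X, fst X)"

definition sep :: "'a signed \<Rightarrow> 'a signed \<Rightarrow> 'a set" where
  "sep X Y = {i. sign_at X i = - sign_at Y i \<and> sign_at X i \<noteq> 0}"

definition composition :: "'a signed \<Rightarrow> 'a signed \<Rightarrow> 'a signed" where
  "composition X Y = (fst X \<union> (fst Y - supp X), snd X \<union> (snd Y - supp X))"

definition conditional_oriented_matroid :: "'a set \<Rightarrow> 'a signed set \<Rightarrow> bool" where
  "conditional_oriented_matroid I L \<longleftrightarrow>
     (\<forall>X\<in>L. signed_set I X) \<and>
     (\<forall>X\<in>L. \<forall>Y\<in>L. composition X (opp Y) \<in> L) \<and>
     (\<forall>X\<in>L. \<forall>Y\<in>L. \<forall>i\<in>sep X Y. \<exists>Z\<in>L. sign_at Z i = 0 \<and>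
        (\<forall>j\<in>I - sep X Y. sign_at Z j = sign_at (composition X Y) j))"

definition circuits :: "'a set \<Rightarrow> 'a signed set \<Rightarrow> 'a signed set" where
  "circuits I L = {X. signed_set I X \<and> (\<forall>Y\<in>L. composition X Y \<noteq> Y) \<and>
     (\<forall>Z. signed_set I Z \<and> supp Z \<subset> supp X \<longrightarrow> (\<exists>Y\<in>L. composition Z Y = Y))}"

definition topes :: "'a set \<Rightarrow> 'a signed set \<Rightarrow> 'a signed set" where
  "topes I L = {X\<in>L. \<forall>i\<in>I. sign_at X i \<noteq> 0}"


section \<open>The associated graded ring and the Rees ring of a filtered ring\<close>

text \<open>A filtration \<open>F\<close> is indexed by the natural numbers, with \<open>F\<^sub>-\<^sub>1 = 0\<close>.\<close>

definition filt_prev :: "('r, 'm) ring_scheme \<Rightarrow> (nat \<Rightarrow> 'r set) \<Rightarrow> nat \<Rightarrow> 'r set" where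
  "filt_prev A F k = (if k = 0 then {\<zero>\<^bsub>A\<^esub>} else F (k - 1))"

definition gr_piece :: "('r, 'm) ring_scheme \<Rightarrow> (nat \<Rightarrow> 'r set) \<Rightarrow> nat \<Rightarrow> 'r set monoid" where
  "gr_piece A F k = ((add_monoid A)\<lparr>carrier := F k\<rparr>) Mod (filt_prev A F k)"

text \<open>The class of \<open>a \<in> F k\<close> in the summand of index \<open>k\<close>.\<close>

definition gr_class :: "('r, 'm) ring_scheme \<Rightarrow> (nat \<Rightarrow> 'r set) \<Rightarrow> nat \<Rightarrow> 'r \<Rightarrow> nat \<Rightarrow> 'r set" where
  "gr_class A F k a = (\<lambda>j. if j = k then filt_prev A F k +>\<^bsub>A\<^esub> a else filt_prev A F j)"

text \<open>
  Elements of the direct sum are finitely supported families of cosets. The set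
  \<open>rcoset_mult A (filt_prev A F (i + j)) (a + F (i - 1)) (b + F (j - 1))\<close> is the coset
  \<open>a b + F (i + j - 1)\<close>.
\<close>

definition gr_ring :: "('r, 'm) ring_scheme \<Rightarrow> (nat \<Rightarrow> 'r set) \<Rightarrow> (nat \<Rightarrow> 'r set) ring" where
  "gr_ring A F =
    \<lparr>carrier = {x. (\<forall>k. x k \<in> carrier (gr_piece A F k)) \<and> finite {k. x k \<noteq> \<one>\<^bsub>gr_piece A F k\<^esub>}},
     mult = (\<lambda>x y n. finprod (gr_piece A F n)
        (\<lambda>i. rcoset_mult A (filt_prev A F n) (x i) (y (n - i))) {..n}),
     one = gr_class A F 0 \<one>\<^bsub>A\<^esub>,
     zero = (\<lambda>k. \<one>\<^bsub>gr_piece A F k\<^esub>),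
     add = (\<lambda>x y k. x k \<otimes>\<^bsub>gr_piece A F k\<^esub> y k)\<rparr>"

text \<open>The tensor product of \<open>A\<close> with \<open>\<int>[u]\<close> is rendered as the polynomial ring \<open>UP A\<close>.\<close>

definition rees_ring :: "('r, 'm) ring_scheme \<Rightarrow> (nat \<Rightarrow> 'r set) \<Rightarrow> ('r, nat \<Rightarrow> 'r) up_ring" where
  "rees_ring A F = (UP A)\<lparr>carrier := {p \<in> carrier (UP A). \<forall>k. coeff (UP A) p k \<in> F k}\<rparr>"

text \<open>Homogeneous parts; the summand of index \<open>k\<close> has degree \<open>2 k\<close>.\<close>

definition gr_degree :: "('r, 'm) ring_scheme \<Rightarrow> (nat \<Rightarrow> 'r set) \<Rightarrow> nat \<Rightarrow> (nat \<Rightarrow> 'r set) set" where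
  "gr_degree A F d = {x \<in> carrier (gr_ring A F). \<forall>k. 2 * k \<noteq> d \<longrightarrow> x k = \<one>\<^bsub>gr_piece A F k\<^esub>}"

definition rees_degree :: "('r, 'm) ring_scheme \<Rightarrow> (nat \<Rightarrow> 'r set) \<Rightarrow> nat \<Rightarrow> (nat \<Rightarrow> 'r) set" where
  "rees_degree A F d = {p \<in> carrier (rees_ring A F). \<forall>k. 2 * k \<noteq> d \<longrightarrow> coeff (UP A) p k = \<zero>\<^bsub>A\<^esub>}"


section \<open>The ring of integer functions on the topes and its filtration\<close>

definition GR :: "'a set \<Rightarrow> 'a signed set \<Rightarrow> ('a signed \<Rightarrow> int) ring" where
  "GR I L =
    \<lparr>carrier = topes I L \<rightarrow>\<^sub>E UNIV,
     mult = (\<lambda>f g. \<lambda>X\<in>topes I L. f X * g X),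
     one = (\<lambda>X\<in>topes I L. 1),
     zero = (\<lambda>X\<in>topes I L. 0),
     add = (\<lambda>f g. \<lambda>X\<in>topes I L. f X + g X)\<rparr>"

definition heav_plus :: "'a set \<Rightarrow> 'a signed set \<Rightarrow> 'a \<Rightarrow> 'a signed \<Rightarrow> int" where
  "heav_plus I L i = (\<lambda>X\<in>topes I L. if i \<in> fst X then 1 else 0)"

definition heav_minus :: "'a set \<Rightarrow> 'a signed set \<Rightarrow> 'a \<Rightarrow> 'a signed \<Rightarrow> int" where
  "heav_minus I L i = \<one>\<^bsub>GR I L\<^esub> \<ominus>\<^bsub>GR I L\<^esub> heav_plus I L i"

text \<open>\<open>heav_poly I L k f\<close>: \<open>f\<close> is a polynomial expression, with integer coefficients, of degree
  at most \<open>k\<close> in the Heaviside functions.\<close>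

inductive heav_poly :: "'a set \<Rightarrow> 'a signed set \<Rightarrow> nat \<Rightarrow> ('a signed \<Rightarrow> int) \<Rightarrow> bool"
  for I L where
  const: "heav_poly I L k (\<lambda>X\<in>topes I L. c)"
| plus: "i \<in> I \<Longrightarrow> 1 \<le> k \<Longrightarrow> heav_poly I L k (heav_plus I L i)"
| minus: "i \<in> I \<Longrightarrow> 1 \<le> k \<Longrightarrow> heav_poly I L k (heav_minus I L i)"
| sum: "heav_poly I L k f \<Longrightarrow> heav_poly I L k g \<Longrightarrow> heav_poly I L k (f \<oplus>\<^bsub>GR I L\<^esub> g)"
| prod: "heav_poly I L j f \<Longrightarrow> heav_poly I L k g \<Longrightarrow> heav_poly I L (j + k) (f \<otimes>\<^bsub>GR I L\<^esub> g)"

definition filt :: "'a set \<Rightarrow> 'a signed set \<Rightarrow> nat \<Rightarrow> ('a signed \<Rightarrow> int) set" where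
  "filt I L k = generate (add_monoid (GR I L)) {f. heav_poly I L k f}"


section \<open>The ring \<open>R\<close> and the ideals attached to the circuits\<close>

datatype 'a var = Var_u | Var_plus 'a | Var_minus 'a

text \<open>\<open>'a var \<Rightarrow>\<^sub>0 nat\<close> is the type of monomials. The polynomials in the variables indexed by the
  ground set form a subring of the polynomials in all variables of type \<open>'a var\<close>.\<close>

type_synonym 'a mpoly = "('a var \<Rightarrow>\<^sub>0 nat) \<Rightarrow>\<^sub>0 int"

definition vars :: "'a set \<Rightarrow> 'a var set" where
  "vars I = {Var_u} \<union> Var_plus ` I \<union> Var_minus ` I"

definition poly_ring :: "'a set \<Rightarrow> 'a mpoly ring" where
  "poly_ring I =
    \<lparr>carrier = {p. \<forall>m\<in>Poly_Mapping.keys p. Poly_Mapping.keys m \<subseteq> vars I},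
     mult = (*), one = 1, zero = 0, add = (+)\<rparr>"

definition Var :: "'a var \<Rightarrow> 'a mpoly" where
  "Var v = Poly_Mapping.single (Poly_Mapping.single v 1) 1"

definition R_rel :: "'a set \<Rightarrow> 'a mpoly set" where
  "R_rel I = Idl\<^bsub>poly_ring I\<^esub>
     ((\<lambda>i. Var (Var_plus i) * Var (Var_minus i)) ` I \<union>
      (\<lambda>i. Var (Var_plus i) + Var (Var_minus i) - Var Var_u) ` I)"

definition R_ring :: "'a set \<Rightarrow> 'a mpoly set ring" where
  "R_ring I = poly_ring I Quot R_rel I"

definition u_elem :: "'a set \<Rightarrow> 'a mpoly set" where
  "u_elem I = R_rel I +>\<^bsub>poly_ring I\<^esub> Var Var_u"

definition e_plus :: "'a set \<Rightarrow> 'a \<Rightarrow> 'a mpoly set" where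
  "e_plus I i = R_rel I +>\<^bsub>poly_ring I\<^esub> Var (Var_plus i)"

definition e_minus :: "'a set \<Rightarrow> 'a \<Rightarrow> 'a mpoly set" where
  "e_minus I i = R_rel I +>\<^bsub>poly_ring I\<^esub> Var (Var_minus i)"

text \<open>All variables have degree 2.\<close>

definition R_degree :: "'a set \<Rightarrow> nat \<Rightarrow> 'a mpoly set set" where
  "R_degree I d = (\<lambda>p. R_rel I +>\<^bsub>poly_ring I\<^esub> p) `
     {p \<in> carrier (poly_ring I).
      \<forall>m\<in>Poly_Mapping.keys p. 2 * (\<Sum>v\<in>Poly_Mapping.keys m. Poly_Mapping.lookup m v) = d}"

definition e_signed :: "'a set \<Rightarrow> 'a signed \<Rightarrow> 'a mpoly set" where
  "e_signed I X =
     finprod (R_ring I) (e_plus I) (fst X) \<otimes>\<^bsub>R_ring I\<^esub>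
     finprod (R_ring I) (\<lambda>i. \<ominus>\<^bsub>R_ring I\<^esub> e_minus I i) (snd X)"

text \<open>The quotient \<open>(e\<^sub>X - e\<^sub>-\<^sub>X) / u\<close> is well defined: \<open>u\<close> is a non-zero-divisor in \<open>R\<close>, and modulo
  \<open>u\<close> one has \<open>- e_minus = e_plus\<close>.\<close>

definition f_signed :: "'a set \<Rightarrow> 'a signed \<Rightarrow> 'a mpoly set" where
  "f_signed I X =
     (THE f. f \<in> carrier (R_ring I) \<and>
        u_elem I \<otimes>\<^bsub>R_ring I\<^esub> f = e_signed I X \<ominus>\<^bsub>R_ring I\<^esub> e_signed I (opp X))"

definition I_ideal :: "'a set \<Rightarrow> 'a signed set \<Rightarrow> 'a mpoly set set" where
  "I_ideal I L = Idl\<^bsub>R_ring I\<^esub> {e_signed I X | X. X \<in> circuits I L}"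

definition J_ideal :: "'a set \<Rightarrow> 'a signed set \<Rightarrow> 'a mpoly set set" where
  "J_ideal I L = Idl\<^bsub>R_ring I\<^esub> {f_signed I X | X. X \<in> circuits I L \<and> opp X \<in> circuits I L}"

definition R_quot :: "'a set \<Rightarrow> 'a signed set \<Rightarrow> 'a mpoly set set ring" where
  "R_quot I L = R_ring I Quot (I_ideal I L <+>\<^bsub>R_ring I\<^esub> J_ideal I L)"

definition R_quot_class :: "'a set \<Rightarrow> 'a signed set \<Rightarrow> 'a mpoly set \<Rightarrow> 'a mpoly set set" where
  "R_quot_class I L x = (I_ideal I L <+>\<^bsub>R_ring I\<^esub> J_ideal I L) +>\<^bsub>R_ring I\<^esub> x"

text \<open>The specialisations at \<open>u = m\<close>.\<close>

definition u_ideal :: "'a set \<Rightarrow> nat \<Rightarrow> 'a mpoly set set" where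
  "u_ideal I m = Idl\<^bsub>R_ring I\<^esub> {u_elem I \<ominus>\<^bsub>R_ring I\<^esub> [m] \<cdot>\<^bsub>R_ring I\<^esub> \<one>\<^bsub>R_ring I\<^esub>}"

definition R_at :: "'a set \<Rightarrow> nat \<Rightarrow> 'a mpoly set set ring" where
  "R_at I m = R_ring I Quot u_ideal I m"

definition to_R_at :: "'a set \<Rightarrow> nat \<Rightarrow> 'a mpoly set \<Rightarrow> 'a mpoly set set" where
  "to_R_at I m x = u_ideal I m +>\<^bsub>R_ring I\<^esub> x"

definition IJ_at :: "'a set \<Rightarrow> 'a signed set \<Rightarrow> nat \<Rightarrow> 'a mpoly set set set" where
  "IJ_at I L m = to_R_at I m ` I_ideal I L <+>\<^bsub>R_at I m\<^esub> to_R_at I m ` J_ideal I L"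

definition R_at_quot :: "'a set \<Rightarrow> 'a signed set \<Rightarrow> nat \<Rightarrow> 'a mpoly set set set ring" where
  "R_at_quot I L m = R_at I m Quot IJ_at I L m"

definition R_at_quot_class ::
    "'a set \<Rightarrow> 'a signed set \<Rightarrow> nat \<Rightarrow> 'a mpoly set \<Rightarrow> 'a mpoly set set set" where
  "R_at_quot_class I L m x = IJ_at I L m +>\<^bsub>R_at I m\<^esub> to_R_at I m x"

end

(*
  A polynomial vanishes on all topes (with e_i replaced by u times a Heaviside function) if and only
  if it lies in the ideal generated by the relations of R, the e_X and the f_X; this is the Rees
  isomorphism, and the other two follow from it by specialising u. The nontrivial direction is an
  induction on the ground set. If n is not a loop, write p = g + e_n^+ h with g and h not involving n.
  Two topes differing only in n show that h vanishes on the topes of the contraction L/n, so h is in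
  the ideal of L/n. Multiplication by e_n^+ maps a generator of that ideal into the ideal of L plus
  polynomials not involving n: if X is a circuit of L/n, then X extended by n^+ or by n^- lies below
  no covector of L, and f_{X n^+} = e_n^+ f_X + e_{-X}. What remains is a polynomial vanishing on the
  topes of the deletion of n. The step for f_X needs that X n^+ and (-X) n^- are circuits together;
  this holds because a pair of opposite circuits of L/n forces a covector vanishing on their support.
*)
theory Submission
  imports "HOL-Computational_Algebra.Polynomial" Defs
begin

hide_const (open) Polynomial.monom Polynomial.coeff Polynomial.degree Polynomial.order

section \<open>Polynomials and their evaluation\<close>

text \<open>All work is done on polynomials before any quotient is formed: three surjections from
  one polynomial ring get kernels with explicit generators, and the nested quotients are identified
  at the end. Vanishing on the topes has to be read degree by degree, since a relation among
  Heaviside functions that mixes degrees holds after setting u = 1 but not in the Rees ring. Hence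
  u, e_i^+ and e_i^- take values that are multiples of an indeterminate x. Multiplication by x is
  injective, which is why f_X vanishes wherever e_X and e_{-X} do. Specialising is not purely
  formal: for u = 0 a component of index k lying in F_{k-1} must be lifted one degree lower, and for
  u = 1 a polynomial must be homogenised before the degreewise criterion applies. Both rest on the
  fact that a function in F_k is the value of a homogeneous polynomial of degree k, with powers of u
  filling up the degree. On the combinatorial side, circuits compare all signed sets of smaller
  support, whereas the induction sees restrictions only. The two notions agree because every sign
  pattern on the support of a circuit, other than it and its opposite, lies below a
  covector.\<close>

definition polys :: "'a set \<Rightarrow> 'a mpoly set" where
  "polys I = {p. \<forall>m\<in>Poly_Mapping.keys p. Poly_Mapping.keys m \<subseteq> vars I}"

lemma polys_mono: "I \<subseteq> J \<Longrightarrow> polys I \<subseteq> polys J"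
  unfolding polys_def vars_def by fast

lemma polys_0 [simp]: "0 \<in> polys I" and polys_1 [simp]: "1 \<in> polys I"
  by (auto simp: polys_def)

lemma polys_of_int [simp]: "of_int c \<in> polys I"
  by (auto simp: polys_def simp flip: single_of_int)

lemma polys_Var: "v \<in> vars I \<Longrightarrow> Var v \<in> polys I"
  by (auto simp: polys_def Var_def)

lemma polys_Var_simps [simp]:
  "Var Var_u \<in> polys I"
  "i \<in> I \<Longrightarrow> Var (Var_plus i) \<in> polys I"
  "i \<in> I \<Longrightarrow> Var (Var_minus i) \<in> polys I"
  by (auto intro!: polys_Var simp: vars_def)

lemma polys_add [simp]: "p \<in> polys I \<Longrightarrow> q \<in> polys I \<Longrightarrow> p + q \<in> polys I"
  using keys_add[of p q] unfolding polys_def by fast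

lemma polys_uminus [simp]: "p \<in> polys I \<Longrightarrow> - p \<in> polys I"
  by (simp add: polys_def)

lemma polys_diff [simp]: "p \<in> polys I \<Longrightarrow> q \<in> polys I \<Longrightarrow> p - q \<in> polys I"
  using polys_add[of p I "- q"] by simp

lemma polys_mult [simp]: "p \<in> polys I \<Longrightarrow> q \<in> polys I \<Longrightarrow> p * q \<in> polys I"
  using keys_mult[of p q] keys_add[where ?'b = nat and ?'a = "'a var"] unfolding polys_def by blast

lemma polys_power [simp]: "p \<in> polys I \<Longrightarrow> p ^ k \<in> polys I"
  by (induction k) auto

lemma polys_sum [simp]: "(\<And>x. x \<in> A \<Longrightarrow> f x \<in> polys I) \<Longrightarrow> sum f A \<in> polys I"
  by (induction A rule: infinite_finite_induct) auto

lemma polys_prod [simp]: "(\<And>x. x \<in> A \<Longrightarrow> f x \<in> polys I) \<Longrightarrow> prod f A \<in> polys I"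
  by (induction A rule: infinite_finite_induct) auto

lemma poly_mapping_eq_sum_single:
  "p = (\<Sum>m\<in>Poly_Mapping.keys p. Poly_Mapping.single m (Poly_Mapping.lookup p m))"
  by (rule poly_mapping_eqI)
    (auto simp: lookup_sum lookup_single when_def in_keys_iff)

lemma Var_power: "Var v ^ k = Poly_Mapping.single (Poly_Mapping.single v k) 1"
  by (induction k) (auto simp: Var_def mult_single simp flip: single_add)

lemma prod_Var_power:
  "finite A \<Longrightarrow> (\<Prod>v\<in>A. Var v ^ f v) = Poly_Mapping.single (\<Sum>v\<in>A. Poly_Mapping.single v (f v)) 1"
  by (induction A rule: finite_induct) (auto simp: Var_power mult_single)

lemma single_eq_prod_Var:
  "Poly_Mapping.single m c =
    of_int c * (\<Prod>v\<in>Poly_Mapping.keys m. Var v ^ Poly_Mapping.lookup m v)"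
  using poly_mapping_eq_sum_single[of m]
  by (simp add: prod_Var_power mult_single flip: single_of_int)

text \<open>Monomials are products of variables, so closure under sums and products replaces any
  handling of exponents in later arguments.\<close>

lemma polys_induct [consumes 1, case_names const Var add mult]:
  assumes p: "p \<in> polys I"
    and const: "\<And>c. Q (of_int c)"
    and Var: "\<And>v. v \<in> vars I \<Longrightarrow> Q (Var v)"
    and add: "\<And>p q. p \<in> polys I \<Longrightarrow> q \<in> polys I \<Longrightarrow> Q p \<Longrightarrow> Q q \<Longrightarrow> Q (p + q)"
    and mult: "\<And>p q. p \<in> polys I \<Longrightarrow> q \<in> polys I \<Longrightarrow> Q p \<Longrightarrow> Q q \<Longrightarrow> Q (p * q)"
  shows "Q p"
proof -
  \<comment> \<open>Membership is carried along because \<open>add\<close> and \<open>mult\<close>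
    ask for it at every intermediate sum and product.\<close>
  let ?Q = "\<lambda>p. p \<in> polys I \<and> Q p"
  have Q0: "?Q 0" and Q1: "?Q 1" using const[of 0] const[of 1] by auto
  have pw: "?Q p \<Longrightarrow> ?Q (p ^ k)" for p k
    by (induction k) (use Q1 mult in auto)
  have prod: "?Q (prod f A)" if "\<And>x. x \<in> A \<Longrightarrow> ?Q (f x)" for f :: "'a var \<Rightarrow> 'a mpoly" and A
    using that by (induction A rule: infinite_finite_induct) (use Q1 mult in auto)
  have sum: "?Q (sum f A)" if "\<And>x. x \<in> A \<Longrightarrow> ?Q (f x)"
    for f :: "('a var \<Rightarrow>\<^sub>0 nat) \<Rightarrow> 'a mpoly" and A
    using that by (induction A rule: infinite_finite_induct) (use Q0 add in auto)
  have "?Q (Poly_Mapping.single m c)" if "Poly_Mapping.keys m \<subseteq> vars I" for m c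
  proof -
    have "?Q (\<Prod>v\<in>Poly_Mapping.keys m. Var v ^ Poly_Mapping.lookup m v)"
      using that by (intro prod pw) (auto intro: polys_Var Var)
    then show ?thesis unfolding single_eq_prod_Var using const[of c] mult by auto
  qed
  then have "?Q (\<Sum>m\<in>Poly_Mapping.keys p. Poly_Mapping.single m (Poly_Mapping.lookup p m))"
    using p by (intro sum) (auto simp: polys_def)
  then show ?thesis by (simp flip: poly_mapping_eq_sum_single)
qed

section \<open>Evaluation of polynomials in a commutative ring\<close>

definition eval_mon :: "('a var \<Rightarrow> 'b::comm_ring_1) \<Rightarrow> ('a var \<Rightarrow>\<^sub>0 nat) \<Rightarrow> 'b" where
  "eval_mon \<phi> m = (\<Prod>v\<in>Poly_Mapping.keys m. \<phi> v ^ Poly_Mapping.lookup m v)"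

definition eval_poly :: "('a var \<Rightarrow> 'b::comm_ring_1) \<Rightarrow> 'a mpoly \<Rightarrow> 'b" where
  "eval_poly \<phi> p = (\<Sum>m\<in>Poly_Mapping.keys p. of_int (Poly_Mapping.lookup p m) * eval_mon \<phi> m)"

lemma eval_mon_superset:
  assumes "finite S" "Poly_Mapping.keys m \<subseteq> S"
  shows "eval_mon \<phi> m = (\<Prod>v\<in>S. \<phi> v ^ Poly_Mapping.lookup m v)"
  unfolding eval_mon_def using assms
  by (intro prod.mono_neutral_left) (auto simp: in_keys_iff)

lemma eval_mon_add: "eval_mon \<phi> (m + n) = eval_mon \<phi> m * eval_mon \<phi> n"
proof -
  let ?S = "Poly_Mapping.keys m \<union> Poly_Mapping.keys n"
  have "Poly_Mapping.keys (m + n) \<subseteq> ?S" by (rule keys_add)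
  then show ?thesis
    using eval_mon_superset[of ?S "m + n" \<phi>] eval_mon_superset[of ?S m \<phi>] eval_mon_superset[of ?S n \<phi>]
    by (simp add: lookup_add power_add prod.distrib)
qed

lemma eval_poly_superset:
  assumes "finite S" "Poly_Mapping.keys p \<subseteq> S"
  shows "eval_poly \<phi> p = (\<Sum>m\<in>S. of_int (Poly_Mapping.lookup p m) * eval_mon \<phi> m)"
  unfolding eval_poly_def using assms
  by (intro sum.mono_neutral_left) (auto simp: in_keys_iff)

lemma eval_poly_add: "eval_poly \<phi> (p + q) = eval_poly \<phi> p + eval_poly \<phi> q"
proof -
  let ?S = "Poly_Mapping.keys p \<union> Poly_Mapping.keys q"
  have "Poly_Mapping.keys (p + q) \<subseteq> ?S" by (rule keys_add)
  then show ?thesis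
    using eval_poly_superset[of ?S "p + q" \<phi>] eval_poly_superset[of ?S p \<phi>]
      eval_poly_superset[of ?S q \<phi>]
    by (simp add: lookup_add distrib_right sum.distrib)
qed

lemma eval_poly_0 [simp]: "eval_poly \<phi> 0 = 0"
  by (simp add: eval_poly_def)

lemma eval_poly_uminus: "eval_poly \<phi> (- p) = - eval_poly \<phi> p"
  using eval_poly_add[of \<phi> p "- p"] by (simp add: add_eq_0_iff)

lemma eval_poly_diff: "eval_poly \<phi> (p - q) = eval_poly \<phi> p - eval_poly \<phi> q"
  using eval_poly_add[of \<phi> p "- q"] by (simp add: eval_poly_uminus)

lemma eval_poly_sum: "eval_poly \<phi> (sum f A) = (\<Sum>x\<in>A. eval_poly \<phi> (f x))"
  by (induction A rule: infinite_finite_induct) (auto simp: eval_poly_add)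

lemma eval_poly_single: "eval_poly \<phi> (Poly_Mapping.single m c) = of_int c * eval_mon \<phi> m"
  by (cases "c = 0") (auto simp: eval_poly_def)

lemma eval_poly_mult: "eval_poly \<phi> (p * q) = eval_poly \<phi> p * eval_poly \<phi> q"
proof -
  have "eval_poly \<phi> (p * q) =
    eval_poly \<phi> ((\<Sum>m\<in>Poly_Mapping.keys p. Poly_Mapping.single m (Poly_Mapping.lookup p m)) *
      (\<Sum>m\<in>Poly_Mapping.keys q. Poly_Mapping.single m (Poly_Mapping.lookup q m)))"
    by (simp flip: poly_mapping_eq_sum_single)
  also have "\<dots> = eval_poly \<phi> p * eval_poly \<phi> q"
    by (simp add: sum_product eval_poly_sum mult_single eval_poly_single eval_mon_add
        eval_poly_def[of _ p] eval_poly_def[of _ q] algebra_simps)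
  finally show ?thesis .
qed

lemma eval_poly_of_int [simp]: "eval_poly \<phi> (of_int c) = of_int c"
  by (simp add: eval_poly_single eval_mon_def flip: single_of_int)

lemma eval_poly_1 [simp]: "eval_poly \<phi> 1 = 1"
  using eval_poly_of_int[of \<phi> 1] by simp

lemma eval_poly_Var [simp]: "eval_poly \<phi> (Var v) = \<phi> v"
  by (simp add: Var_def eval_poly_single eval_mon_def)

lemma eval_poly_prod: "eval_poly \<phi> (prod f A) = (\<Prod>x\<in>A. eval_poly \<phi> (f x))"
  by (induction A rule: infinite_finite_induct) (auto simp: eval_poly_mult)

lemma eval_poly_power: "eval_poly \<phi> (p ^ k) = eval_poly \<phi> p ^ k"
  by (induction k) (auto simp: eval_poly_mult)

lemmas eval_poly_simps =
  eval_poly_add eval_poly_uminus eval_poly_diff eval_poly_mult eval_poly_sum eval_poly_prod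
  eval_poly_power

lemma eval_poly_cong:
  assumes "p \<in> polys I" "\<And>v. v \<in> vars I \<Longrightarrow> \<phi> v = \<psi> v"
  shows "eval_poly \<phi> p = eval_poly \<psi> p"
  using assms(1) by (induction rule: polys_induct) (auto simp: assms(2) eval_poly_simps)

text \<open>\<open>ev X\<close> records the values at the point \<open>X\<close> of all homogeneous parts of a polynomial: the
  coefficient of the \<open>k\<close>-th power of the variable is the value of the part of degree \<open>k\<close>.\<close>

fun var_value :: "'a signed \<Rightarrow> 'a var \<Rightarrow> int" where
  "var_value X Var_u = 1"
| "var_value X (Var_plus i) = (if i \<in> fst X then 1 else 0)"
| "var_value X (Var_minus i) = (if i \<in> fst X then 0 else 1)"

definition ev :: "'a signed \<Rightarrow> 'a mpoly \<Rightarrow> int poly" where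
  "ev X = eval_poly (\<lambda>v. Polynomial.monom (var_value X v) 1)"

lemma ev_simps [simp]:
  "ev X 0 = 0" "ev X 1 = 1" "ev X (of_int c) = of_int c"
  "ev X (p + q) = ev X p + ev X q" "ev X (- p) = - ev X p" "ev X (p - q) = ev X p - ev X q"
  "ev X (p * q) = ev X p * ev X q" "ev X (sum f A) = (\<Sum>x\<in>A. ev X (f x))"
  "ev X (prod f A) = (\<Prod>x\<in>A. ev X (f x))" "ev X (p ^ k) = ev X p ^ k"
  "ev X (Var v) = Polynomial.monom (var_value X v) 1"
  by (simp_all add: ev_def eval_poly_simps)

text \<open>\<open>var_value\<close> consults only the positive part of a signed set. This is what
  lets a tope of a minor be exchanged for a tope of the whole matroid.\<close>

lemma ev_cong:
  assumes "p \<in> polys I" "fst X \<inter> I = fst Y \<inter> I"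
  shows "ev X p = ev Y p"
  unfolding ev_def using assms by (intro eval_poly_cong[OF assms(1)]) (auto simp: vars_def)

section \<open>Total degree and homogeneous polynomials\<close>

definition mon_degree :: "('a var \<Rightarrow>\<^sub>0 nat) \<Rightarrow> nat" where
  "mon_degree m = (\<Sum>v\<in>Poly_Mapping.keys m. Poly_Mapping.lookup m v)"

lemma ev_eq_sum_monom:
  "ev X p = (\<Sum>m\<in>Poly_Mapping.keys p.
     Polynomial.monom (Poly_Mapping.lookup p m * eval_mon (var_value X) m) (mon_degree m))"
proof -
  have pr: "(\<Prod>v\<in>A. Polynomial.monom (f v) 1 ^ g v) = Polynomial.monom (\<Prod>v\<in>A. f v ^ g v) (\<Sum>v\<in>A. g v)"
    if "finite A" for A and f :: "'a var \<Rightarrow> int" and g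
    using that by (induction A rule: finite_induct) (auto simp: monom_power mult_monom one_poly_eq_simps)
  have "eval_mon (\<lambda>v. Polynomial.monom (var_value X v) 1) m
      = Polynomial.monom (eval_mon (var_value X) m) (mon_degree m)" for m
    unfolding eval_mon_def mon_degree_def by (rule pr) simp
  then show ?thesis
    by (simp add: ev_def eval_poly_def of_int_monom mult_monom)
qed

text \<open>Each variable counts with degree 1 here, half of its degree in \<open>R_degree\<close>;
  this matches the index of the filtration.\<close>

definition hpolys :: "'a set \<Rightarrow> nat \<Rightarrow> 'a mpoly set" where
  "hpolys I k = {p \<in> polys I. \<forall>m\<in>Poly_Mapping.keys p. mon_degree m = k}"

lemma hpolys_polys: "p \<in> hpolys I k \<Longrightarrow> p \<in> polys I"
  by (simp add: hpolys_def)

lemma hpolys_0 [simp]: "0 \<in> hpolys I k"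
  by (simp add: hpolys_def)

lemma hpolys_add [simp]: "p \<in> hpolys I k \<Longrightarrow> q \<in> hpolys I k \<Longrightarrow> p + q \<in> hpolys I k"
  using keys_add[of p q] by (auto simp: hpolys_def)

lemma mon_degree_superset:
  assumes "finite S" "Poly_Mapping.keys m \<subseteq> S"
  shows "mon_degree m = (\<Sum>v\<in>S. Poly_Mapping.lookup m v)"
  unfolding mon_degree_def using assms
  by (intro sum.mono_neutral_left) (auto simp: in_keys_iff)

lemma mon_degree_add: "mon_degree (m + n) = mon_degree m + mon_degree n"
proof -
  let ?S = "Poly_Mapping.keys m \<union> Poly_Mapping.keys n"
  have "Poly_Mapping.keys (m + n) \<subseteq> ?S" by (rule keys_add)
  then show ?thesis
    using mon_degree_superset[of ?S "m + n"] mon_degree_superset[of ?S m] mon_degree_superset[of ?S n]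
    by (simp add: lookup_add sum.distrib)
qed

lemma hpolys_mult [simp]: "p \<in> hpolys I j \<Longrightarrow> q \<in> hpolys I k \<Longrightarrow> p * q \<in> hpolys I (j + k)"
  using keys_mult[of p q] by (fastforce simp: hpolys_def mon_degree_add)

lemma hpolys_of_int [simp]: "of_int c \<in> hpolys I 0"
  by (simp add: hpolys_def) (auto simp: mon_degree_def simp flip: single_of_int)

lemma hpolys_Var: "v \<in> vars I \<Longrightarrow> Var v \<in> hpolys I 1"
  by (auto simp: hpolys_def polys_Var) (auto simp: Var_def mon_degree_def)

lemma hpolys_u_power: "Var Var_u ^ k \<in> hpolys I k"
proof (induction k)
  case 0
  show ?case using hpolys_of_int[of 1] by simp
next
  case (Suc k)
  then show ?case using hpolys_mult[OF hpolys_Var[of Var_u] Suc] by (simp add: vars_def)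
qed

text \<open>Ideals of subrings of a ring, so that the ring of polynomials over a smaller ground set can
  be compared with the one over a larger ground set.\<close>

inductive_set idl :: "'r::comm_ring_1 set \<Rightarrow> 'r set \<Rightarrow> 'r set" for A G where
  zero: "0 \<in> idl A G"
| step: "a \<in> A \<Longrightarrow> g \<in> G \<Longrightarrow> x \<in> idl A G \<Longrightarrow> a * g + x \<in> idl A G"

lemma idl_mono:
  assumes "x \<in> idl A G" "A \<subseteq> B" "G \<subseteq> H"
  shows "x \<in> idl B H"
  using assms(1) by induction (use assms in \<open>auto intro: idl.intros\<close>)

lemma idl_add [simp]: "x \<in> idl A G \<Longrightarrow> y \<in> idl A G \<Longrightarrow> x + y \<in> idl A G"
  by (induction rule: idl.induct) (auto simp: add.assoc intro: idl.intros)

lemma idl_sum: "(\<And>x. x \<in> A \<Longrightarrow> f x \<in> idl B G) \<Longrightarrow> sum f A \<in> idl B G"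
  by (induction A rule: infinite_finite_induct) (auto intro: idl.zero)

lemma idl_gen: "g \<in> G \<Longrightarrow> 1 \<in> A \<Longrightarrow> g \<in> idl A G"
  using idl.step[of 1 A g G 0] by (auto intro: idl.zero)

lemma idl_mult_left:
  assumes "x \<in> idl A G" "a \<in> A" "\<And>a b. a \<in> A \<Longrightarrow> b \<in> A \<Longrightarrow> a * b \<in> A"
  shows "a * x \<in> idl A G"
  using assms(1)
proof induction
  case zero
  show ?case by (simp add: idl.zero)
next
  case (step b g x)
  then have "(a * b) * g + a * x \<in> idl A G" using assms by (intro idl.step) auto
  then show ?case by (simp add: algebra_simps)
qed

lemma idl_polys_mult [simp]: "x \<in> idl (polys I) G \<Longrightarrow> a \<in> polys I \<Longrightarrow> a * x \<in> idl (polys I) G"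
  by (rule idl_mult_left) auto

lemma idl_polys_mult' [simp]: "x \<in> idl (polys I) G \<Longrightarrow> a \<in> polys I \<Longrightarrow> x * a \<in> idl (polys I) G"
  using idl_polys_mult[of x I G a] by (simp add: mult.commute)

lemma idl_polys_uminus [simp]: "x \<in> idl (polys I) G \<Longrightarrow> - x \<in> idl (polys I) G"
  using idl_polys_mult[of x I G "- 1"] by simp

lemma idl_polys_diff [simp]:
  "x \<in> idl (polys I) G \<Longrightarrow> y \<in> idl (polys I) G \<Longrightarrow> x - y \<in> idl (polys I) G"
  using idl_add[of x "polys I" G "- y"] by simp

lemma idl_polys_gen: "g \<in> G \<Longrightarrow> g \<in> idl (polys I) G"
  by (rule idl_gen) auto

lemma idl_subset:
  assumes "x \<in> idl A G" "G \<subseteq> A" "0 \<in> A" "\<And>a b. a \<in> A \<Longrightarrow> b \<in> A \<Longrightarrow> a * b \<in> A"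
    "\<And>a b. a \<in> A \<Longrightarrow> b \<in> A \<Longrightarrow> a + b \<in> A"
  shows "x \<in> A"
  using assms(1) by induction (use assms in auto)

lemma idl_polys_subset: "x \<in> idl (polys I) G \<Longrightarrow> G \<subseteq> polys I \<Longrightarrow> x \<in> polys I"
  by (rule idl_subset) auto

section \<open>Circuits and minors of conditional oriented matroids\<close>

text \<open>For signed sets the inclusions amount to \<open>composition X Y = Y\<close>, see
  \<open>faced_iff\<close>; in this form the property visibly passes to restrictions of X.\<close>

definition faced :: "'a signed set \<Rightarrow> 'a signed \<Rightarrow> bool" where
  "faced L X \<longleftrightarrow> (\<exists>Y\<in>L. fst X \<subseteq> fst Y \<and> snd X \<subseteq> snd Y)"

definition del :: "'a \<Rightarrow> 'a signed \<Rightarrow> 'a signed" where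
  "del i X = (fst X - {i}, snd X - {i})"

text \<open>Since \<open>faced\<close> passes to restrictions, minimality among all restrictions of
  X need only be tested on the removal of one element.\<close>

definition cmin :: "'a signed set \<Rightarrow> 'a signed \<Rightarrow> bool" where
  "cmin L X \<longleftrightarrow> \<not> faced L X \<and> (\<forall>i\<in>supp X. faced L (del i X))"

definition deletion :: "'a \<Rightarrow> 'a signed set \<Rightarrow> 'a signed set" where
  "deletion n L = del n ` L"

definition contraction :: "'a \<Rightarrow> 'a signed set \<Rightarrow> 'a signed set" where
  "contraction n L = {Y\<in>L. n \<notin> supp Y}"

lemma fst_del [simp]: "fst (del i X) = fst X - {i}" and snd_del [simp]: "snd (del i X) = snd X - {i}"
  and fst_opp [simp]: "fst (opp X) = snd X" and snd_opp [simp]: "snd (opp X) = fst X"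
  and opp_opp [simp]: "opp (opp X) = X" and supp_opp [simp]: "supp (opp X) = supp X"
  and supp_del [simp]: "supp (del i X) = supp X - {i}" and opp_del: "opp (del i X) = del i (opp X)"
  by (auto simp: del_def opp_def supp_def)

lemma signed_set_opp [simp]: "signed_set I (opp X) \<longleftrightarrow> signed_set I X"
  by (auto simp: signed_set_def)

lemma signed_set_del: "signed_set I X \<Longrightarrow> signed_set (I - {i}) (del i X)"
  by (auto simp: signed_set_def)

lemma fst_composition [simp]: "fst (composition X Y) = fst X \<union> (fst Y - supp X)"
  and snd_composition [simp]: "snd (composition X Y) = snd X \<union> (snd Y - supp X)"
  by (auto simp: composition_def)

lemma signed_eqI: "fst X = fst Y \<Longrightarrow> snd X = snd Y \<Longrightarrow> X = Y"
  by (rule prod_eqI)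

lemma sep_eq:
  assumes "signed_set I X" "signed_set J Y"
  shows "sep X Y = fst X \<inter> snd Y \<union> snd X \<inter> fst Y"
  using assms unfolding sep_def sign_at_def signed_set_def by (auto split: if_splits)

lemma sign_at_eq_iff:
  assumes "signed_set I X" "signed_set J Y"
  shows "sign_at X i = sign_at Y i \<longleftrightarrow> (i \<in> fst X \<longleftrightarrow> i \<in> fst Y) \<and> (i \<in> snd X \<longleftrightarrow> i \<in> snd Y)"
  using assms unfolding sign_at_def signed_set_def by (auto split: if_splits)

lemma sign_at_eq_0_iff: "sign_at X i = 0 \<longleftrightarrow> i \<notin> supp X"
  by (auto simp: sign_at_def supp_def)

lemma signed_set_composition:
  "signed_set I X \<Longrightarrow> signed_set I Y \<Longrightarrow> signed_set I (composition X Y)"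
  by (auto simp: signed_set_def supp_def)

section \<open>Composition and elimination of covectors\<close>

lemma com_signed: "conditional_oriented_matroid I L \<Longrightarrow> X \<in> L \<Longrightarrow> signed_set I X"
  by (simp add: conditional_oriented_matroid_def)

lemma com_comp_opp:
  "conditional_oriented_matroid I L \<Longrightarrow> X \<in> L \<Longrightarrow> Y \<in> L \<Longrightarrow> composition X (opp Y) \<in> L"
  by (simp add: conditional_oriented_matroid_def)

text \<open>Axiom (FS) negates the second factor. Applying it twice, X o -(X o -Y) = X o Y: the
  signs on the support of X are overwritten, the others are negated twice.\<close>

lemma com_comp:
  assumes "conditional_oriented_matroid I L" "X \<in> L" "Y \<in> L"
  shows "composition X Y \<in> L"
proof -
  have "composition X (opp (composition X (opp Y))) = composition X Y"
    using com_signed[OF assms(1,2)] by (intro signed_eqI) (auto simp: supp_def signed_set_def)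
  then show ?thesis using com_comp_opp[OF assms(1)] assms(2,3) by metis
qed

text \<open>Outside the separation set X and Y never conflict, so their composition there is the
  union of their signs. For j outside the ground set, where the axiom is silent, all three signed
  sets vanish.\<close>

lemma com_elim:
  assumes "conditional_oriented_matroid I L" "X \<in> L" "Y \<in> L"
    "i \<in> fst X \<inter> snd Y \<union> snd X \<inter> fst Y"
  obtains Z where "Z \<in> L" "i \<notin> supp Z"
    "\<And>j. j \<notin> fst X \<inter> snd Y \<union> snd X \<inter> fst Y \<Longrightarrow>
      (j \<in> fst Z \<longleftrightarrow> j \<in> fst X \<or> j \<in> fst Y) \<and> (j \<in> snd Z \<longleftrightarrow> j \<in> snd X \<or> j \<in> snd Y)"
proof -
  note sX = com_signed[OF assms(1,2)] and sY = com_signed[OF assms(1,3)]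
  from assms obtain Z where Z: "Z \<in> L" "sign_at Z i = 0"
    and eq: "\<forall>j\<in>I - sep X Y. sign_at Z j = sign_at (composition X Y) j"
    unfolding conditional_oriented_matroid_def sep_eq[OF sX sY, symmetric] by meson
  note sZ = com_signed[OF assms(1) Z(1)]
  have "(j \<in> fst Z \<longleftrightarrow> j \<in> fst X \<or> j \<in> fst Y) \<and> (j \<in> snd Z \<longleftrightarrow> j \<in> snd X \<or> j \<in> snd Y)"
    if j: "j \<notin> fst X \<inter> snd Y \<union> snd X \<inter> fst Y" for j
  proof (cases "j \<in> I")
    case True
    then have "sign_at Z j = sign_at (composition X Y) j"
      using eq j sep_eq[OF sX sY] by blast
    then show ?thesis
      using j unfolding sign_at_eq_iff[OF sZ signed_set_composition[OF sX sY]]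
      by (auto simp: supp_def)
  next
    case False
    then show ?thesis using sX sY sZ by (auto simp: signed_set_def)
  qed
  with Z show ?thesis by (intro that) (auto simp: sign_at_eq_0_iff)
qed

text \<open>A signed set below both X and Y avoids their separation set, so elimination leaves its
  signs untouched.\<close>

lemma com_elim_below:
  assumes "conditional_oriented_matroid I L" "X \<in> L" "Y \<in> L"
    "i \<in> fst X \<inter> snd Y \<union> snd X \<inter> fst Y"
    "fst W \<subseteq> fst X" "fst W \<subseteq> fst Y" "snd W \<subseteq> snd X" "snd W \<subseteq> snd Y"
  shows "faced (contraction i L) W"
proof -
  obtain Z where Z: "Z \<in> L" "i \<notin> supp Z"
    "\<And>j. j \<notin> fst X \<inter> snd Y \<union> snd X \<inter> fst Y \<Longrightarrow>
      (j \<in> fst Z \<longleftrightarrow> j \<in> fst X \<or> j \<in> fst Y) \<and> (j \<in> snd Z \<longleftrightarrow> j \<in> snd X \<or> j \<in> snd Y)"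
    using com_elim[OF assms(1-4)] by blast
  have "fst W \<subseteq> fst Z" "snd W \<subseteq> snd Z"
    using Z(3) assms(5-8) com_signed[OF assms(1,2)] com_signed[OF assms(1,3)]
    by (fastforce simp: signed_set_def)+
  then show ?thesis using Z(1,2) unfolding faced_def contraction_def by blast
qed

text \<open>The zeros of Y are filled with the signs of U.\<close>

lemma faced_comp:
  assumes "conditional_oriented_matroid I L" "Y \<in> L" "U \<in> L"
    "fst W \<subseteq> fst Y \<union> (fst U - snd Y)" "snd W \<subseteq> snd Y \<union> (snd U - fst Y)"
  shows "faced L W"
proof -
  have "composition Y U \<in> L" using com_comp assms by blast
  then show ?thesis unfolding faced_def using assms(4,5)
    by (intro bexI[of _ "composition Y U"]) (auto simp: supp_def)
qed

lemma faced_comp_opp: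
  assumes "conditional_oriented_matroid I L" "Y \<in> L" "U \<in> L"
    "fst W \<subseteq> fst Y \<union> (snd U - snd Y)" "snd W \<subseteq> snd Y \<union> (fst U - fst Y)"
  shows "faced L W"
proof -
  have "composition Y (opp U) \<in> L" using com_comp_opp assms by blast
  then show ?thesis unfolding faced_def using assms(4,5)
    by (intro bexI[of _ "composition Y (opp U)"]) (auto simp: supp_def)
qed

lemma faced_contraction: "faced (contraction n L) X \<Longrightarrow> faced L X"
  unfolding faced_def contraction_def by blast

section \<open>Contraction and deletion as conditional oriented matroids\<close>

lemma com_contraction:
  assumes "conditional_oriented_matroid I L"
  shows "conditional_oriented_matroid (I - {n}) (contraction n L)"
proof -
  have sg: "signed_set (I - {n}) X" if "X \<in> contraction n L" for X
    using com_signed[OF assms, of X] that by (auto simp: contraction_def signed_set_def supp_def)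
  have FS: "composition X (opp Y) \<in> contraction n L"
    if "X \<in> contraction n L" "Y \<in> contraction n L" for X Y
    using that com_comp_opp[OF assms, of X Y] by (auto simp: contraction_def supp_def)
  have SE: "\<exists>Z\<in>contraction n L. sign_at Z i = 0 \<and>
      (\<forall>j\<in>I - {n} - sep X Y. sign_at Z j = sign_at (composition X Y) j)"
    if X: "X \<in> contraction n L" and Y: "Y \<in> contraction n L" and i: "i \<in> sep X Y" for X Y i
  proof -
    note sX = sg[OF X] and sY = sg[OF Y]
    have XY: "X \<in> L" "Y \<in> L" "n \<notin> supp X" "n \<notin> supp Y" using X Y by (auto simp: contraction_def)
    obtain Z where Z: "Z \<in> L" "i \<notin> supp Z"
      "\<And>j. j \<notin> fst X \<inter> snd Y \<union> snd X \<inter> fst Y \<Longrightarrow>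
      (j \<in> fst Z \<longleftrightarrow> j \<in> fst X \<or> j \<in> fst Y) \<and> (j \<in> snd Z \<longleftrightarrow> j \<in> snd X \<or> j \<in> snd Y)"
      using com_elim[OF assms XY(1,2)] i unfolding sep_eq[OF sX sY] by metis
    \<comment> \<open>Both covectors vanish at n, so n is not separated and Z keeps the
      zero.\<close>
    have "n \<notin> supp Z" using XY Z(3)[of n] by (auto simp: supp_def)
    moreover have "sign_at Z j = sign_at (composition X Y) j" if "j \<notin> sep X Y" for j
      using Z(3)[of j] that
      unfolding sign_at_eq_iff[OF com_signed[OF assms Z(1)] signed_set_composition[OF sX sY]] sep_eq[OF sX sY]
      by (auto simp: supp_def)
    ultimately show ?thesis using Z by (intro bexI[of _ Z]) (auto simp: contraction_def sign_at_eq_0_iff)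
  qed
  show ?thesis unfolding conditional_oriented_matroid_def using sg FS SE by blast
qed

lemma com_deletion:
  assumes "conditional_oriented_matroid I L"
  shows "conditional_oriented_matroid (I - {n}) (deletion n L)"
proof -
  have sg: "signed_set (I - {n}) X" if "X \<in> deletion n L" for X
    using com_signed[OF assms] that by (auto simp: deletion_def intro: signed_set_del)
  have FS: "composition (del n X) (opp (del n Y)) \<in> deletion n L" if "X \<in> L" "Y \<in> L" for X Y
  proof -
    have "composition (del n X) (opp (del n Y)) = del n (composition X (opp Y))"
      by (intro signed_eqI) (auto simp: supp_def)
    then show ?thesis using com_comp_opp[OF assms that] by (auto simp: deletion_def)
  qed
  have SE: "\<exists>Z\<in>deletion n L. sign_at Z i = 0 \<and>
      (\<forall>j\<in>I - {n} - sep (del n X) (del n Y). sign_at Z j = sign_at (composition (del n X) (del n Y)) j)"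
    if X: "X \<in> L" and Y: "Y \<in> L" and i: "i \<in> sep (del n X) (del n Y)" for X Y i
  proof -
    note sX' = com_signed[OF assms X] and sY' = com_signed[OF assms Y]
    note sX = signed_set_del[OF sX', of n] and sY = signed_set_del[OF sY', of n]
    obtain Z where Z: "Z \<in> L" "i \<notin> supp Z"
      "\<And>j. j \<notin> fst X \<inter> snd Y \<union> snd X \<inter> fst Y \<Longrightarrow>
      (j \<in> fst Z \<longleftrightarrow> j \<in> fst X \<or> j \<in> fst Y) \<and> (j \<in> snd Z \<longleftrightarrow> j \<in> snd X \<or> j \<in> snd Y)"
      using com_elim[OF assms X Y, of i] i unfolding sep_eq[OF sX sY] by auto
    note sZ = signed_set_del[OF com_signed[OF assms Z(1)], of n]
    have "sign_at (del n Z) j = sign_at (composition (del n X) (del n Y)) j"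
      if "j \<notin> sep (del n X) (del n Y)" for j
      using Z(3)[of j] that
      unfolding sign_at_eq_iff[OF sZ signed_set_composition[OF sX sY]] sep_eq[OF sX sY]
      by (auto simp: supp_def)
    then show ?thesis using Z by (intro bexI[of _ "del n Z"]) (auto simp: deletion_def sign_at_eq_0_iff)
  qed
  show ?thesis unfolding conditional_oriented_matroid_def
    using sg FS SE by (auto simp: deletion_def)
qed

text \<open>If Y had the sign of X at i, then X would lie below Y. If Y vanished at i, one could
  compose Y with a covector above X without j, which has the sign of X at i, and X would lie below
  the result. The second element j serves to provide that covector.\<close>

lemma cmin_flip:
  assumes com: "conditional_oriented_matroid I L" and X: "cmin L X"
    and ij: "i \<in> supp X" "j \<in> supp X" "i \<noteq> j"
    and Y: "Y \<in> L" "fst X - {i} \<subseteq> fst Y" "snd X - {i} \<subseteq> snd Y"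
  shows "i \<in> fst X \<Longrightarrow> i \<in> snd Y" "i \<in> snd X \<Longrightarrow> i \<in> fst Y"
proof -
  have "faced L (del j X)" using X ij by (simp add: cmin_def)
  then obtain V where V: "V \<in> L" "fst X - {j} \<subseteq> fst V" "snd X - {j} \<subseteq> snd V"
    unfolding faced_def by auto
  have nf: "\<not> (fst X \<subseteq> fst Y \<union> (fst V - snd Y) \<and> snd X \<subseteq> snd Y \<union> (snd V - fst Y))"
    using X faced_comp[OF com Y(1) V(1), of X] unfolding cmin_def by blast
  have V': "fst V \<inter> snd V = {}" using com_signed[OF com V(1)] by (simp add: signed_set_def)
  have iV: "i \<in> fst X \<Longrightarrow> i \<in> fst V" "i \<in> snd X \<Longrightarrow> i \<in> snd V" using V(2,3) ij(3) by auto
  show "i \<in> snd Y" if "i \<in> fst X"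
  proof (rule ccontr)
    assume "i \<notin> snd Y"
    moreover have "i \<notin> snd X" using iV that V' by blast
    ultimately show False using nf iV(1)[OF that] Y(2,3) by blast
  qed
  show "i \<in> fst Y" if "i \<in> snd X"
  proof (rule ccontr)
    assume "i \<notin> fst Y"
    moreover have "i \<notin> fst X" using iV that V' by blast
    ultimately show False using nf iV(2)[OF that] Y(2,3) by blast
  qed
qed

text \<open>By \<open>cmin_flip\<close> no covector above X without i vanishes at i. For another
  element k, covectors above X without i and above X without k have opposite signs at i, and
  eliminating i between them gives the covector needed for minimality.\<close>

lemma cmin_contraction:
  assumes com: "conditional_oriented_matroid I L" and X: "cmin L X"
    and ij: "i \<in> supp X" "j \<in> supp X" "i \<noteq> j"
  shows "cmin (contraction i L) (del i X)"
  unfolding cmin_def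
proof safe
  assume "faced (contraction i L) (del i X)"
  then obtain Y where Y: "Y \<in> L" "i \<notin> supp Y" "fst X - {i} \<subseteq> fst Y" "snd X - {i} \<subseteq> snd Y"
    unfolding faced_def contraction_def by auto
  show False using cmin_flip[OF com X ij Y(1,3,4)] ij Y(2) by (auto simp: supp_def)
next
  fix k assume "k \<in> supp (del i X)"
  then have k: "k \<in> supp X" "i \<noteq> k" by auto
  from X ij k obtain V W where
    V: "V \<in> L" "fst X - {i} \<subseteq> fst V" "snd X - {i} \<subseteq> snd V" and
    W: "W \<in> L" "fst X - {k} \<subseteq> fst W" "snd X - {k} \<subseteq> snd W"
    unfolding cmin_def faced_def by (metis fst_del snd_del)
  have "i \<in> fst V \<inter> snd W \<union> snd V \<inter> fst W"
    using cmin_flip[OF com X ij(1) k V] ij(1) k W by (auto simp: supp_def)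
  then show "faced (contraction i L) (del k (del i X))"
    using V W by (intro com_elim_below[OF com V(1) W(1)]) auto
qed

text \<open>Contract an element i at which T and X differ. A covector V above X without i is forced
  to have the sign of T at i. The induction hypothesis supplies a covector above the rest of T that
  vanishes at i, and composing it with V restores the sign there.\<close>

lemma cmin_faced:
  assumes "conditional_oriented_matroid I L" "cmin L X" "finite (supp X)"
    "signed_set I X" "signed_set I T" "supp T = supp X" "T \<noteq> X" "T \<noteq> opp X"
  shows "faced L T"
  using assms
proof (induction "card (supp X)" arbitrary: I L X T rule: less_induct)
  case less
  note com = less.prems(1) and X = less.prems(2) and fin = less.prems(3)
  \<comment> \<open>As the supports agree, N collects the elements where T and X have opposite
    signs; it is nonempty because T is not X, and proper because T is not -X. When N has a second
    element l, the elements l and k keep the restricted T different from both restricted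
    patterns.\<close>
  define N where "N = {i \<in> supp X. \<not> (i \<in> fst X \<longleftrightarrow> i \<in> fst T)}"
  have sgX: "fst X \<inter> snd X = {}" and sgT: "fst T \<inter> snd T = {}"
    using less.prems by (auto simp: signed_set_def)
  have "N \<noteq> {}"
  proof
    assume "N = {}"
    then have "T = X" using less.prems(6) sgX sgT unfolding N_def supp_def
      by (intro signed_eqI) blast+
    with less.prems show False by simp
  qed
  have "N \<noteq> supp X"
  proof
    assume "N = supp X"
    then have "T = opp X" using less.prems(6) sgX sgT unfolding N_def supp_def
      by (intro signed_eqI; simp) blast+
    with less.prems show False by simp
  qed
  from \<open>N \<noteq> {}\<close> obtain i where i: "i \<in> N" by auto
  from \<open>N \<noteq> supp X\<close> obtain k where k: "k \<in> supp X" "k \<notin> N" by (auto simp: N_def)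
  have ik: "i \<in> supp X" "k \<in> supp X" "i \<noteq> k" using i k by (auto simp: N_def)
  have "faced L (del i X)" using X ik by (simp add: cmin_def)
  then obtain V where V: "V \<in> L" "fst X - {i} \<subseteq> fst V" "snd X - {i} \<subseteq> snd V"
    unfolding faced_def by auto
  note flip = cmin_flip[OF com X ik V]
  have flipT: "i \<in> fst T \<Longrightarrow> i \<in> fst V" "i \<in> snd T \<Longrightarrow> i \<in> snd V" "i \<in> supp T"
    using flip i less.prems(6) sgT sgX unfolding N_def supp_def by blast+
  show ?case
  proof (cases "N = {i}")
    case True
    then have "\<And>j. j \<in> supp X \<Longrightarrow> j \<noteq> i \<Longrightarrow> (j \<in> fst X \<longleftrightarrow> j \<in> fst T)"
      by (auto simp: N_def)
    then have eq: "fst T - {i} = fst X - {i}"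
      using less.prems(6) by (auto simp: supp_def)
    then have "snd T - {i} = snd X - {i}"
      using less.prems(6) sgX sgT by (auto simp: supp_def)
    with eq have "fst T \<subseteq> fst V" "snd T \<subseteq> snd V"
      using flipT V(2,3) by auto
    then show ?thesis using V unfolding faced_def by blast
  next
    case False
    with i obtain l where l: "l \<in> N" "l \<noteq> i" by blast
    have "faced (contraction i L) (del i T)"
    proof (rule less.hyps[OF _ com_contraction[OF com] cmin_contraction[OF com X ik]])
      show "card (supp (del i X)) < card (supp X)"
        by (metis card_Diff1_less fin ik(1) supp_del)
      show "finite (supp (del i X))" "supp (del i T) = supp (del i X)"
        using fin less.prems(6) by auto
      show "signed_set (I - {i}) (del i X)" "signed_set (I - {i}) (del i T)"
        by (rule signed_set_del[OF less.prems(4)], rule signed_set_del[OF less.prems(5)])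
      have "\<not> (l \<in> fst (del i T) \<longleftrightarrow> l \<in> fst (del i X))"
        using l by (auto simp: N_def)
      then show "del i T \<noteq> del i X" by metis
      have "\<not> (k \<in> fst (del i T) \<longleftrightarrow> k \<in> fst (opp (del i X)))"
        using k ik sgX by (auto simp: N_def supp_def)
      then show "del i T \<noteq> opp (del i X)" by metis
    qed
    then obtain Y where Y: "Y \<in> L" "i \<notin> supp Y" "fst T - {i} \<subseteq> fst Y" "snd T - {i} \<subseteq> snd Y"
      unfolding faced_def contraction_def by auto
    show ?thesis
      using Y flipT by (intro faced_comp[OF com Y(1) V(1)]) (auto simp: supp_def)
  qed
qed

text \<open>Contracting the elements of the support one by one keeps X and -X minimal until a single
  element is left, and every covector of a contraction vanishes at the contracted elements.\<close>

lemma cmin_opp_zero: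
  assumes "conditional_oriented_matroid I L" "cmin L X" "cmin L (opp X)" "finite (supp X)" "supp X \<noteq> {}"
    "fst X \<inter> snd X = {}"
  shows "\<exists>Z\<in>L. supp Z \<inter> supp X = {}"
  using assms
proof (induction "card (supp X)" arbitrary: I L X rule: less_induct)
  case less
  note com = less.prems(1) and X = less.prems(2) and oX = less.prems(3)
  from less.prems obtain i where i: "i \<in> supp X" by auto
  show ?case
  proof (cases "supp X = {i}")
    case True
    \<comment> \<open>Minimality provides some covector at all. It cannot have either sign at i,
      since neither X nor -X lies below it.\<close>
    from X i obtain Z where Z: "Z \<in> L" by (auto simp: cmin_def faced_def)
    have "i \<notin> supp Z"
    proof
      assume "i \<in> supp Z"
      then have "fst X \<subseteq> fst Z \<and> snd X \<subseteq> snd Z \<or> snd X \<subseteq> fst Z \<and> fst X \<subseteq> snd Z"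
        using True less.prems(6) by (auto simp: supp_def Un_singleton_iff)
      then show False using X oX Z unfolding cmin_def faced_def by auto
    qed
    with Z True show ?thesis by (intro bexI[of _ Z]) auto
  next
    case False
    with i obtain j where j: "j \<in> supp X" "i \<noteq> j" by blast
    have "card (supp (del i X)) < card (supp X)"
      by (metis card_Diff1_less i less.prems(4) supp_del)
    then have "\<exists>Z\<in>contraction i L. supp Z \<inter> supp (del i X) = {}"
      using less.prems i j cmin_contraction[OF com X i j] cmin_contraction[OF com oX, of i j]
      by (intro less.hyps[OF _ com_contraction[OF com]]) (auto simp: opp_del)
    then show ?thesis by (auto simp: contraction_def)
  qed
qed

section \<open>Circuits as minimal signed sets below no covector\<close>

lemma composition_absorb_iff:
  "signed_set I Y \<Longrightarrow> composition X Y = Y \<longleftrightarrow> fst X \<subseteq> fst Y \<and> snd X \<subseteq> snd Y"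
  unfolding signed_set_def composition_def supp_def by (auto simp: prod_eq_iff)

lemma faced_iff:
  assumes "conditional_oriented_matroid I L"
  shows "faced L X \<longleftrightarrow> (\<exists>Y\<in>L. composition X Y = Y)"
  using composition_absorb_iff[OF com_signed[OF assms]] by (auto simp: faced_def)

text \<open>A circuit is by definition minimal among all signed sets of smaller support, not only among its
  own restrictions; by \<open>cmin_faced\<close> this makes no difference.\<close>

lemma circuits_eq:
  assumes com: "conditional_oriented_matroid I L" and "finite I"
  shows "circuits I L = {X. signed_set I X \<and> cmin L X}"
proof (intro equalityI subsetI CollectI conjI)
  fix X assume "X \<in> circuits I L"
  then have X: "signed_set I X" "\<not> faced L X"
    "\<And>Z. signed_set I Z \<Longrightarrow> supp Z \<subset> supp X \<Longrightarrow> faced L Z"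
    unfolding circuits_def faced_iff[OF com] mem_Collect_eq by blast+
  show "signed_set I X" by fact
  have "faced L (del i X)" if "i \<in> supp X" for i
    using X(1) that by (intro X(3)) (auto simp: signed_set_def)
  with X show "cmin L X" by (simp add: cmin_def)
next
  fix X assume "X \<in> {X. signed_set I X \<and> cmin L X}"
  then have X: "signed_set I X" "cmin L X" by auto
  have fin: "finite (supp X)"
    using X(1) \<open>finite I\<close> by (auto simp: signed_set_def supp_def intro: finite_subset)
  have "faced L Z" if Z: "signed_set I Z" "supp Z \<subset> supp X" for Z
  proof (cases "supp Z = {}")
    case True
    from Z(2) obtain i where "i \<in> supp X" by auto
    with X(2) have "faced L (del i X)" by (simp add: cmin_def)
    with True show ?thesis unfolding faced_def supp_def by blast
  next
    case False
    then obtain z where z: "z \<in> supp Z" by auto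
    from Z(2) obtain k where k: "k \<in> supp X" "k \<notin> supp Z" by auto
    have fc: "faced L (composition Z T) \<Longrightarrow> faced L Z" for T
      unfolding faced_def by auto
    \<comment> \<open>Z is completed to the support of X by X or by -X. The element k outside the
      support of Z rules out these two coincidences.\<close>
    have ne: "composition Z X \<noteq> opp X" "composition Z (opp X) \<noteq> X"
      using k X(1) by (auto simp: supp_def signed_set_def prod_eq_iff)
    \<comment> \<open>At z the two completions have the same sign, while X and -X differ there.
      Hence some completion is neither X nor -X, and \<open>cmin_faced\<close> applies to
      it.\<close>
    have "composition Z X \<noteq> X \<or> composition Z (opp X) \<noteq> opp X"
      using z Z X(1) unfolding composition_absorb_iff[OF X(1)]
      by (subst composition_absorb_iff[of I]) (auto simp: supp_def signed_set_def)
    then show ?thesis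
    proof
      assume "composition Z X \<noteq> X"
      then have "faced L (composition Z X)"
        using ne Z X(1) by (intro cmin_faced[OF com X(2) fin X(1)] signed_set_composition)
          (auto simp: supp_def)
      then show ?thesis by (rule fc)
    next
      assume "composition Z (opp X) \<noteq> opp X"
      then have "faced L (composition Z (opp X))"
        using ne Z X(1) by (intro cmin_faced[OF com X(2) fin X(1)] signed_set_composition)
          (auto simp: supp_def)
      then show ?thesis by (rule fc)
    qed
  qed
  moreover have "\<not> faced L X" using X by (simp add: cmin_def)
  ultimately show "X \<in> circuits I L"
    using X(1) unfolding circuits_def faced_iff[OF com] mem_Collect_eq by blast
qed

text \<open>Elements are removed as long as what remains is below no covector; on a finite support
  this ends at a minimal signed set.\<close>

lemma not_faced_circuit:
  assumes com: "conditional_oriented_matroid I L" and fin: "finite I"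
    and X: "signed_set I X" "\<not> faced L X"
  obtains C where "C \<in> circuits I L" "fst C \<subseteq> fst X" "snd C \<subseteq> snd X"
proof -
  have "\<exists>C. signed_set I C \<and> cmin L C \<and> fst C \<subseteq> fst X \<and> snd C \<subseteq> snd X"
    using X
  proof (induction "card (supp X)" arbitrary: X rule: less_induct)
    case less
    show ?case
    proof (cases "cmin L X")
      case False
      with less.prems obtain i where i: "i \<in> supp X" "\<not> faced L (del i X)"
        by (auto simp: cmin_def)
      have "finite (supp X)"
        using less.prems fin by (auto simp: signed_set_def supp_def intro: finite_subset)
      then have "card (supp (del i X)) < card (supp X)"
        by (metis card_Diff1_less i(1) supp_del)
      moreover have "signed_set I (del i X)" using less.prems by (auto simp: signed_set_def)
      ultimately obtain C where "signed_set I C" "cmin L C" "fst C \<subseteq> fst (del i X)"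
        "snd C \<subseteq> snd (del i X)"
        using less.hyps i(2) by blast
      then show ?thesis by (intro exI[of _ C]) auto
    qed (use less.prems in blast)
  qed
  with that show ?thesis by (auto simp: circuits_eq[OF com fin])
qed

lemma faced_deletion: "n \<notin> supp X \<Longrightarrow> faced (deletion n L) X \<longleftrightarrow> faced L X"
  unfolding faced_def deletion_def supp_def by (simp add: subset_Diff_insert)

lemma circuits_deletion:
  assumes "conditional_oriented_matroid I L" "finite I"
  shows "circuits (I - {n}) (deletion n L) \<subseteq> circuits I L"
proof
  fix X assume "X \<in> circuits (I - {n}) (deletion n L)"
  then have X: "signed_set (I - {n}) X" "cmin (deletion n L) X"
    using assms by (auto simp: circuits_eq[OF com_deletion])
  then have "n \<notin> supp X" by (auto simp: signed_set_def supp_def)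
  then have "cmin L X" using X by (simp add: cmin_def faced_deletion)
  with X show "X \<in> circuits I L" using assms by (auto simp: circuits_eq signed_set_def)
qed

text \<open>Composing Z with the negative of a covector above W reverses the signs on the support of
  W, where Z vanishes.\<close>

lemma faced_opp:
  assumes com: "conditional_oriented_matroid I L" and Z: "Z \<in> L" "supp Z \<inter> supp W = {}"
    and W: "faced L W"
  shows "faced L (opp W)"
proof -
  from W obtain Y where Y: "Y \<in> L" "fst W \<subseteq> fst Y" "snd W \<subseteq> snd Y"
    unfolding faced_def by blast
  show ?thesis using Y Z by (intro faced_comp_opp[OF com Z(1) Y(1)]) (auto simp: supp_def)
qed

section \<open>The polynomials vanishing on the topes\<close>

abbreviation "uu \<equiv> Var Var_u"
abbreviation "pp i \<equiv> Var (Var_plus i)"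
abbreviation "mm i \<equiv> Var (Var_minus i)"

definition ep :: "'a signed \<Rightarrow> 'a mpoly" where
  "ep X = (\<Prod>i\<in>fst X. pp i) * (\<Prod>i\<in>snd X. - mm i)"

definition Rgens :: "'a set \<Rightarrow> 'a mpoly set" where
  "Rgens I = (\<lambda>i. pp i * mm i) ` I \<union> (\<lambda>i. pp i + mm i - uu) ` I"

text \<open>Polynomial representatives of f_X. A relation is used instead of a choice, because f_X
  fixes a polynomial only modulo the relations of R and the induction builds its own
  representatives.\<close>

definition is_f :: "'a set \<Rightarrow> 'a signed \<Rightarrow> 'a mpoly \<Rightarrow> bool" where
  "is_f I X f \<longleftrightarrow> f \<in> polys I \<and> uu * f - (ep X - ep (opp X)) \<in> idl (polys I) (Rgens I)"

definition Kgens :: "'a set \<Rightarrow> 'a signed set \<Rightarrow> 'a mpoly set" where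
  "Kgens I L = Rgens I \<union> ep ` circuits I L \<union>
     {f. \<exists>X\<in>circuits I L. opp X \<in> circuits I L \<and> is_f I X f}"

text \<open>The preimage of I + J in the polynomial ring, generated by the relations of R and all
  representatives of the generators of I and J.\<close>

definition kernel_ideal :: "'a set \<Rightarrow> 'a signed set \<Rightarrow> 'a mpoly set" where
  "kernel_ideal I L = idl (polys I) (Kgens I L)"

lemma Rgens_mono: "I \<subseteq> J \<Longrightarrow> Rgens I \<subseteq> Rgens J"
  by (auto simp: Rgens_def)

lemma Rgens_polys: "Rgens I \<subseteq> polys I"
  by (auto simp: Rgens_def)

lemma ep_polys: "signed_set I X \<Longrightarrow> ep X \<in> polys I"
  unfolding ep_def signed_set_def by (intro polys_mult polys_prod) (auto intro!: polys_uminus)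

lemma Kgens_polys: "Kgens I L \<subseteq> polys I"
  using Rgens_polys[of I] by (auto simp: Kgens_def is_f_def circuits_def intro: ep_polys)

lemma kernel_ideal_polys: "x \<in> kernel_ideal I L \<Longrightarrow> x \<in> polys I"
  unfolding kernel_ideal_def by (rule idl_polys_subset[OF _ Kgens_polys])

lemma idl_Rgens_kernel: "x \<in> idl (polys I) (Rgens I) \<Longrightarrow> x \<in> kernel_ideal I L"
  unfolding kernel_ideal_def by (erule idl_mono) (auto simp: Kgens_def)

lemma kernel_ideal_0 [simp]: "0 \<in> kernel_ideal I L"
  and kernel_ideal_add [simp]: "x \<in> kernel_ideal I L \<Longrightarrow> y \<in> kernel_ideal I L \<Longrightarrow> x + y \<in> kernel_ideal I L"
  and kernel_ideal_mult [simp]: "x \<in> kernel_ideal I L \<Longrightarrow> a \<in> polys I \<Longrightarrow> a * x \<in> kernel_ideal I L"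
  and kernel_ideal_gen: "x \<in> Kgens I L \<Longrightarrow> x \<in> kernel_ideal I L"
  unfolding kernel_ideal_def by (simp_all add: idl.zero idl_polys_gen)

lemma ep_opp_insert:
  assumes "n \<notin> supp X" "finite (supp X)"
  shows "ep (insert n (fst X), snd X) = pp n * ep X" "ep (fst X, insert n (snd X)) = - mm n * ep X"
  using assms by (simp_all add: ep_def supp_def algebra_simps)

lemma ep_factor:
  assumes "finite I" "signed_set I X" "fst C \<subseteq> fst X" "snd C \<subseteq> snd X"
  obtains q where "q \<in> polys I" "ep X = q * ep C"
proof -
  have fin: "finite (fst X)" "finite (snd X)"
    using assms by (auto simp: signed_set_def intro: finite_subset)
  have "ep X = ep (fst X - fst C, snd X - snd C) * ep C"
    using prod.subset_diff[OF assms(3) fin(1), of pp] prod.subset_diff[OF assms(4) fin(2), of "\<lambda>i. - mm i"]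
    by (simp add: ep_def)
  moreover have "ep (fst X - fst C, snd X - snd C) \<in> polys I"
    using assms(2) by (intro ep_polys) (auto simp: signed_set_def)
  ultimately show ?thesis by (rule that[rotated])
qed

text \<open>There is a circuit C below X, and e_C divides e_X.\<close>

lemma not_faced_ep:
  assumes "conditional_oriented_matroid I L" "finite I" "signed_set I X" "\<not> faced L X"
  shows "ep X \<in> kernel_ideal I L"
proof -
  obtain C where C: "C \<in> circuits I L" "fst C \<subseteq> fst X" "snd C \<subseteq> snd X"
    using not_faced_circuit[OF assms] .
  obtain q where "q \<in> polys I" "ep X = q * ep C"
    using ep_factor[OF assms(2,3) C(2,3)] .
  moreover have "ep C \<in> kernel_ideal I L" using C by (intro kernel_ideal_gen) (auto simp: Kgens_def)
  ultimately show ?thesis by simp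
qed

lemma is_f_mono: "is_f J X f \<Longrightarrow> J \<subseteq> I \<Longrightarrow> is_f I X f"
  unfolding is_f_def using polys_mono[of J I] idl_mono[OF _ polys_mono Rgens_mono, of _ J J I I] by blast

lemma is_f_opp: "is_f I X f \<Longrightarrow> is_f I (opp X) (- f)"
  unfolding is_f_def using idl_polys_uminus[of "uu * f - (ep X - ep (opp X))" I "Rgens I"]
  by (simp add: algebra_simps)

lemma idl_Rgens_sum: "i \<in> I \<Longrightarrow> pp i + mm i - uu \<in> idl (polys I) (Rgens I)"
  and idl_Rgens_prod: "i \<in> I \<Longrightarrow> pp i * mm i \<in> idl (polys I) (Rgens I)"
  by (auto simp: Rgens_def intro: idl_polys_gen)

text \<open>From u - e_n^+ = e_n^- one gets u (e_n^+ f + e_{-X}) = e_n^+ e_X + e_n^- e_{-X}, and the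
  last summand is minus the e of the opposite extension, whose factor at n is -e_n^-.\<close>

lemma is_f_insert:
  assumes X: "signed_set I X" "finite I" and n: "n \<in> I" "n \<notin> supp X" and f: "is_f I X f"
  shows "is_f I (insert n (fst X), snd X) (pp n * f + ep (opp X))"
proof -
  have fin: "finite (supp X)" using X by (auto simp: signed_set_def supp_def intro: finite_subset)
  have "ep (opp (insert n (fst X), snd X)) = - mm n * ep (opp X)"
    using ep_opp_insert(2)[of n "opp X"] n fin by (metis fst_opp opp_def prod.sel snd_opp supp_opp)
  moreover have "ep (insert n (fst X), snd X) = pp n * ep X"
    using ep_opp_insert(1)[of n X] n fin by simp
  ultimately have eq: "uu * (pp n * f + ep (opp X)) - (ep (insert n (fst X), snd X) - ep (opp (insert n (fst X), snd X)))
      = pp n * (uu * f - (ep X - ep (opp X))) - ep (opp X) * (pp n + mm n - uu)" (is "_ = ?r")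
    by (simp add: algebra_simps)
  have ox: "ep (opp X) \<in> polys I" using X by (simp add: ep_polys)
  have "?r \<in> idl (polys I) (Rgens I)"
    using f n ox by (auto simp: is_f_def intro!: idl_polys_diff idl_polys_mult idl_Rgens_sum)
  with eq show ?thesis using f n ox by (simp add: is_f_def)
qed

text \<open>The division by u is carried out one element at a time, starting from f = 0 for the
  empty signed set, whose e equals that of its opposite.\<close>

lemma is_f_exists:
  assumes "finite I" "signed_set I X"
  shows "\<exists>f. is_f I X f"
proof -
  have "finite (supp X)" using assms by (auto simp: signed_set_def supp_def intro: finite_subset)
  then show ?thesis using assms(2)
  proof (induction "supp X" arbitrary: X rule: finite_induct)
    case empty
    then have "X = ({}, {})" by (auto simp: supp_def prod_eq_iff)
    then have "is_f I X 0" by (simp add: is_f_def ep_def opp_def idl.zero)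
    then show ?case ..
  next
    case (insert n A)
    have A: "A = supp (del n X)" using insert by auto
    have sg: "signed_set I (del n X)" using insert.prems by (auto simp: signed_set_def)
    obtain f where f: "is_f I (del n X) f" using insert.hyps(3)[OF A sg] by auto
    have n: "n \<in> I" using insert by (auto simp: signed_set_def supp_def)
    consider "n \<in> fst X" | "n \<in> snd X" using insert by (auto simp: supp_def)
    then show ?case
    proof cases
      case 1
      then have "X = (insert n (fst (del n X)), snd (del n X))"
        using insert.prems by (auto simp: signed_set_def prod_eq_iff)
      then show ?thesis using is_f_insert[OF sg assms(1) n _ f] by auto
    next
      case 2
      \<comment> \<open>A negative element is added by passing to the opposite signed set, which
        only changes the sign of f.\<close>
      then have X: "opp X = (insert n (fst (opp (del n X))), snd (opp (del n X)))"
        using insert.prems by (auto simp: signed_set_def prod_eq_iff)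
      obtain g where "is_f I (opp X) g"
        using is_f_insert[OF _ assms(1) n _ is_f_opp[OF f]] sg X by auto
      then show ?thesis using is_f_opp[of I "opp X" g] by auto
    qed
  qed
qed

text \<open>X may be any pair of sets, tope or not: \<open>var_value\<close> gives e_i^- the value 1
  also where X vanishes at i, so exactly one of e_i^+ and e_i^- has the value of u.\<close>

lemma ev_Rgens: "x \<in> idl (polys I) (Rgens I) \<Longrightarrow> ev X x = 0"
  by (induction rule: idl.induct) (auto simp: Rgens_def mult_monom add_monom diff_monom split: if_splits)

lemma monom_1_mult_eq_0: "Polynomial.monom (1::int) 1 * p = 0 \<Longrightarrow> p = 0"
  by simp

text \<open>The value of u is the indeterminate, which cancels in integer polynomials.\<close>

lemma ev_is_f:
  assumes "is_f I X f" "ev T (ep X) = 0" "ev T (ep (opp X)) = 0"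
  shows "ev T f = 0"
proof -
  have "ev T (uu * f - (ep X - ep (opp X))) = 0"
    using assms(1) by (intro ev_Rgens) (auto simp: is_f_def)
  then have "Polynomial.monom (1::int) 1 * ev T f = 0" using assms by simp
  then show ?thesis by (rule monom_1_mult_eq_0)
qed

text \<open>Some sign of C is not matched by T; as T has no zero coordinate, T has the opposite sign
  there and that factor of e_C vanishes.\<close>

lemma ev_ep_circuit:
  assumes com: "conditional_oriented_matroid I L" and fin: "finite I"
    and C: "C \<in> circuits I L" and T: "T \<in> topes I L"
  shows "ev T (ep C) = 0"
proof -
  have C': "signed_set I C" "\<not> faced L C" using C by (auto simp: circuits_eq[OF com fin] cmin_def)
  have finC: "finite (fst C)" "finite (snd C)"
    using C' fin by (auto simp: signed_set_def intro: finite_subset)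
  have "\<not> (fst C \<subseteq> fst T \<and> snd C \<subseteq> snd T)"
    using C' T by (auto simp: faced_def topes_def)
  then consider i where "i \<in> fst C" "i \<notin> fst T" | i where "i \<in> snd C" "i \<notin> snd T" by blast
  then show ?thesis
  proof cases
    case 1
    then show ?thesis using finC by (auto simp: ep_def intro!: prod_zero)
  next
    case 2
    then have "i \<in> fst T"
      using T C' by (auto simp: topes_def sign_at_eq_0_iff supp_def signed_set_def)
    then have "(\<Prod>i\<in>snd C. ev T (- mm i)) = 0" using 2 finC by (intro prod_zero) auto
    then show ?thesis by (simp add: ep_def)
  qed
qed

lemma ev_kernel_ideal:
  assumes com: "conditional_oriented_matroid I L" and fin: "finite I"
    and x: "x \<in> kernel_ideal I L" and T: "T \<in> topes I L"
  shows "ev T x = 0"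
proof -
  have "ev T g = 0" if "g \<in> Kgens I L" for g
    using that ev_Rgens[OF idl_polys_gen] ev_ep_circuit[OF com fin _ T] ev_is_f
    unfolding Kgens_def by blast
  with x show ?thesis unfolding kernel_ideal_def
    by (induction rule: idl.induct) auto
qed

lemma kernel_ideal_deletion:
  assumes "conditional_oriented_matroid I L" "finite I"
  shows "kernel_ideal (I - {n}) (deletion n L) \<subseteq> kernel_ideal I L"
proof
  fix x assume "x \<in> kernel_ideal (I - {n}) (deletion n L)"
  then show "x \<in> kernel_ideal I L"
    unfolding kernel_ideal_def
  proof (rule idl_mono)
    show "polys (I - {n}) \<subseteq> polys I" by (rule polys_mono) auto
    show "Kgens (I - {n}) (deletion n L) \<subseteq> Kgens I L"
      using circuits_deletion[OF assms, of n] Rgens_mono[of "I - {n}" I] is_f_mono[of "I - {n}" _ _ I]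
      unfolding Kgens_def by (intro Un_mono) blast+
  qed
qed

text \<open>There are no topes in these cases, so the ideal must be everything. Without covectors
  the empty signed set is a circuit, with e = 1. For a loop i both signs of i form circuits, and
  e_i^+ + e_i^- = u shows that f = 1.\<close>

lemma loop_kernel_ideal:
  assumes com: "conditional_oriented_matroid I L" and fin: "finite I"
    and loop: "L = {} \<or> (\<exists>i\<in>I. \<forall>Y\<in>L. i \<notin> supp Y)"
  shows "1 \<in> kernel_ideal I L"
proof (cases "L = {}")
  case True
  then have "ep ({}, {}) \<in> kernel_ideal I L"
    by (intro not_faced_ep[OF com fin]) (auto simp: signed_set_def faced_def)
  then show ?thesis by (simp add: ep_def)
next
  case False
  with loop obtain i where i: "i \<in> I" "\<And>Y. Y \<in> L \<Longrightarrow> i \<notin> supp Y" by blast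
  let ?X = "({i}, {})"
  have "?X \<in> circuits I L" "opp ?X \<in> circuits I L"
    using i False unfolding circuits_eq[OF com fin]
    by (auto simp: signed_set_def cmin_def faced_def supp_def opp_def)
  moreover have "is_f I ?X 1"
    using idl_polys_uminus[OF idl_Rgens_sum[OF i(1)]]
    by (simp add: is_f_def ep_def opp_def algebra_simps)
  ultimately show ?thesis by (intro kernel_ideal_gen) (auto simp: Kgens_def)
qed

text \<open>In R one has e_n^- = u - e_n^+ and (e_n^+)^2 = u e_n^+, so polynomials can be reduced to
  degree at most one in e_n^+ and degree zero in e_n^-.\<close>

lemma polys_split:
  assumes "p \<in> polys I" "n \<in> I"
  shows "\<exists>g\<in>polys (I - {n}). \<exists>h\<in>polys (I - {n}). p - (g + pp n * h) \<in> idl (polys I) (Rgens I)"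
  using assms(1)
proof (induction rule: polys_induct)
  case (const c)
  show ?case by (rule bexI[of _ "of_int c"], rule bexI[of _ 0]) (auto simp: idl.zero)
next
  case (Var v)
  consider "v \<in> vars (I - {n})" | "v = Var_plus n" | "v = Var_minus n"
    using Var by (auto simp: vars_def)
  then show ?case
  proof cases
    case 1
    show ?thesis
      by (rule bexI[of _ "Var v"], rule bexI[of _ 0]) (use 1 in \<open>auto simp: idl.zero polys_Var\<close>)
  next
    case 2
    show ?thesis
      by (rule bexI[of _ 0], rule bexI[of _ 1]) (use 2 in \<open>auto simp: idl.zero\<close>)
  next
    case 3
    then have r: "Var v - (uu + pp n * (- 1)) \<in> idl (polys I) (Rgens I)"
      using idl_Rgens_sum[OF assms(2)] by (simp add: algebra_simps)
    show ?thesis by (rule bexI[of _ uu], rule bexI[of _ "- 1"]) (use r in auto)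
  qed
next
  case (add p q)
  then obtain g h g' h' where *: "g \<in> polys (I - {n})" "h \<in> polys (I - {n})"
    "g' \<in> polys (I - {n})" "h' \<in> polys (I - {n})"
    "p - (g + pp n * h) \<in> idl (polys I) (Rgens I)" "q - (g' + pp n * h') \<in> idl (polys I) (Rgens I)"
    by blast
  have eq: "p + q - ((g + g') + pp n * (h + h')) = (p - (g + pp n * h)) + (q - (g' + pp n * h'))"
    by (simp add: algebra_simps)
  have r: "p + q - ((g + g') + pp n * (h + h')) \<in> idl (polys I) (Rgens I)"
    unfolding eq by (rule idl_add[OF *(5,6)])
  show ?case by (rule bexI[of _ "g + g'"], rule bexI[of _ "h + h'"]) (use * r in simp_all)
next
  case (mult p q)
  then obtain g h g' h' where *: "g \<in> polys (I - {n})" "h \<in> polys (I - {n})"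
    "g' \<in> polys (I - {n})" "h' \<in> polys (I - {n})"
    "p - (g + pp n * h) \<in> idl (polys I) (Rgens I)" "q - (g' + pp n * h') \<in> idl (polys I) (Rgens I)"
    by blast
  have sub: "polys (I - {n}) \<subseteq> polys I" by (rule polys_mono) auto
  have in_I: "g \<in> polys I" "h \<in> polys I" "g' \<in> polys I" "h' \<in> polys I" using * sub by auto
  \<comment> \<open>The coefficient of e_n^+ in (g + e_n^+ h)(g' + e_n^+ h'); its last summand comes
    from replacing (e_n^+)^2 by u e_n^+.\<close>
  let ?h = "g * h' + h * g' + uu * (h * h')"
  have "p * q - (g * g' + pp n * ?h) =
      q * (p - (g + pp n * h)) + (g + pp n * h) * (q - (g' + pp n * h'))
      + h * h' * (pp n * (pp n + mm n - uu) - pp n * mm n)"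
    by (simp add: algebra_simps)
  also have "\<dots> \<in> idl (polys I) (Rgens I)"
  proof (intro idl_add)
    show "q * (p - (g + pp n * h)) \<in> idl (polys I) (Rgens I)"
      using *(5) mult.hyps by (intro idl_polys_mult)
    show "(g + pp n * h) * (q - (g' + pp n * h')) \<in> idl (polys I) (Rgens I)"
      using *(6) in_I assms(2) by (intro idl_polys_mult) auto
    show "h * h' * (pp n * (pp n + mm n - uu) - pp n * mm n) \<in> idl (polys I) (Rgens I)"
    proof (rule idl_polys_mult[OF idl_polys_diff])
      show "pp n * (pp n + mm n - uu) \<in> idl (polys I) (Rgens I)"
        using assms(2) by (intro idl_polys_mult idl_Rgens_sum) auto
    qed (use in_I assms(2) idl_Rgens_prod in auto)
  qed
  finally have r: "p * q - (g * g' + pp n * ?h) \<in> idl (polys I) (Rgens I)" .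
  show ?case by (rule bexI[of _ "g * g'"], rule bexI[of _ ?h]) (use * r in simp_all)
qed

text \<open>Multiplication by \<open>e\<^sub>n\<^sup>+\<close> maps the relations of the contraction into those of the whole
  matroid, up to polynomials not involving \<open>n\<close>.\<close>

definition modulo_polys :: "'a \<Rightarrow> 'a set \<Rightarrow> 'a signed set \<Rightarrow> 'a mpoly set" where
  "modulo_polys n I L = {k + q | k q. k \<in> kernel_ideal I L \<and> q \<in> polys (I - {n})}"

lemma modulo_polysI: "k \<in> kernel_ideal I L \<Longrightarrow> q \<in> polys (I - {n}) \<Longrightarrow> k + q \<in> modulo_polys n I L"
  by (auto simp: modulo_polys_def)

lemma modulo_polys_kernel: "k \<in> kernel_ideal I L \<Longrightarrow> k \<in> modulo_polys n I L"
  using modulo_polysI[of k I L 0 n] by simp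

lemma modulo_polys_add:
  assumes "x \<in> modulo_polys n I L" "y \<in> modulo_polys n I L"
  shows "x + y \<in> modulo_polys n I L"
proof -
  from assms obtain k q k' q' where "x = k + q" "y = k' + q'" and
    *: "k \<in> kernel_ideal I L" "k' \<in> kernel_ideal I L" "q \<in> polys (I - {n})" "q' \<in> polys (I - {n})"
    by (auto simp: modulo_polys_def)
  then have "x + y = (k + k') + (q + q')" by (simp add: algebra_simps)
  with * show ?thesis by (simp add: modulo_polysI)
qed

lemma modulo_polys_mult:
  assumes "x \<in> modulo_polys n I L" "a \<in> polys (I - {n})"
  shows "a * x \<in> modulo_polys n I L"
proof -
  from assms obtain k q where "x = k + q" and *: "k \<in> kernel_ideal I L" "q \<in> polys (I - {n})"
    by (auto simp: modulo_polys_def)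
  moreover have "a \<in> polys I" using polys_mono[of "I - {n}" I] assms by auto
  ultimately show ?thesis using assms by (simp add: distrib_left modulo_polysI)
qed

section \<open>From the contraction to the whole matroid\<close>

context
  fixes I :: "'a set" and L n
  assumes com: "conditional_oriented_matroid I L" and fin: "finite I" and n: "n \<in> I"
begin

text \<open>Covectors above the two extensions are separated by n; eliminating n would put X below a
  covector of the contraction.\<close>

lemma contraction_not_faced_extension:
  assumes "\<not> faced (contraction n L) X"
  shows "\<not> faced L (insert n (fst X), snd X) \<or> \<not> faced L (fst X, insert n (snd X))"
proof (rule ccontr)
  assume "\<not> ?thesis"
  then obtain V W where "V \<in> L" "insert n (fst X) \<subseteq> fst V" "snd X \<subseteq> snd V"
    "W \<in> L" "fst X \<subseteq> fst W" "insert n (snd X) \<subseteq> snd W"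
    unfolding faced_def by auto
  then have "faced (contraction n L) X" by (intro com_elim_below[OF com, of V W]) auto
  with assms show False by simp
qed

text \<open>If the positive extension lies below no covector, its e is e_n^+ e_X. For the negative
  one it is -e_n^- e_X, and e_n^+ e_X = -e_n^- e_X + u e_X in R, where u e_X does not involve
  n.\<close>

lemma ep_contraction:
  assumes X: "signed_set (I - {n}) X" "\<not> faced (contraction n L) X"
  shows "pp n * ep X \<in> modulo_polys n I L"
proof -
  have nX: "n \<notin> supp X" "finite (supp X)" using X fin
    by (auto simp: signed_set_def supp_def intro: finite_subset)
  have eX: "ep X \<in> polys (I - {n})" "ep X \<in> polys I"
    using ep_polys[OF X(1)] polys_mono[of "I - {n}" I] by auto
  from contraction_not_faced_extension[OF X(2)] show ?thesis
  proof
    assume nf: "\<not> faced L (insert n (fst X), snd X)"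
    have "ep (insert n (fst X), snd X) \<in> kernel_ideal I L"
      using X n by (intro not_faced_ep[OF com fin _ nf]) (auto simp: signed_set_def)
    then show ?thesis by (simp add: ep_opp_insert nX modulo_polys_kernel)
  next
    assume nf: "\<not> faced L (fst X, insert n (snd X))"
    have "ep (fst X, insert n (snd X)) \<in> kernel_ideal I L"
      using X n by (intro not_faced_ep[OF com fin _ nf]) (auto simp: signed_set_def)
    then have k: "- mm n * ep X \<in> kernel_ideal I L" by (simp only: ep_opp_insert(2)[OF nX])
    have "pp n * ep X = (- mm n * ep X + ep X * (pp n + mm n - uu)) + uu * ep X"
      by (simp add: algebra_simps)
    moreover have "ep X * (pp n + mm n - uu) \<in> kernel_ideal I L"
      using eX n by (intro kernel_ideal_mult idl_Rgens_kernel idl_Rgens_sum)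
    with k have "- mm n * ep X + ep X * (pp n + mm n - uu) \<in> kernel_ideal I L"
      by (rule kernel_ideal_add)
    ultimately show ?thesis using eX by (simp add: modulo_polysI)
  qed
qed

text \<open>The positive extension of X and its opposite turn out to be circuits of L, so e_n^+ f +
  e_{-X} is a representative of a generator of J, and e_{-X} does not involve n.\<close>

lemma f_contraction_plus:
  assumes X: "signed_set (I - {n}) X" "cmin (contraction n L) X" "faced L X"
    and f: "is_f (I - {n}) X f"
    and Z: "Z \<in> contraction n L" "supp Z \<inter> supp X = {}"
    and U: "U \<in> L" "n \<in> supp U"
    and nf: "\<not> faced L (insert n (fst X), snd X)"
  shows "pp n * f \<in> modulo_polys n I L"
proof -
  let ?X = "(insert n (fst X), snd X)"
  have Z': "Z \<in> L" "n \<notin> supp Z" using Z by (auto simp: contraction_def)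
  have nX: "n \<notin> supp X" using X by (auto simp: signed_set_def supp_def)
  have sX: "supp ?X = insert n (supp X)" by (auto simp: supp_def)
  \<comment> \<open>Z vanishes on the support of X and at n, so on these coordinates lying below a
    covector is invariant under a change of sign.\<close>
  have opp_faced: "faced L (opp W)" if "faced L W" "supp W \<subseteq> insert n (supp X)" for W
    using that Z Z' by (intro faced_opp[OF com Z'(1)]) auto
  have fd: "faced L (del j ?X)" if "j \<in> supp ?X" for j
  proof (cases "j = n")
    case True
    then have "del j ?X = X" using nX by (auto simp: supp_def prod_eq_iff)
    with X show ?thesis by simp
  next
    case False
    then have "j \<in> supp X" using that sX by auto
    with X(2) have "faced (contraction n L) (del j X)" by (simp add: cmin_def)
    then obtain Y where Y: "Y \<in> L" "n \<notin> supp Y" "fst X - {j} \<subseteq> fst Y" "snd X - {j} \<subseteq> snd Y"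
      unfolding faced_def contraction_def by auto
    \<comment> \<open>Y vanishes at n. Composing it with U or with -U, whichever is positive at n,
      supplies the missing sign.\<close>
    show ?thesis
    proof (cases "n \<in> fst U")
      case True
      then show ?thesis using Y nX by (intro faced_comp[OF com Y(1) U(1)]) (auto simp: supp_def)
    next
      case False
      with U have "n \<in> snd U" by (auto simp: supp_def)
      then show ?thesis using Y nX by (intro faced_comp_opp[OF com Y(1) U(1)]) (auto simp: supp_def)
    qed
  qed
  have "cmin L ?X" using nf fd by (simp add: cmin_def)
  moreover have "cmin L (opp ?X)"
    unfolding cmin_def
  proof safe
    assume "faced L (opp ?X)"
    then have "faced L (opp (opp ?X))" by (rule opp_faced) (simp add: sX)
    with nf show False by simp
  next
    fix j assume "j \<in> supp (opp ?X)"
    then have "faced L (opp (del j ?X))" by (intro opp_faced fd) (auto simp: sX)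
    then show "faced L (del j (opp ?X))" by (simp add: opp_del)
  qed
  moreover have sg: "signed_set I ?X" using X n by (auto simp: signed_set_def)
  moreover have sgX: "signed_set I X" using X by (auto simp: signed_set_def)
  moreover have "is_f I ?X (pp n * f + ep (opp X))"
    using is_f_insert[OF sgX fin n nX is_f_mono[OF f]] by auto
  ultimately have "pp n * f + ep (opp X) \<in> kernel_ideal I L"
    by (intro kernel_ideal_gen) (auto simp: Kgens_def circuits_eq[OF com fin])
  moreover have "- ep (opp X) \<in> polys (I - {n})"
    using X by (intro polys_uminus ep_polys) simp
  ultimately show ?thesis using modulo_polysI by fastforce
qed

text \<open>The cases distinguish whether X is below a covector of L. A covector of L/n vanishing on
  the support of X makes X and -X behave alike throughout.\<close>

lemma f_contraction:
  assumes X: "X \<in> circuits (I - {n}) (contraction n L)" "opp X \<in> circuits (I - {n}) (contraction n L)"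
    and f: "is_f (I - {n}) X f" and U: "U \<in> L" "n \<in> supp U"
  shows "pp n * f \<in> modulo_polys n I L"
proof -
  have fin': "finite (I - {n})" using fin by simp
  note com' = com_contraction[OF com, of n]
  have sg: "signed_set (I - {n}) X" and cm: "cmin (contraction n L) X" and cmo: "cmin (contraction n L) (opp X)"
    using X by (auto simp: circuits_eq[OF com' fin'])
  have fp: "f \<in> polys (I - {n})" using f by (simp add: is_f_def)
  have finX: "finite (supp X)" using sg fin by (auto simp: signed_set_def supp_def intro: finite_subset)
  show ?thesis
  proof (cases "supp X = {}")
    case True
    \<comment> \<open>The empty signed set is a circuit only if L/n has no covector. Its e is 1, so
      e_n^+ itself is already of the required form.\<close>
    then have "X = ({}, {})" by (auto simp: supp_def prod_eq_iff)
    then have "pp n \<in> modulo_polys n I L"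
      using ep_contraction[OF sg] cm by (simp add: ep_def cmin_def)
    then show ?thesis using modulo_polys_mult[of "pp n" n I L f] fp by (simp add: mult.commute)
  next
    case False
    have "fst X \<inter> snd X = {}" using sg by (simp add: signed_set_def)
    then obtain Z where Z: "Z \<in> contraction n L" "supp Z \<inter> supp X = {}"
      using cmin_opp_zero[OF com' cm cmo finX False] by auto
    have Z': "Z \<in> L" "n \<notin> supp Z" using Z by (auto simp: contraction_def)
    have opp_faced: "faced L (opp W)" if "faced L W" "supp W \<subseteq> insert n (supp X)" for W
      using that Z Z' by (intro faced_opp[OF com Z'(1)]) auto
    show ?thesis
    proof (cases "faced L X")
      case True
      from contraction_not_faced_extension[of X] cm
      consider "\<not> faced L (insert n (fst X), snd X)" | "\<not> faced L (fst X, insert n (snd X))"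
        by (auto simp: cmin_def)
      then show ?thesis
      proof cases
        case 1
        then show ?thesis by (rule f_contraction_plus[OF sg cm True f Z U])
      next
        case 2
        \<comment> \<open>Reversing all signs turns the negative extension of X into the positive
          extension of -X, so the first case applies to -X and -f.\<close>
        have "\<not> faced L (insert n (fst (opp X)), snd (opp X))"
          using 2 opp_faced[of "(insert n (fst (opp X)), snd (opp X))"]
          by (auto simp: opp_def supp_def)
        then have "pp n * (- f) \<in> modulo_polys n I L"
          using sg cmo is_f_opp[OF f] Z U opp_faced[OF True]
          by (intro f_contraction_plus[of "opp X"]) auto
        then have "- 1 * (pp n * (- f)) \<in> modulo_polys n I L"
          by (rule modulo_polys_mult) simp
        then show ?thesis by simp
      qed
    next
      \<comment> \<open>Here X and -X are circuits of L as well, and already f lies in the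
        ideal.\<close>
      case nf: False
      have "\<not> faced L (opp X)" using opp_faced[of "opp X"] nf by auto
      then have "cmin L X" "cmin L (opp X)"
        using nf cm cmo by (auto simp: cmin_def intro: faced_contraction)
      moreover have "signed_set I X" using sg by (auto simp: signed_set_def)
      ultimately have "X \<in> circuits I L" "opp X \<in> circuits I L"
        by (simp_all add: circuits_eq[OF com fin])
      moreover have "is_f I X f" using is_f_mono[OF f] by auto
      ultimately have "f \<in> kernel_ideal I L"
        by (intro kernel_ideal_gen) (unfold Kgens_def, blast)
      then show ?thesis using n by (intro modulo_polys_kernel kernel_ideal_mult) auto
    qed
  qed
qed

text \<open>The coefficients of the ideal of L/n do not involve n, so they preserve
  \<open>modulo_polys\<close> and only generators have to be checked.\<close>

lemma kernel_ideal_contraction: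
  assumes U: "U \<in> L" "n \<in> supp U" and h: "h \<in> kernel_ideal (I - {n}) (contraction n L)"
  shows "pp n * h \<in> modulo_polys n I L"
proof -
  have fin': "finite (I - {n})" using fin by simp
  have gen: "pp n * g \<in> modulo_polys n I L" if "g \<in> Kgens (I - {n}) (contraction n L)" for g
  proof -
    from that consider "g \<in> Rgens (I - {n})"
      | X where "g = ep X" "X \<in> circuits (I - {n}) (contraction n L)"
      | X where "X \<in> circuits (I - {n}) (contraction n L)" "opp X \<in> circuits (I - {n}) (contraction n L)"
        "is_f (I - {n}) X g"
      by (auto simp: Kgens_def)
    then show ?thesis
    proof cases
      case 1
      then have "g \<in> idl (polys I) (Rgens I)"
        using Rgens_mono[of "I - {n}" I] by (auto intro: idl_polys_gen)
      then show ?thesis using n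
        by (intro modulo_polys_kernel kernel_ideal_mult idl_Rgens_kernel) auto
    next
      case 2
      then show ?thesis
        by (auto intro!: ep_contraction simp: circuits_eq[OF com_contraction[OF com] fin'] cmin_def)
    next
      case 3
      then show ?thesis by (rule f_contraction[OF _ _ _ U])
    qed
  qed
  from h show ?thesis unfolding kernel_ideal_def
  proof (induction rule: idl.induct)
    case zero
    show ?case by (simp add: modulo_polys_kernel)
  next
    case (step a g x)
    then have "a * (pp n * g) + pp n * x \<in> modulo_polys n I L"
      by (intro modulo_polys_add modulo_polys_mult[OF gen])
    then show ?case by (simp add: algebra_simps)
  qed
qed

text \<open>The only zero of Y is at n, where U and -U supply the two signs; which of the two
  compositions becomes V depends on the sign of U at n.\<close>

lemma tope_extension:
  assumes Y: "Y \<in> L" "\<forall>i\<in>I - {n}. i \<in> supp Y" "n \<notin> supp Y" and U: "U \<in> L" "n \<in> supp U"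
  obtains V W where "V \<in> topes I L" "W \<in> topes I L" "fst V \<inter> I = insert n (fst Y)"
    "fst W \<inter> I = fst Y"
proof -
  let ?V = "composition Y U" and ?W = "composition Y (opp U)"
  have VW: "?V \<in> L" "?W \<in> L" using com_comp[OF com Y(1) U(1)] com_comp_opp[OF com Y(1) U(1)] .
  have sY: "fst Y \<subseteq> I" "snd Y \<subseteq> I" using com_signed[OF com Y(1)] by (auto simp: signed_set_def)
  have sU: "fst U \<subseteq> I" "snd U \<subseteq> I" "fst U \<inter> snd U = {}"
    using com_signed[OF com U(1)] by (auto simp: signed_set_def)
  have tp: "?V \<in> topes I L" "?W \<in> topes I L"
    using VW Y U by (auto simp: topes_def sign_at_eq_0_iff supp_def)
  show ?thesis
  proof (cases "n \<in> fst U")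
    case True
    then show ?thesis using tp sY sU Y by (intro that[of ?V ?W]) (auto simp: supp_def)
  next
    case False
    then show ?thesis using tp sY sU Y U by (intro that[of ?W ?V]) (auto simp: supp_def)
  qed
qed

end

section \<open>Polynomials over the empty ground set\<close>

lemma lookup_single_u:
  fixes m :: "'a var \<Rightarrow>\<^sub>0 nat"
  assumes "Poly_Mapping.keys m \<subseteq> {Var_u}"
  shows "m = Poly_Mapping.single Var_u (mon_degree m)"
proof (rule poly_mapping_eqI)
  fix k
  have "mon_degree m = Poly_Mapping.lookup m Var_u"
    using mon_degree_superset[OF _ assms] by simp
  then show "Poly_Mapping.lookup m k = Poly_Mapping.lookup (Poly_Mapping.single Var_u (mon_degree m)) k"
    using assms by (auto simp: lookup_single when_def in_keys_iff subset_iff)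
qed

text \<open>Only powers of u occur, and they have distinct degrees, so their values cannot
  cancel.\<close>

lemma ev_empty_ground_set:
  assumes p: "p \<in> polys {}" and ev: "ev X p = 0"
  shows "p = 0"
proof (rule poly_mapping_eqI)
  fix m
  show "Poly_Mapping.lookup p m = Poly_Mapping.lookup 0 m"
  proof (cases "m \<in> Poly_Mapping.keys p")
    case True
    have single: "m' = Poly_Mapping.single Var_u (mon_degree m')" if "m' \<in> Poly_Mapping.keys p" for m'
      using p that by (intro lookup_single_u) (auto simp: polys_def vars_def)
    have val: "eval_mon (var_value X) m' = 1" if "m' \<in> Poly_Mapping.keys p" for m'
      by (subst single[OF that]) (simp add: eval_mon_def)
    have "0 = Polynomial.coeff (ev X p) (mon_degree m)" using ev by simp
    also have "\<dots> = (\<Sum>m'\<in>Poly_Mapping.keys p. if mon_degree m' = mon_degree m then Poly_Mapping.lookup p m' else 0)"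
      by (auto simp: ev_eq_sum_monom coeff_sum val intro!: sum.cong)
    also have "\<dots> = (\<Sum>m'\<in>Poly_Mapping.keys p. if m' = m then Poly_Mapping.lookup p m' else 0)"
      using single True by (intro sum.cong refl) metis
    also have "\<dots> = Poly_Mapping.lookup p m" using True by simp
    finally show ?thesis by simp
  qed (simp add: in_keys_iff)
qed

theorem kernel_ideal_complete:
  assumes "finite I" "conditional_oriented_matroid I L" "p \<in> polys I"
    "\<And>T. T \<in> topes I L \<Longrightarrow> ev T p = 0"
  shows "p \<in> kernel_ideal I L"
  using assms
proof (induction "card I" arbitrary: I L p rule: less_induct)
  case less
  note fin = less.prems(1) and com = less.prems(2) and p = less.prems(3) and ev = less.prems(4)
  show ?case
  proof (cases "L = {} \<or> (\<exists>i\<in>I. \<forall>Y\<in>L. i \<notin> supp Y)")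
    case True
    then show ?thesis
      using kernel_ideal_mult[OF loop_kernel_ideal[OF com fin True] p] by simp
  next
    case noloop: False
    show ?thesis
    proof (cases "I = {}")
      case True
      from noloop obtain X where "X \<in> L" by auto
      then have "ev X p = 0" using True by (intro ev) (auto simp: topes_def)
      then have "p = 0" using p True by (intro ev_empty_ground_set) auto
      then show ?thesis by simp
    next
      case False
      then obtain n where n: "n \<in> I" by auto
      with noloop obtain U where U: "U \<in> L" "n \<in> supp U" by blast
      have card: "card (I - {n}) < card I" using n fin by (rule card_Diff1_less[rotated])
      have fin': "finite (I - {n})" using fin by simp
      have sub: "polys (I - {n}) \<subseteq> polys I" by (rule polys_mono) auto
      obtain g h where gh: "g \<in> polys (I - {n})" "h \<in> polys (I - {n})"
        and r: "p - (g + pp n * h) \<in> idl (polys I) (Rgens I)"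
        using polys_split[OF p n] by blast
      have "h \<in> kernel_ideal (I - {n}) (contraction n L)"
      proof (rule less.hyps[OF card fin' com_contraction[OF com] gh(2)])
        fix T assume "T \<in> topes (I - {n}) (contraction n L)"
        then have T: "T \<in> L" "\<forall>i\<in>I - {n}. i \<in> supp T" "n \<notin> supp T"
          by (auto simp: topes_def contraction_def sign_at_eq_0_iff)
        obtain V W where VW: "V \<in> topes I L" "W \<in> topes I L" "fst V \<inter> I = insert n (fst T)"
          "fst W \<inter> I = fst T"
          using tope_extension[OF com fin n T U] .
        have TI: "fst T \<subseteq> I" "n \<notin> fst T"
          using com_signed[OF com T(1)] T(3) by (auto simp: signed_set_def supp_def)
        have eq: "ev V q = ev T q" "ev W q = ev T q" if "q \<in> polys (I - {n})" for q
          using that VW TI by (auto intro!: ev_cong)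
        have eV: "ev V (pp n) = Polynomial.monom 1 1" and eW: "ev W (pp n) = 0"
          using VW n TI by auto
        have "ev X p = ev X g + ev X (pp n) * ev X h" for X
          using ev_Rgens[OF r, of X] by (simp add: algebra_simps)
        \<comment> \<open>V and W agree with T away from n. As e_n^+ vanishes at W, the value of g
          is 0; at V what remains is the indeterminate times the value of h.\<close>
        from this[of V] this[of W] have "Polynomial.monom 1 1 * ev T h = 0"
          using ev[OF VW(1)] ev[OF VW(2)] eV eW gh eq by simp
        then show "ev T h = 0" by (rule monom_1_mult_eq_0)
      qed
      then have "pp n * h \<in> modulo_polys n I L"
        by (rule kernel_ideal_contraction[OF com fin n U])
      then obtain k q where kq: "k \<in> kernel_ideal I L" "q \<in> polys (I - {n})" "pp n * h = k + q"
        by (auto simp: modulo_polys_def)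
      have eq: "p = (p - (g + pp n * h)) + k + (g + q)" using kq by simp
      have rk: "(p - (g + pp n * h)) + k \<in> kernel_ideal I L"
        by (rule kernel_ideal_add[OF idl_Rgens_kernel[OF r] kq(1)])
      have "g + q \<in> kernel_ideal (I - {n}) (deletion n L)"
      proof (rule less.hyps[OF card fin' com_deletion[OF com]])
        show gq: "g + q \<in> polys (I - {n})" using gh kq by simp
        fix T assume "T \<in> topes (I - {n}) (deletion n L)"
        then obtain Y where Y: "Y \<in> L" "T = del n Y" "\<forall>i\<in>I - {n}. i \<in> supp Y"
          by (auto simp: topes_def deletion_def sign_at_eq_0_iff)
        \<comment> \<open>A tope of the deletion comes from a tope of L with the same positive part
          off n: either Y already has a sign at n, or it can be given one because n is not a
          loop.\<close>
        obtain V where V: "V \<in> topes I L" "fst V \<inter> (I - {n}) = fst Y \<inter> (I - {n})"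
        proof (cases "n \<in> supp Y")
          case True
          then have "Y \<in> topes I L" using Y by (auto simp: topes_def sign_at_eq_0_iff)
          then show ?thesis by (rule that) simp
        next
          case False
          obtain V W where "V \<in> topes I L" "fst V \<inter> I = insert n (fst Y)"
            using tope_extension[OF com fin n Y(1) Y(3) False U] .
          then show ?thesis by (intro that[of V]) auto
        qed
        have "ev T (g + q) = ev V (g + q)"
          by (rule ev_cong[OF gq]) (use V Y in auto)
        also have "\<dots> = ev V (p - (p - (g + pp n * h) + k))"
          by (rule arg_cong[of _ _ "ev V"]) (use kq(3) in \<open>simp add: algebra_simps\<close>)
        also have "\<dots> = ev V p - ev V (p - (g + pp n * h) + k)" by (rule ev_simps(6))
        also have "\<dots> = 0"
          using ev[OF V(1)] ev_kernel_ideal[OF com fin rk V(1)] by simp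
        finally show "ev T (g + q) = 0" .
      qed
      then have "g + q \<in> kernel_ideal I L" using kernel_ideal_deletion[OF com fin] by blast
      with rk show ?thesis using eq kernel_ideal_add by metis
    qed
  qed
qed

section \<open>The filtration by Heaviside functions\<close>

lemma GR_carrier: "carrier (GR I L) = extensional (topes I L)"
  by (auto simp: GR_def PiE_def)

lemma GR_simps [simp]:
  "\<zero>\<^bsub>GR I L\<^esub> = (\<lambda>X\<in>topes I L. 0)" "\<one>\<^bsub>GR I L\<^esub> = (\<lambda>X\<in>topes I L. 1)"
  "f \<oplus>\<^bsub>GR I L\<^esub> g = (\<lambda>X\<in>topes I L. f X + g X)"
  "f \<otimes>\<^bsub>GR I L\<^esub> g = (\<lambda>X\<in>topes I L. f X * g X)"
  by (simp_all add: GR_def)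

lemma GR_restrict [simp, intro!]: "(\<lambda>X\<in>topes I L. f X) \<in> carrier (GR I L)"
  by (simp add: GR_carrier)

lemma GR_eqI:
  assumes "f \<in> carrier (GR I L)" "g \<in> carrier (GR I L)" "\<And>X. X \<in> topes I L \<Longrightarrow> f X = g X"
  shows "f = g"
  using assms by (intro extensionalityI[of f "topes I L" g]) (auto simp: GR_carrier)

lemma cring_GR: "cring (GR I L)"
proof (rule cringI)
  show "abelian_group (GR I L)"
  proof (rule abelian_groupI)
    fix f assume f: "f \<in> carrier (GR I L)"
    show "\<exists>g\<in>carrier (GR I L). g \<oplus>\<^bsub>GR I L\<^esub> f = \<zero>\<^bsub>GR I L\<^esub>"
      by (rule bexI[of _ "\<lambda>X\<in>topes I L. - f X"]) (auto intro!: GR_eqI[of _ I L])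
  qed (auto intro!: GR_eqI[of _ I L])
  show "Group.comm_monoid (GR I L)"
    by (rule comm_monoidI) (auto intro!: GR_eqI[of _ I L])
qed (auto intro!: GR_eqI[of _ I L] simp: distrib_right)

lemma GR_a_inv [simp]:
  assumes "f \<in> carrier (GR I L)"
  shows "\<ominus>\<^bsub>GR I L\<^esub> f = (\<lambda>X\<in>topes I L. - f X)"
proof -
  interpret cring "GR I L" by (rule cring_GR)
  show ?thesis by (rule minus_equality) (use assms in \<open>auto intro!: GR_eqI[of _ I L]\<close>)
qed

lemma GR_minus [simp]:
  assumes "f \<in> carrier (GR I L)" "g \<in> carrier (GR I L)"
  shows "f \<ominus>\<^bsub>GR I L\<^esub> g = (\<lambda>X\<in>topes I L. f X - g X)"
  using assms by (auto simp: a_minus_def intro!: GR_eqI[of _ I L])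

lemma GR_finsum:
  assumes "finite A" "f \<in> A \<rightarrow> carrier (GR I L)"
  shows "finsum (GR I L) f A = (\<lambda>X\<in>topes I L. \<Sum>a\<in>A. f a X)"
proof -
  interpret cring "GR I L" by (rule cring_GR)
  show ?thesis using assms
  proof (induction rule: finite_induct)
    case empty
    show ?case by simp
  next
    case (insert a A)
    then have "f \<in> A \<rightarrow> carrier (GR I L)" "f a \<in> carrier (GR I L)" by auto
    then show ?case using insert by (subst finsum_insert) (auto intro!: GR_eqI[of _ I L])
  qed
qed

lemma heav_plus_eq: "heav_plus I L i = (\<lambda>X\<in>topes I L. if i \<in> fst X then 1 else 0)"
  by (simp add: heav_plus_def)

lemma heav_minus_eq: "heav_minus I L i = (\<lambda>X\<in>topes I L. if i \<in> fst X then 0 else 1)"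
  by (auto simp: heav_minus_def heav_plus_def intro!: GR_eqI[of _ I L])

lemma heav_poly_carrier: "heav_poly I L k f \<Longrightarrow> f \<in> carrier (GR I L)"
  by (induction rule: heav_poly.induct) (auto simp: heav_plus_eq heav_minus_eq simp flip: restrict_def)

lemma heav_poly_zero: "heav_poly I L k \<zero>\<^bsub>GR I L\<^esub>"
  using heav_poly.const[of I L k 0] by simp

text \<open>The constant 1 counts as an expression of any degree, and multiplying by it raises the
  bound.\<close>

lemma heav_poly_mono:
  assumes "heav_poly I L j f" "j \<le> k"
  shows "heav_poly I L k f"
proof -
  have "heav_poly I L (k - j + j) (\<one>\<^bsub>GR I L\<^esub> \<otimes>\<^bsub>GR I L\<^esub> f)"
    using heav_poly.prod[OF heav_poly.const[of I L "k - j" 1] assms(1)] by simp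
  moreover have "\<one>\<^bsub>GR I L\<^esub> \<otimes>\<^bsub>GR I L\<^esub> f = f"
    using heav_poly_carrier[OF assms(1)] by (auto intro!: GR_eqI[of _ I L])
  ultimately show ?thesis using assms(2) by simp
qed

lemma heav_poly_uminus:
  assumes "heav_poly I L k f"
  shows "heav_poly I L k (\<ominus>\<^bsub>GR I L\<^esub> f)"
proof -
  have "heav_poly I L (0 + k) ((\<lambda>X\<in>topes I L. - 1) \<otimes>\<^bsub>GR I L\<^esub> f)"
    by (intro heav_poly.prod heav_poly.const assms)
  moreover have "(\<lambda>X\<in>topes I L. - 1) \<otimes>\<^bsub>GR I L\<^esub> f = \<ominus>\<^bsub>GR I L\<^esub> f"
    using heav_poly_carrier[OF assms] by (auto intro!: GR_eqI[of _ I L])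
  ultimately show ?thesis by simp
qed

lemma heav_poly_sum:
  assumes "finite A" "\<And>a. a \<in> A \<Longrightarrow> heav_poly I L k (\<lambda>X\<in>topes I L. f a X)"
  shows "heav_poly I L k (\<lambda>X\<in>topes I L. \<Sum>a\<in>A. f a X)"
  using assms
proof (induction rule: finite_induct)
  case empty
  show ?case using heav_poly.const[of I L k 0] by (simp flip: restrict_def)
next
  case (insert a A)
  have "heav_poly I L k ((\<lambda>X\<in>topes I L. f a X) \<oplus>\<^bsub>GR I L\<^esub> (\<lambda>X\<in>topes I L. \<Sum>a\<in>A. f a X))"
    by (intro heav_poly.sum insert) auto
  moreover have "(\<lambda>X\<in>topes I L. f a X) \<oplus>\<^bsub>GR I L\<^esub> (\<lambda>X\<in>topes I L. \<Sum>a\<in>A. f a X)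
      = (\<lambda>X\<in>topes I L. \<Sum>a\<in>insert a A. f a X)"
    using insert.hyps by (auto intro!: GR_eqI[of _ I L])
  ultimately have "heav_poly I L k (\<lambda>X\<in>topes I L. \<Sum>a\<in>insert a A. f a X)" by simp
  then show ?case by (simp add: restrict_def)
qed

lemma heav_poly_subgroup: "subgroup {f. heav_poly I L k f} (add_monoid (GR I L))"
proof -
  interpret cring "GR I L" by (rule cring_GR)
  show ?thesis
  proof (intro add.subgroupI)
    show "\<ominus>\<^bsub>GR I L\<^esub> f \<in> {f. heav_poly I L k f}" if "f \<in> {f. heav_poly I L k f}" for f
      using heav_poly_uminus[of I L k f] that by (simp del: GR_a_inv)
    show "{f. heav_poly I L k f} \<noteq> {}" using heav_poly_zero by blast
  qed (use heav_poly_carrier heav_poly.sum in auto)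
qed

text \<open>Expressions of bounded degree are closed under sums, and under negation through the
  constant -1, so they already form a subgroup.\<close>

lemma filt_eq: "filt I L k = {f. heav_poly I L k f}"
proof -
  interpret cring "GR I L" by (rule cring_GR)
  show ?thesis unfolding filt_def
  proof (intro equalityI)
    show "generate (add_monoid (GR I L)) {f. heav_poly I L k f} \<subseteq> {f. heav_poly I L k f}"
      by (intro add.generate_subgroup_incl heav_poly_subgroup) auto
  qed (auto intro: generate.incl)
qed

text \<open>The map to the Rees ring. An element of \<open>UP\<close> is its own coefficient
  function, so as a function of k this is directly an element of \<open>UP (GR I L)\<close>.\<close>

definition coeff_fun :: "'a set \<Rightarrow> 'a signed set \<Rightarrow> 'a mpoly \<Rightarrow> nat \<Rightarrow> 'a signed \<Rightarrow> int" where
  "coeff_fun I L p k = (\<lambda>X\<in>topes I L. Polynomial.coeff (ev X p) k)"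

lemma coeff_fun_carrier [simp]: "coeff_fun I L p k \<in> carrier (GR I L)"
  by (simp add: coeff_fun_def)

lemma coeff_fun_add: "coeff_fun I L (p + q) k = coeff_fun I L p k \<oplus>\<^bsub>GR I L\<^esub> coeff_fun I L q k"
  and coeff_fun_diff: "coeff_fun I L (p - q) k = coeff_fun I L p k \<ominus>\<^bsub>GR I L\<^esub> coeff_fun I L q k"
  by (auto intro!: GR_eqI[of _ I L]) (auto simp: coeff_fun_def)

lemma coeff_fun_mult:
  "coeff_fun I L (p * q) n =
    (\<Oplus>\<^bsub>GR I L\<^esub>i\<in>{..n}. coeff_fun I L p i \<otimes>\<^bsub>GR I L\<^esub> coeff_fun I L q (n - i))"
  by (subst GR_finsum) (auto simp: coeff_fun_def coeff_mult intro!: GR_eqI[of _ I L])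

lemma coeff_fun_0 [simp]: "coeff_fun I L 0 k = \<zero>\<^bsub>GR I L\<^esub>"
  by (simp add: coeff_fun_def)

lemma coeff_fun_of_int: "coeff_fun I L (of_int c) k = (\<lambda>X\<in>topes I L. if k = 0 then c else 0)"
  by (simp add: coeff_fun_def flip: monom_0) (simp add: of_int_poly coeff_pCons split: nat.split)

lemma coeff_fun_Var: "coeff_fun I L (Var v) k = (\<lambda>X\<in>topes I L. if k = 1 then var_value X v else 0)"
  by (auto simp: coeff_fun_def)

lemma coeff_fun_heaviside:
  "coeff_fun I L (pp i) k = (if k = 1 then heav_plus I L i else \<zero>\<^bsub>GR I L\<^esub>)"
  "coeff_fun I L (mm i) k = (if k = 1 then heav_minus I L i else \<zero>\<^bsub>GR I L\<^esub>)"
  "coeff_fun I L uu k = (if k = 1 then \<one>\<^bsub>GR I L\<^esub> else \<zero>\<^bsub>GR I L\<^esub>)"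
  by (auto simp: coeff_fun_Var heav_plus_eq heav_minus_eq)

lemma coeff_fun_filt: "p \<in> polys I \<Longrightarrow> coeff_fun I L p k \<in> filt I L k"
proof (induction arbitrary: k rule: polys_induct)
  case (const c)
  then show ?case by (auto simp: coeff_fun_of_int filt_eq heav_poly.const simp flip: restrict_def)
next
  case (Var v)
  then show ?case
    by (cases v) (auto simp: coeff_fun_heaviside filt_eq vars_def
        intro: heav_poly_zero[simplified] heav_poly.intros)
next
  case (add p q)
  then show ?case by (simp only: coeff_fun_add filt_eq mem_Collect_eq heav_poly.sum)
next
  case (mult p q)
  have "heav_poly I L k (\<lambda>X\<in>topes I L. Polynomial.coeff (ev X p) i * Polynomial.coeff (ev X q) (k - i))"
    if "i \<le> k" for i
  proof -
    have "heav_poly I L (i + (k - i)) (coeff_fun I L p i \<otimes>\<^bsub>GR I L\<^esub> coeff_fun I L q (k - i))"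
      using mult.IH by (intro heav_poly.prod) (simp_all add: filt_eq)
    moreover have "coeff_fun I L p i \<otimes>\<^bsub>GR I L\<^esub> coeff_fun I L q (k - i) =
        (\<lambda>X\<in>topes I L. Polynomial.coeff (ev X p) i * Polynomial.coeff (ev X q) (k - i))"
      by (auto simp: coeff_fun_def intro!: GR_eqI[of _ I L])
    ultimately show ?thesis using that by simp
  qed
  then have "heav_poly I L k (\<lambda>X\<in>topes I L. \<Sum>i\<le>k. Polynomial.coeff (ev X p) i * Polynomial.coeff (ev X q) (k - i))"
    by (intro heav_poly_sum) auto
  then show ?case by (simp add: coeff_fun_def coeff_mult filt_eq restrict_def)
qed

text \<open>Homogenisation: h_i^+ and h_i^- are replaced by e_i^+ and e_i^-, and powers of u fill
  the degree up to exactly k without changing the function.\<close>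

lemma filt_lift:
  assumes "f \<in> filt I L k"
  shows "\<exists>p\<in>hpolys I k. \<forall>X\<in>topes I L. ev X p = Polynomial.monom (f X) k"
proof -
  have u: "ev X (uu ^ k) = Polynomial.monom 1 k" for X :: "'a signed" and k
    by (simp add: monom_power)
  from assms have "heav_poly I L k f" by (simp add: filt_eq)
  then show ?thesis
  proof induction
    case (const k c)
    have "of_int c * uu ^ k \<in> hpolys I (0 + k)" by (intro hpolys_mult hpolys_of_int hpolys_u_power)
    moreover have "ev X (of_int c * uu ^ k) = Polynomial.monom c k" for X :: "'a signed"
      unfolding ev_simps(7) u by (simp add: of_int_monom mult_monom)
    ultimately show ?case by (intro bexI[of _ "of_int c * uu ^ k"]) auto
  next
    case (plus i k)
    have "uu ^ (k - 1) * pp i \<in> hpolys I (k - 1 + 1)"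
      using plus by (intro hpolys_mult hpolys_Var hpolys_u_power) (auto simp: vars_def)
    moreover have "ev X (uu ^ (k - 1) * pp i) = Polynomial.monom (heav_plus I L i X) k" if "X \<in> topes I L" for X
      unfolding ev_simps(7) u using plus that by (simp add: mult_monom heav_plus_eq)
    ultimately show ?case using plus by (intro bexI[of _ "uu ^ (k - 1) * pp i"]) auto
  next
    case (minus i k)
    have "uu ^ (k - 1) * mm i \<in> hpolys I (k - 1 + 1)"
      using minus by (intro hpolys_mult hpolys_Var hpolys_u_power) (auto simp: vars_def)
    moreover have "ev X (uu ^ (k - 1) * mm i) = Polynomial.monom (heav_minus I L i X) k" if "X \<in> topes I L" for X
      unfolding ev_simps(7) u using minus that by (simp add: mult_monom heav_minus_eq)
    ultimately show ?case using minus by (intro bexI[of _ "uu ^ (k - 1) * mm i"]) auto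
  next
    case (sum k f g)
    then obtain p q where "p \<in> hpolys I k" "q \<in> hpolys I k"
      "\<forall>X\<in>topes I L. ev X p = Polynomial.monom (f X) k" "\<forall>X\<in>topes I L. ev X q = Polynomial.monom (g X) k"
      by blast
    then show ?case by (intro bexI[of _ "p + q"]) (auto simp: add_monom)
  next
    case (prod j f k g)
    then obtain p q where "p \<in> hpolys I j" "q \<in> hpolys I k"
      "\<forall>X\<in>topes I L. ev X p = Polynomial.monom (f X) j" "\<forall>X\<in>topes I L. ev X q = Polynomial.monom (g X) k"
      by blast
    then show ?case by (intro bexI[of _ "p * q"]) (auto simp: mult_monom)
  qed
qed

lemma filt_lift_coeff:
  assumes "f \<in> filt I L k"
  obtains p where "p \<in> hpolys I k" "coeff_fun I L p = (\<lambda>j. if j = k then f else \<zero>\<^bsub>GR I L\<^esub>)"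
    "\<And>X. X \<in> topes I L \<Longrightarrow> ev X p = Polynomial.monom (f X) k"
proof -
  obtain p where p: "p \<in> hpolys I k" "\<forall>X\<in>topes I L. ev X p = Polynomial.monom (f X) k"
    using filt_lift[OF assms] by blast
  have "f \<in> carrier (GR I L)" using assms by (simp add: filt_eq heav_poly_carrier)
  then have "coeff_fun I L p j = (if j = k then f else \<zero>\<^bsub>GR I L\<^esub>)" for j
    using p(2) by (auto intro!: GR_eqI[of _ I L]) (auto simp: coeff_fun_def)
  then show ?thesis using p by (intro that) auto
qed

lemma coeff_fun_bound: "\<exists>N. \<forall>k>N. coeff_fun I L p k = \<zero>\<^bsub>GR I L\<^esub>"
\<comment> \<open>If p = 0 the maximum is over the empty set and its value is unknown; this is
  harmless, as p then has no monomials to bound.\<close>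
proof (intro exI[of _ "Max (mon_degree ` Poly_Mapping.keys p)"] allI impI)
  fix k assume k: "k > Max (mon_degree ` Poly_Mapping.keys p)"
  have "mon_degree m \<noteq> k" if "m \<in> Poly_Mapping.keys p" for m
    using k Max_ge[of "mon_degree ` Poly_Mapping.keys p" "mon_degree m"] that by fastforce
  then have "Polynomial.coeff (ev X p) k = 0" for X
    unfolding ev_eq_sum_monom by (auto simp: coeff_sum intro!: sum.neutral)
  then show "coeff_fun I L p k = \<zero>\<^bsub>GR I L\<^esub>" by (simp add: coeff_fun_def)
qed

text \<open>The components have homogeneous lifts, and the bound N makes their sum finite.\<close>

lemma coeff_fun_surj:
  assumes "\<And>k. f k \<in> filt I L k" "\<And>k. k > N \<Longrightarrow> f k = \<zero>\<^bsub>GR I L\<^esub>"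
  obtains p where "p \<in> polys I" "coeff_fun I L p = f"
proof -
  have "\<exists>q. q \<in> hpolys I k \<and> coeff_fun I L q = (\<lambda>j. if j = k then f k else \<zero>\<^bsub>GR I L\<^esub>)" for k
    using filt_lift_coeff[OF assms(1)[of k]] by metis
  then obtain q where q: "\<And>k. q k \<in> hpolys I k"
    "\<And>k. coeff_fun I L (q k) = (\<lambda>j. if j = k then f k else \<zero>\<^bsub>GR I L\<^esub>)"
    by metis
  have fc: "f k \<in> carrier (GR I L)" for k using assms(1)[of k] by (simp add: filt_eq heav_poly_carrier)
  have "coeff_fun I L (\<Sum>k\<le>N. q k) j = f j" for j
  proof (rule GR_eqI)
    fix X assume X: "X \<in> topes I L"
    have "coeff_fun I L (\<Sum>k\<le>N. q k) j X = (\<Sum>k\<le>N. coeff_fun I L (q k) j X)"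
      using X by (simp add: coeff_fun_def coeff_sum)
    also have "\<dots> = (\<Sum>k\<le>N. if k = j then f k X else 0)"
      using X by (intro sum.cong refl) (auto simp: q(2))
    also have "\<dots> = f j X" using assms(2)[of j] X by auto
    finally show "coeff_fun I L (\<Sum>k\<le>N. q k) j X = f j X" .
  qed (auto simp: fc)
  moreover have "(\<Sum>k\<le>N. q k) \<in> polys I" by (intro polys_sum hpolys_polys[OF q(1)])
  ultimately show ?thesis by (intro that) auto
qed

section \<open>Kernels of the three maps\<close>

definition filt0 :: "'a set \<Rightarrow> 'a signed set \<Rightarrow> nat \<Rightarrow> ('a signed \<Rightarrow> int) set" where
  "filt0 I L = filt_prev (GR I L) (filt I L)"

lemma filt0_simps: "filt0 I L 0 = {\<zero>\<^bsub>GR I L\<^esub>}" "filt0 I L (Suc k) = filt I L k"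
  by (simp_all add: filt0_def filt_prev_def)

lemma filt0_zero: "\<zero>\<^bsub>GR I L\<^esub> \<in> filt0 I L k"
  by (cases k) (auto simp: filt0_simps filt_eq heav_poly_zero[simplified])

lemma filt0_add: "f \<in> filt0 I L k \<Longrightarrow> g \<in> filt0 I L k \<Longrightarrow> f \<oplus>\<^bsub>GR I L\<^esub> g \<in> filt0 I L k"
  by (cases k) (auto simp: filt0_simps filt_eq heav_poly.sum[simplified])

text \<open>Evaluating the indeterminate at 1 adds up the values of all homogeneous parts, which is
  the specialisation u = 1.\<close>

definition eval_one :: "'a set \<Rightarrow> 'a signed set \<Rightarrow> 'a mpoly \<Rightarrow> 'a signed \<Rightarrow> int" where
  "eval_one I L p = (\<lambda>X\<in>topes I L. Polynomial.poly (ev X p) 1)"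

context
  fixes I :: "'a set" and L
  assumes fin: "finite I" and com: "conditional_oriented_matroid I L"
begin

lemma kernel_ideal_iff:
  assumes "p \<in> polys I"
  shows "p \<in> kernel_ideal I L \<longleftrightarrow> (\<forall>k. coeff_fun I L p k = \<zero>\<^bsub>GR I L\<^esub>)"
proof
  assume "p \<in> kernel_ideal I L"
  then show "\<forall>k. coeff_fun I L p k = \<zero>\<^bsub>GR I L\<^esub>"
    using ev_kernel_ideal[OF com fin] by (auto simp: coeff_fun_def)
next
  assume *: "\<forall>k. coeff_fun I L p k = \<zero>\<^bsub>GR I L\<^esub>"
  have "ev X p = 0" if "X \<in> topes I L" for X
  proof (rule poly_eqI)
    fix k
    have "coeff_fun I L p k X = 0" using * that by simp
    then show "Polynomial.coeff (ev X p) k = Polynomial.coeff 0 k" using that by (simp add: coeff_fun_def)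
  qed
  then show "p \<in> kernel_ideal I L" by (rule kernel_ideal_complete[OF fin com assms])
qed

lemma kernel_idl_mono: "x \<in> kernel_ideal I L \<Longrightarrow> x \<in> idl (polys I) (Kgens I L \<union> G)"
  unfolding kernel_ideal_def by (erule idl_mono) auto

text \<open>Multiplication by u shifts components by one index, so a component of index k of a
  multiple of u lies in F_{k-1}. Conversely, components satisfying this can be shifted back and
  lifted to a quotient by u.\<close>

lemma kernel_u0_iff:
  assumes p: "p \<in> polys I"
  shows "p \<in> idl (polys I) (Kgens I L \<union> {uu}) \<longleftrightarrow> (\<forall>k. coeff_fun I L p k \<in> filt0 I L k)"
proof
  assume "p \<in> idl (polys I) (Kgens I L \<union> {uu})"
  then show "\<forall>k. coeff_fun I L p k \<in> filt0 I L k"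
  proof (induction rule: idl.induct)
    case zero
    show ?case by (simp add: filt0_zero del: GR_simps)
  next
    case (step a g x)
    have "coeff_fun I L (a * g) k \<in> filt0 I L k" for k
    proof (cases "g \<in> Kgens I L")
      case True
      then have "a * g \<in> kernel_ideal I L" using step by (intro kernel_ideal_mult kernel_ideal_gen)
      then have "coeff_fun I L (a * g) k = \<zero>\<^bsub>GR I L\<^esub>"
        using kernel_ideal_iff kernel_ideal_polys by blast
      then show ?thesis using filt0_zero by (simp only:)
    next
      case False
      then have g: "g = uu" using step by auto
      show ?thesis
      proof (cases k)
        case 0
        have "Polynomial.coeff (ev X a * Polynomial.monom 1 (Suc 0)) 0 = 0" for X
          by (simp add: coeff_mult)
        then show ?thesis using 0 g by (simp add: filt0_simps coeff_fun_def)
      next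
        case (Suc j)
        have "coeff_fun I L (a * g) (Suc j) = coeff_fun I L a j"
          using g by (auto simp: coeff_fun_def mult.commute[of "ev _ a"] coeff_monom_mult)
        then show ?thesis using Suc coeff_fun_filt[OF step(1)] by (simp add: filt0_simps)
      qed
    qed
    then show ?case using step.IH by (simp add: coeff_fun_add filt0_add del: GR_simps)
  qed
next
  assume *: "\<forall>k. coeff_fun I L p k \<in> filt0 I L k"
  obtain N where N: "\<forall>k>N. coeff_fun I L p k = \<zero>\<^bsub>GR I L\<^esub>" using coeff_fun_bound by blast
  \<comment> \<open>The candidate for p / u modulo the kernel ideal: its component k is the
    component k + 1 of p, which lies in F_k by assumption.\<close>
  obtain q where q: "q \<in> polys I" "coeff_fun I L q = (\<lambda>k. coeff_fun I L p (Suc k))"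
  proof (rule coeff_fun_surj)
    show "coeff_fun I L p (Suc k) \<in> filt I L k" for k using *[rule_format, of "Suc k"] by (simp add: filt0_simps)
    show "coeff_fun I L p (Suc k) = \<zero>\<^bsub>GR I L\<^esub>" if "k > N" for k using N that by simp
  qed
  have "coeff_fun I L (p - q * uu) k = \<zero>\<^bsub>GR I L\<^esub>" for k
  proof (cases k)
    case 0
    have "Polynomial.coeff (ev X q * Polynomial.monom 1 (Suc 0)) 0 = 0" for X
      by (simp add: coeff_mult)
    moreover have "coeff_fun I L p 0 = \<zero>\<^bsub>GR I L\<^esub>" using * by (auto simp: filt0_simps dest: spec[of _ 0])
    then have "coeff_fun I L p 0 X = 0" if "X \<in> topes I L" for X using that by simp
    then have "Polynomial.coeff (ev X p) 0 = 0" if "X \<in> topes I L" for X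
      using that by (simp add: coeff_fun_def)
    ultimately show ?thesis using 0 by (auto simp: coeff_fun_def)
  next
    case (Suc j)
    have "Polynomial.coeff (ev X q) j = Polynomial.coeff (ev X p) (Suc j)" if "X \<in> topes I L" for X
      using fun_cong[OF fun_cong[OF q(2), of j], of X] that by (simp add: coeff_fun_def)
    moreover have "Polynomial.coeff (ev X q * Polynomial.monom 1 (Suc 0)) (Suc j) = Polynomial.coeff (ev X q) j" for X
      by (subst mult.commute) (simp add: coeff_monom_mult)
    ultimately show ?thesis using Suc by (auto simp: coeff_fun_def)
  qed
  then have "p - q * uu \<in> kernel_ideal I L"
    using p q by (subst kernel_ideal_iff) auto
  then have "q * uu + (p - q * uu) \<in> idl (polys I) (Kgens I L \<union> {uu})"
    using q by (intro idl.step kernel_idl_mono) auto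
  then show "p \<in> idl (polys I) (Kgens I L \<union> {uu})" by simp
qed

text \<open>Bring all homogeneous parts of p to one degree N by powers of u. At a tope the resulting
  polynomial has the value p(1) x^N = 0, where p(1) is the value for u = 1, so it lies in the kernel
  ideal; modulo u - 1 it agrees with p.\<close>

lemma kernel_u1_iff:
  assumes p: "p \<in> polys I"
  shows "p \<in> idl (polys I) (Kgens I L \<union> {uu - 1}) \<longleftrightarrow> eval_one I L p = \<zero>\<^bsub>GR I L\<^esub>"
proof
  assume *: "p \<in> idl (polys I) (Kgens I L \<union> {uu - 1})"
  have "Polynomial.poly (ev X p) 1 = 0" if X: "X \<in> topes I L" for X
    using *
  proof (induction rule: idl.induct)
    case (step a g x)
    have "Polynomial.poly (ev X g) 1 = 0"
      using step(2) ev_kernel_ideal[OF com fin kernel_ideal_gen X]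
      by (auto simp: poly_monom)
    then show ?case using step.IH by simp
  qed simp
  then show "eval_one I L p = \<zero>\<^bsub>GR I L\<^esub>" by (auto simp: eval_one_def intro!: restrict_ext)
next
  assume *: "eval_one I L p = \<zero>\<^bsub>GR I L\<^esub>"
  let ?N = "idl (polys I) (Kgens I L \<union> {uu - 1})"
  obtain N where N: "\<forall>k>N. coeff_fun I L p k = \<zero>\<^bsub>GR I L\<^esub>" using coeff_fun_bound by blast
  \<comment> \<open>These are not the homogeneous parts of p themselves, but homogeneous polynomials
    with the same values on the topes.\<close>
  have "\<exists>q. q \<in> hpolys I k \<and> coeff_fun I L q = (\<lambda>j. if j = k then coeff_fun I L p k else \<zero>\<^bsub>GR I L\<^esub>)
      \<and> (\<forall>X\<in>topes I L. ev X q = Polynomial.monom (coeff_fun I L p k X) k)" for k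
    using filt_lift_coeff[OF coeff_fun_filt[OF p, where L = L and k = k]] by metis
  then obtain q where q: "\<And>k. q k \<in> hpolys I k"
    "\<And>k X. X \<in> topes I L \<Longrightarrow> ev X (q k) = Polynomial.monom (Polynomial.coeff (ev X p) k) k"
    unfolding coeff_fun_def by (metis restrict_apply')
  have qp: "q k \<in> polys I" for k using q(1) by (rule hpolys_polys)
  have sum: "ev X p = (\<Sum>k\<le>N. Polynomial.monom (Polynomial.coeff (ev X p) k) k)" if "X \<in> topes I L" for X
  proof (rule poly_eqI)
    fix j
    have "coeff_fun I L p j X = 0" if "j > N" using N that \<open>X \<in> topes I L\<close> by simp
    then have "Polynomial.coeff (ev X p) j = 0" if "j > N"
      using that \<open>X \<in> topes I L\<close> by (simp add: coeff_fun_def)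
    then show "Polynomial.coeff (ev X p) j
        = Polynomial.coeff (\<Sum>k\<le>N. Polynomial.monom (Polynomial.coeff (ev X p) k) k) j"
      by (auto simp: coeff_sum)
  qed
  have "p - (\<Sum>k\<le>N. q k) \<in> kernel_ideal I L"
    using p qp q(2) sum by (intro kernel_ideal_complete[OF fin com]) auto
  moreover have "(\<Sum>k\<le>N. uu ^ (N - k) * q k) \<in> kernel_ideal I L"
  proof (rule kernel_ideal_complete[OF fin com])
    show "(\<Sum>k\<le>N. uu ^ (N - k) * q k) \<in> polys I" using qp by auto
    fix X assume X: "X \<in> topes I L"
    have "ev X (uu ^ (N - k) * q k) = Polynomial.monom (Polynomial.coeff (ev X p) k) N" if "k \<le> N" for k
      using q(2)[OF X, of k] that by (simp add: monom_power mult_monom)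
    then have "ev X (\<Sum>k\<le>N. uu ^ (N - k) * q k) = (\<Sum>k\<le>N. Polynomial.monom (Polynomial.coeff (ev X p) k) N)"
      unfolding ev_simps(8) by (intro sum.cong) auto
    also have "\<dots> = Polynomial.monom (\<Sum>k\<le>N. Polynomial.coeff (ev X p) k) N"
      by (simp add: monom_sum)
    also have "(\<Sum>k\<le>N. Polynomial.coeff (ev X p) k) = Polynomial.poly (ev X p) 1"
      by (subst (2) sum[OF X]) (simp add: poly_sum poly_monom)
    also have "\<dots> = 0" using fun_cong[OF *, of X] X by (simp add: eval_one_def)
    finally show "ev X (\<Sum>k\<le>N. uu ^ (N - k) * q k) = 0" by simp
  qed
  ultimately have 1: "p - (\<Sum>k\<le>N. q k) \<in> ?N" "(\<Sum>k\<le>N. uu ^ (N - k) * q k) \<in> ?N"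
    by (blast intro: kernel_idl_mono)+
  \<comment> \<open>Powers of u are 1 modulo u - 1, so the factors u^(N-k) may be dropped
    again.\<close>
  have "(uu ^ n - 1) \<in> ?N" for n
  proof (induction n)
    case (Suc n)
    have "uu ^ n * (uu - 1) + (uu ^ n - 1) \<in> ?N"
      using Suc by (intro idl.step) auto
    then show ?case by (simp add: algebra_simps)
  qed (simp add: idl.zero)
  then have "q k * (uu ^ (N - k) - 1) \<in> ?N" for k using qp by (intro idl_polys_mult)
  then have 2: "(\<Sum>k\<le>N. q k * (uu ^ (N - k) - 1)) \<in> ?N"
    by (intro idl_sum)
  have eq: "(p - (\<Sum>k\<le>N. q k)) + (\<Sum>k\<le>N. uu ^ (N - k) * q k) - (\<Sum>k\<le>N. q k * (uu ^ (N - k) - 1)) = p"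
    by (simp add: algebra_simps sum_subtractf)
  show "p \<in> ?N" using idl_polys_diff[OF idl_add[OF 1] 2] unfolding eq .
qed

end

section \<open>Presentations of quotients of the polynomial ring\<close>

lemma poly_ring_simps [simp]:
  "carrier (poly_ring I) = polys I" "p \<otimes>\<^bsub>poly_ring I\<^esub> q = p * q" "p \<oplus>\<^bsub>poly_ring I\<^esub> q = p + q"
  "\<one>\<^bsub>poly_ring I\<^esub> = 1" "\<zero>\<^bsub>poly_ring I\<^esub> = 0"
  by (simp_all add: poly_ring_def polys_def)

lemma cring_poly_ring: "cring (poly_ring I)"
proof (rule cringI)
  show "abelian_group (poly_ring I)"
  proof (rule abelian_groupI)
    fix p assume "p \<in> carrier (poly_ring I)"
    then show "\<exists>q\<in>carrier (poly_ring I). q \<oplus>\<^bsub>poly_ring I\<^esub> p = \<zero>\<^bsub>poly_ring I\<^esub>"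
      by (intro bexI[of _ "- p"]) auto
  qed (auto simp: algebra_simps)
  show "Group.comm_monoid (poly_ring I)"
    by (rule comm_monoidI) (auto simp: algebra_simps)
qed (auto simp: algebra_simps)

lemma minus_eq_zero_iff:
  assumes "cring A" "a \<in> carrier A" "b \<in> carrier A"
  shows "a \<ominus>\<^bsub>A\<^esub> b = \<zero>\<^bsub>A\<^esub> \<longleftrightarrow> a = b"
proof -
  interpret cring A by fact
  have "a = (a \<ominus>\<^bsub>A\<^esub> b) \<oplus>\<^bsub>A\<^esub> b" using assms(2,3) by algebra
  then show ?thesis using assms(2,3) by (auto simp: minus_eq r_neg)
qed

text \<open>A is the polynomial ring modulo the ideal generated by G, with \<open>\<alpha>\<close>
  as quotient map. This replaces cosets of cosets of cosets by a list of generators in one fixed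
  ring.\<close>

definition presents :: "'a set \<Rightarrow> ('a mpoly \<Rightarrow> 'b) \<Rightarrow> ('b, 'm) ring_scheme \<Rightarrow> 'a mpoly set \<Rightarrow> bool" where
  "presents I \<alpha> A G \<longleftrightarrow> cring A \<and> \<alpha> \<in> ring_hom (poly_ring I) A \<and> \<alpha> ` polys I = carrier A \<and>
     G \<subseteq> polys I \<and> (\<forall>p\<in>polys I. \<alpha> p = \<zero>\<^bsub>A\<^esub> \<longleftrightarrow> p \<in> idl (polys I) G)"

context
  fixes I :: "'a set" and \<alpha> and A :: "('b, 'm) ring_scheme" and G
  assumes pres: "presents I \<alpha> A G"
begin

lemma presents_cring: "cring A"
  and presents_hom: "\<alpha> \<in> ring_hom (poly_ring I) A"
  and presents_image: "\<alpha> ` polys I = carrier A"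
  and presents_gens: "G \<subseteq> polys I"
  and presents_kernel: "p \<in> polys I \<Longrightarrow> \<alpha> p = \<zero>\<^bsub>A\<^esub> \<longleftrightarrow> p \<in> idl (polys I) G"
  using pres by (auto simp: presents_def)

interpretation A: cring A by (rule presents_cring)

interpretation \<alpha>: ring_hom_cring "poly_ring I" A \<alpha>
  by (rule ring_hom_cringI[OF cring_poly_ring presents_cring presents_hom])

lemma presents_closed [simp]: "p \<in> polys I \<Longrightarrow> \<alpha> p \<in> carrier A"
  using \<alpha>.hom_closed by simp

lemma presents_add: "p \<in> polys I \<Longrightarrow> q \<in> polys I \<Longrightarrow> \<alpha> (p + q) = \<alpha> p \<oplus>\<^bsub>A\<^esub> \<alpha> q"
  and presents_mult: "p \<in> polys I \<Longrightarrow> q \<in> polys I \<Longrightarrow> \<alpha> (p * q) = \<alpha> p \<otimes>\<^bsub>A\<^esub> \<alpha> q"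
  using \<alpha>.hom_add[of p q] \<alpha>.hom_mult[of p q] by simp_all

lemma presents_0: "\<alpha> 0 = \<zero>\<^bsub>A\<^esub>" and presents_1: "\<alpha> 1 = \<one>\<^bsub>A\<^esub>"
  using \<alpha>.hom_zero \<alpha>.hom_one by simp_all

lemma presents_uminus:
  assumes "p \<in> polys I"
  shows "\<alpha> (- p) = \<ominus>\<^bsub>A\<^esub> \<alpha> p"
proof -
  have "\<alpha> (- p) \<oplus>\<^bsub>A\<^esub> \<alpha> p = \<zero>\<^bsub>A\<^esub>"
    using assms by (simp add: presents_add[symmetric] presents_0)
  then show ?thesis using assms by (intro A.minus_equality[symmetric]) auto
qed

lemma presents_diff: "p \<in> polys I \<Longrightarrow> q \<in> polys I \<Longrightarrow> \<alpha> (p - q) = \<alpha> p \<ominus>\<^bsub>A\<^esub> \<alpha> q"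
  using presents_add[of p "- q"] by (simp add: presents_uminus a_minus_def)

lemma presents_eq_iff:
  assumes "p \<in> polys I" "q \<in> polys I"
  shows "\<alpha> p = \<alpha> q \<longleftrightarrow> p - q \<in> idl (polys I) G"
proof -
  have "\<alpha> p = \<alpha> q \<longleftrightarrow> \<alpha> p \<ominus>\<^bsub>A\<^esub> \<alpha> q = \<zero>\<^bsub>A\<^esub>"
    using assms by (simp add: minus_eq_zero_iff[OF presents_cring])
  then have "\<alpha> p = \<alpha> q \<longleftrightarrow> \<alpha> (p - q) = \<zero>\<^bsub>A\<^esub>"
    using assms by (simp add: presents_diff)
  then show ?thesis using presents_kernel[of "p - q"] assms by simp
qed

lemma presents_prod:
  assumes "finite S" "\<And>i. i \<in> S \<Longrightarrow> f i \<in> polys I"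
  shows "finprod A (\<lambda>i. \<alpha> (f i)) S = \<alpha> (\<Prod>i\<in>S. f i)"
  using assms
  by (induction S rule: finite_induct)
    (auto simp: presents_1 presents_mult A.finprod_insert Pi_def)

lemma presents_surj: "x \<in> carrier A \<Longrightarrow> \<exists>p\<in>polys I. x = \<alpha> p"
  using presents_image by blast

context
  fixes H assumes H: "H \<subseteq> polys I"
begin

lemma idl_in_polys: "x \<in> idl (polys I) H \<Longrightarrow> x \<in> polys I"
  using idl_polys_subset H by blast

lemma presents_ideal: "ideal (\<alpha> ` idl (polys I) H) A"
proof (rule idealI)
  show "subgroup (\<alpha> ` idl (polys I) H) (add_monoid A)"
  proof (rule A.add.subgroupI)
    show "\<alpha> ` idl (polys I) H \<subseteq> carrier A" using idl_in_polys by auto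
    show "\<alpha> ` idl (polys I) H \<noteq> {}" using idl.zero by blast
    show "\<ominus>\<^bsub>A\<^esub> x \<in> \<alpha> ` idl (polys I) H" if "x \<in> \<alpha> ` idl (polys I) H" for x
      using that idl_in_polys by (auto simp: presents_uminus[symmetric])
    show "x \<oplus>\<^bsub>A\<^esub> y \<in> \<alpha> ` idl (polys I) H"
      if "x \<in> \<alpha> ` idl (polys I) H" "y \<in> \<alpha> ` idl (polys I) H" for x y
      using that idl_in_polys by (auto simp: presents_add[symmetric])
  qed
  show l: "x \<otimes>\<^bsub>A\<^esub> a \<in> \<alpha> ` idl (polys I) H" if a: "a \<in> \<alpha> ` idl (polys I) H" and x: "x \<in> carrier A" for a x
  proof -
    from x obtain p where p: "p \<in> polys I" "x = \<alpha> p" using presents_surj by blast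
    from a obtain q where q: "q \<in> idl (polys I) H" "a = \<alpha> q" by blast
    have "x \<otimes>\<^bsub>A\<^esub> a = \<alpha> (p * q)" using p q idl_in_polys by (simp add: presents_mult)
    then show ?thesis using p q by auto
  qed
  show "a \<otimes>\<^bsub>A\<^esub> x \<in> \<alpha> ` idl (polys I) H" if a: "a \<in> \<alpha> ` idl (polys I) H" and x: "x \<in> carrier A" for a x
  proof -
    have "a \<in> carrier A" using a idl_in_polys by auto
    then show ?thesis using l[OF a x] A.m_comm[OF x] by simp
  qed
qed (rule A.ring_axioms)

lemma presents_genideal: "Idl\<^bsub>A\<^esub> (\<alpha> ` H) = \<alpha> ` idl (polys I) H"
proof
  show "Idl\<^bsub>A\<^esub> (\<alpha> ` H) \<subseteq> \<alpha> ` idl (polys I) H"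
    by (rule A.genideal_minimal[OF presents_ideal]) (auto intro: idl_polys_gen)
  have sub: "\<alpha> ` H \<subseteq> carrier A" using H by auto
  interpret J: ideal "Idl\<^bsub>A\<^esub> (\<alpha> ` H)" A by (rule A.genideal_ideal[OF sub])
  have "\<alpha> x \<in> Idl\<^bsub>A\<^esub> (\<alpha> ` H)" if "x \<in> idl (polys I) H" for x
    using that
  proof (induction rule: idl.induct)
    case zero
    show ?case by (simp add: presents_0)
  next
    case (step a g x)
    then have g: "g \<in> polys I" "\<alpha> g \<in> Idl\<^bsub>A\<^esub> (\<alpha> ` H)"
      using H A.genideal_self[OF sub] by auto
    have "\<alpha> (a * g + x) = \<alpha> a \<otimes>\<^bsub>A\<^esub> \<alpha> g \<oplus>\<^bsub>A\<^esub> \<alpha> x"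
      using g step idl_in_polys by (simp add: presents_add presents_mult)
    then show ?case using step g by (simp add: J.I_l_closed J.a_closed)
  qed
  then show "\<alpha> ` idl (polys I) H \<subseteq> Idl\<^bsub>A\<^esub> (\<alpha> ` H)" by blast
qed

text \<open>Two representatives of one element of A differ by an element of the ideal of G, so
  pulling back an ideal adjoins G to its generators.\<close>

lemma presents_mem_image:
  assumes p: "p \<in> polys I"
  shows "\<alpha> p \<in> \<alpha> ` idl (polys I) H \<longleftrightarrow> p \<in> idl (polys I) (G \<union> H)"
proof
  assume "\<alpha> p \<in> \<alpha> ` idl (polys I) H"
  then obtain q where q: "q \<in> idl (polys I) H" "\<alpha> p = \<alpha> q" by auto
  then have "p - q \<in> idl (polys I) G" using p idl_in_polys presents_eq_iff by blast
  then have "p - q \<in> idl (polys I) (G \<union> H)" by (rule idl_mono) auto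
  moreover have "q \<in> idl (polys I) (G \<union> H)" using q(1) by (rule idl_mono) auto
  ultimately show "p \<in> idl (polys I) (G \<union> H)" using idl_add by fastforce
next
  interpret J: ideal "\<alpha> ` idl (polys I) H" A by (rule presents_ideal)
  assume "p \<in> idl (polys I) (G \<union> H)"
  then show "\<alpha> p \<in> \<alpha> ` idl (polys I) H"
  proof (induction rule: idl.induct)
    case zero
    show ?case using idl.zero by blast
  next
    case (step a g x)
    have x: "x \<in> polys I" using step(3) H presents_gens by (intro idl_polys_subset[of x I "G \<union> H"]) auto
    have g: "g \<in> polys I" using step H presents_gens by auto
    have "\<alpha> g \<in> \<alpha> ` idl (polys I) H"
    proof (cases "g \<in> G")
      case True
      then have "\<alpha> g = \<zero>\<^bsub>A\<^esub>" using presents_kernel[OF g] idl_polys_gen by blast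
      then show ?thesis by simp
    next
      case False
      then show ?thesis using step by (auto intro: idl_polys_gen)
    qed
    moreover have "\<alpha> (a * g + x) = \<alpha> a \<otimes>\<^bsub>A\<^esub> \<alpha> g \<oplus>\<^bsub>A\<^esub> \<alpha> x"
      using g x step by (simp add: presents_add presents_mult)
    ultimately show ?case using step by (simp add: J.I_l_closed J.a_closed)
  qed
qed

text \<open>Iterating this step computes R, its specialisations and their quotients by collecting
  generators.\<close>

lemma presents_quot:
  "presents I (\<lambda>p. (\<alpha> ` idl (polys I) H) +>\<^bsub>A\<^esub> \<alpha> p) (A Quot (\<alpha> ` idl (polys I) H)) (G \<union> H)"
proof -
  interpret J: ideal "\<alpha> ` idl (polys I) H" A by (rule presents_ideal)
  let ?J = "\<alpha> ` idl (polys I) H"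
  have hom: "(\<lambda>p. ?J +>\<^bsub>A\<^esub> \<alpha> p) \<in> ring_hom (poly_ring I) (A Quot ?J)"
    using ring_hom_trans[OF presents_hom J.rcos_ring_hom] by (simp add: comp_def)
  have ker: "?J +>\<^bsub>A\<^esub> \<alpha> p = \<zero>\<^bsub>A Quot ?J\<^esub> \<longleftrightarrow> p \<in> idl (polys I) (G \<union> H)" if "p \<in> polys I" for p
  proof -
    have "?J +>\<^bsub>A\<^esub> \<alpha> p = \<zero>\<^bsub>A Quot ?J\<^esub> \<longleftrightarrow> \<alpha> p \<in> ?J"
      using J.a_rcos_const[of "\<alpha> p"] J.a_rcos_self[of "\<alpha> p"] that
      by (auto simp: FactRing_def simp del: image_iff)
    then show ?thesis using presents_mem_image[OF that] by simp
  qed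
  have "carrier (A Quot ?J) = (\<lambda>x. ?J +>\<^bsub>A\<^esub> x) ` carrier A"
    by (auto simp: FactRing_simps)
  then have "(\<lambda>p. ?J +>\<^bsub>A\<^esub> \<alpha> p) ` polys I = carrier (A Quot ?J)"
    by (simp only: presents_image[symmetric] image_image)
  then show ?thesis unfolding presents_def
    using J.quotient_is_cring[OF presents_cring] hom ker H presents_gens by auto
qed

end

text \<open>An element of the ideal of the union is split by sorting its summands according to the
  generator they contain.\<close>

lemma presents_set_add:
  assumes H: "H \<subseteq> polys I" "H' \<subseteq> polys I"
  shows "\<alpha> ` idl (polys I) H <+>\<^bsub>A\<^esub> \<alpha> ` idl (polys I) H' = \<alpha> ` idl (polys I) (H \<union> H')"
proof
  have "\<alpha> x \<oplus>\<^bsub>A\<^esub> \<alpha> y \<in> \<alpha> ` idl (polys I) (H \<union> H')"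
    if "x \<in> idl (polys I) H" "y \<in> idl (polys I) H'" for x y
  proof -
    have "x + y \<in> idl (polys I) (H \<union> H')"
      using idl_mono[OF that(1), of "polys I" "H \<union> H'"] idl_mono[OF that(2), of "polys I" "H \<union> H'"]
      by auto
    moreover have "\<alpha> (x + y) = \<alpha> x \<oplus>\<^bsub>A\<^esub> \<alpha> y"
      using idl_in_polys[OF H(1) that(1)] idl_in_polys[OF H(2) that(2)] by (rule presents_add)
    ultimately show ?thesis by (metis imageI)
  qed
  then show "\<alpha> ` idl (polys I) H <+>\<^bsub>A\<^esub> \<alpha> ` idl (polys I) H' \<subseteq> \<alpha> ` idl (polys I) (H \<union> H')"
    by (auto simp: set_add_def' simp del: image_iff)
next
  have "\<exists>y\<in>idl (polys I) H. \<exists>z\<in>idl (polys I) H'. x = y + z" if "x \<in> idl (polys I) (H \<union> H')" for x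
    using that
  proof (induction rule: idl.induct)
    case zero
    show ?case using idl.zero[of "polys I" H] idl.zero[of "polys I" H'] by force
  next
    case (step a g x)
    then obtain y z where yz: "y \<in> idl (polys I) H" "z \<in> idl (polys I) H'" "x = y + z" by blast
    show ?case
    proof (cases "g \<in> H")
      case True
      then have "a * g + y \<in> idl (polys I) H" using step yz by (intro idl.step)
      moreover have "a * g + x = (a * g + y) + z" using yz by simp
      ultimately show ?thesis using yz by blast
    next
      case False
      then have "a * g + z \<in> idl (polys I) H'" using step yz by (intro idl.step) auto
      moreover have "a * g + x = y + (a * g + z)" using yz by simp
      ultimately show ?thesis using yz by blast
    qed
  qed
  then show "\<alpha> ` idl (polys I) (H \<union> H') \<subseteq> \<alpha> ` idl (polys I) H <+>\<^bsub>A\<^esub> \<alpha> ` idl (polys I) H'"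
    using idl_in_polys[OF H(1)] idl_in_polys[OF H(2)]
    by (fastforce simp: set_add_def' presents_add)
qed

text \<open>The homomorphism theorem: \<open>\<alpha>\<close> and \<open>\<psi>\<close> identify the
  same pairs of polynomials.\<close>

lemma presents_ring_iso:
  assumes \<psi>: "\<psi> \<in> ring_hom (poly_ring I) C" "\<psi> ` polys I = carrier C"
    and eq: "\<And>p q. p \<in> polys I \<Longrightarrow> q \<in> polys I \<Longrightarrow> \<psi> p = \<psi> q \<longleftrightarrow> p - q \<in> idl (polys I) G"
  shows "\<exists>\<phi>\<in>ring_iso A C. \<forall>p\<in>polys I. \<phi> (\<alpha> p) = \<psi> p"
proof -
  \<comment> \<open>Any preimage under \<open>\<alpha>\<close> serves, since by \<open>eq\<close>
    the value of \<open>\<psi>\<close> does not depend on it.\<close>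
  define \<phi> where "\<phi> x = \<psi> (SOME p. p \<in> polys I \<and> \<alpha> p = x)" for x
  have \<phi>: "\<phi> (\<alpha> p) = \<psi> p" if p: "p \<in> polys I" for p
  proof -
    let ?q = "SOME q. q \<in> polys I \<and> \<alpha> q = \<alpha> p"
    have "?q \<in> polys I \<and> \<alpha> ?q = \<alpha> p" by (rule someI[of _ p]) (simp add: p)
    then show ?thesis using presents_eq_iff[of ?q p] eq[of ?q p] p by (simp add: \<phi>_def)
  qed
  have car: "carrier A = \<alpha> ` polys I" by (rule presents_image[symmetric])
  have "\<phi> \<in> ring_hom A C"
  proof (rule ring_hom_memI)
    show "\<phi> x \<in> carrier C" if "x \<in> carrier A" for x
      using that \<psi>(2) by (auto simp: car \<phi>)
    show "\<phi> (x \<otimes>\<^bsub>A\<^esub> y) = \<phi> x \<otimes>\<^bsub>C\<^esub> \<phi> y" "\<phi> (x \<oplus>\<^bsub>A\<^esub> y) = \<phi> x \<oplus>\<^bsub>C\<^esub> \<phi> y"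
      if "x \<in> carrier A" "y \<in> carrier A" for x y
      using that ring_hom_mult[OF \<psi>(1)] ring_hom_add[OF \<psi>(1)]
      by (auto simp: car \<phi> presents_mult[symmetric] presents_add[symmetric])
    show "\<phi> \<one>\<^bsub>A\<^esub> = \<one>\<^bsub>C\<^esub>"
      using \<phi>[of 1] ring_hom_one[OF \<psi>(1)] by (simp add: presents_1)
  qed
  moreover have "bij_betw \<phi> (carrier A) (carrier C)"
    unfolding bij_betw_def
  proof
    show "inj_on \<phi> (carrier A)"
      by (rule inj_onI) (auto simp: car \<phi> eq presents_eq_iff)
    show "\<phi> ` carrier A = carrier C"
      unfolding car image_image \<psi>(2)[symmetric] by (intro image_cong refl \<phi>)
  qed
  ultimately show ?thesis using \<phi> by (auto simp: ring_iso_def)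
qed

end

lemma presents_poly_ring: "presents I (\<lambda>p. p) (poly_ring I) {}"
proof -
  have "p = 0" if "p \<in> idl (polys I) {}" for p using that by induction auto
  then show ?thesis unfolding presents_def
    using cring_poly_ring by (auto simp: ring_hom_def idl.zero)
qed

section \<open>The ring R and the elements e_X and f_X in it\<close>

definition R_class :: "'a set \<Rightarrow> 'a mpoly \<Rightarrow> 'a mpoly set" where
  "R_class I p = R_rel I +>\<^bsub>poly_ring I\<^esub> p"

lemma R_rel_eq: "R_rel I = idl (polys I) (Rgens I)"
  using presents_genideal[OF presents_poly_ring Rgens_polys, of I]
  by (simp add: R_rel_def Rgens_def)

lemma presents_R_ring: "presents I (R_class I) (R_ring I) (Rgens I)"
  using presents_quot[OF presents_poly_ring Rgens_polys, of I]
  by (simp add: R_ring_def R_class_def[abs_def] R_rel_eq)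

lemma e_signed_eq:
  assumes "finite I" "signed_set I X"
  shows "e_signed I X = R_class I (ep X)"
proof -
  note pres = presents_R_ring[of I]
  interpret R: cring "R_ring I" by (rule presents_cring[OF pres])
  have fin: "finite (fst X)" "finite (snd X)" and sub: "fst X \<subseteq> I" "snd X \<subseteq> I"
    using assms by (auto simp: signed_set_def intro: finite_subset)
  have "finprod (R_ring I) (e_plus I) (fst X) = R_class I (\<Prod>i\<in>fst X. pp i)"
    unfolding e_plus_def[abs_def] R_class_def[symmetric]
    using sub by (intro presents_prod[OF pres fin(1)]) auto
  moreover have "finprod (R_ring I) (\<lambda>i. \<ominus>\<^bsub>R_ring I\<^esub> e_minus I i) (snd X) = R_class I (\<Prod>i\<in>snd X. - mm i)"
  proof -
    have "finprod (R_ring I) (\<lambda>i. \<ominus>\<^bsub>R_ring I\<^esub> e_minus I i) (snd X) = finprod (R_ring I) (\<lambda>i. R_class I (- mm i)) (snd X)"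
      using sub by (intro R.finprod_cong refl)
        (auto simp: simp_implies_def e_minus_def R_class_def[symmetric] presents_uminus[OF pres] presents_closed[OF pres])
    also have "\<dots> = R_class I (\<Prod>i\<in>snd X. - mm i)"
      using sub by (intro presents_prod[OF pres fin(2)]) auto
    finally show ?thesis .
  qed
  moreover have "(\<Prod>i\<in>fst X. pp i) \<in> polys I" "(\<Prod>i\<in>snd X. - mm i) \<in> polys I"
    using sub by (auto intro!: polys_prod polys_uminus)
  ultimately show ?thesis by (simp add: e_signed_def ep_def presents_mult[OF pres])
qed

text \<open>The relations of \<open>R\<close> are those of the matroid of all signed sets, which has no circuits.\<close>

lemma u_nonzerodivisor:
  assumes fin: "finite I" and p: "p \<in> polys I" "uu * p \<in> idl (polys I) (Rgens I)"
  shows "p \<in> idl (polys I) (Rgens I)"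
proof -
  let ?L = "Collect (signed_set I)"
  have com: "conditional_oriented_matroid I ?L"
    unfolding conditional_oriented_matroid_def
  proof (intro conjI ballI)
    fix X Y i assume XY: "X \<in> ?L" "Y \<in> ?L" and "i \<in> sep X Y"
    \<comment> \<open>All signed sets are available, so the eliminated covector can be written down
      directly.\<close>
    let ?Z = "del i (composition X Y)"
    have i: "i \<in> sep X Y" by fact
    have "signed_set I ?Z"
      using XY signed_set_composition[of I X Y] by (auto simp: signed_set_def)
    moreover have "sign_at ?Z j = sign_at (composition X Y) j" if "j \<in> I - sep X Y" for j
    proof -
      have "j \<noteq> i" using that i by blast
      then show ?thesis by (simp add: sign_at_def)
    qed
    ultimately show "\<exists>Z\<in>?L. sign_at Z i = 0 \<and> (\<forall>j\<in>I - sep X Y. sign_at Z j = sign_at (composition X Y) j)"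
      using i by (intro bexI[of _ ?Z] conjI ballI) (auto simp: sign_at_eq_0_iff)
  qed (auto intro: signed_set_composition)
  have "faced ?L X" if "signed_set I X" for X using that unfolding faced_def by blast
  then have "circuits I ?L = {}" by (auto simp: circuits_eq[OF com fin] cmin_def)
  then have "kernel_ideal I ?L = idl (polys I) (Rgens I)"
    by (simp add: kernel_ideal_def Kgens_def)
  moreover have "p \<in> kernel_ideal I ?L"
  proof (rule kernel_ideal_complete[OF fin com p(1)])
    fix X
    have "Polynomial.monom 1 1 * ev X p = 0" using ev_Rgens[OF p(2), of X] by simp
    then show "ev X p = 0" by (rule monom_1_mult_eq_0)
  qed
  ultimately show ?thesis by simp
qed

text \<open>The equation defining \<open>f_signed\<close> has only one solution because u is a
  non-zero-divisor, and the class of f solves it.\<close>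

lemma f_signed_eq:
  assumes fin: "finite I" and X: "signed_set I X" and f: "is_f I X f"
  shows "f_signed I X = R_class I f"
proof -
  note pres = presents_R_ring[of I]
  have eX: "ep X \<in> polys I" "ep (opp X) \<in> polys I" using X by (auto intro: ep_polys)
  have iff: "u_elem I \<otimes>\<^bsub>R_ring I\<^esub> R_class I g = e_signed I X \<ominus>\<^bsub>R_ring I\<^esub> e_signed I (opp X) \<longleftrightarrow>
      uu * g - (ep X - ep (opp X)) \<in> idl (polys I) (Rgens I)" if g: "g \<in> polys I" for g
  proof -
    have "u_elem I \<otimes>\<^bsub>R_ring I\<^esub> R_class I g = R_class I (uu * g)"
      using g by (simp add: u_elem_def R_class_def[symmetric] presents_mult[OF pres])
    moreover have "e_signed I X \<ominus>\<^bsub>R_ring I\<^esub> e_signed I (opp X) = R_class I (ep X - ep (opp X))"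
      using eX X fin by (simp add: e_signed_eq presents_diff[OF pres])
    ultimately show ?thesis using presents_eq_iff[OF pres, of "uu * g"] g eX by simp
  qed
  have f': "f \<in> polys I" using f by (simp add: is_f_def)
  show ?thesis unfolding f_signed_def
  proof (rule the_equality)
    show "R_class I f \<in> carrier (R_ring I) \<and>
        u_elem I \<otimes>\<^bsub>R_ring I\<^esub> R_class I f = e_signed I X \<ominus>\<^bsub>R_ring I\<^esub> e_signed I (opp X)"
      using f f' iff by (simp add: is_f_def presents_closed[OF pres])
  next
    fix x assume x: "x \<in> carrier (R_ring I) \<and>
        u_elem I \<otimes>\<^bsub>R_ring I\<^esub> x = e_signed I X \<ominus>\<^bsub>R_ring I\<^esub> e_signed I (opp X)"
    then obtain g where g: "g \<in> polys I" "x = R_class I g" using presents_surj[OF pres] by blast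
    then have "uu * g - (ep X - ep (opp X)) \<in> idl (polys I) (Rgens I)" using x iff by blast
    moreover have "uu * f - (ep X - ep (opp X)) \<in> idl (polys I) (Rgens I)"
      using f by (simp add: is_f_def)
    ultimately have "(uu * g - (ep X - ep (opp X))) - (uu * f - (ep X - ep (opp X))) \<in> idl (polys I) (Rgens I)"
      by (rule idl_polys_diff)
    then have "uu * (g - f) \<in> idl (polys I) (Rgens I)" by (simp add: algebra_simps)
    then have "g - f \<in> idl (polys I) (Rgens I)"
      by (rule u_nonzerodivisor[OF fin polys_diff[OF g(1) f']])
    then show "x = R_class I f" using presents_eq_iff[OF pres g(1) f'] g(2) by simp
  qed
qed

section \<open>Presentations of the three quotient rings\<close>

definition fgens :: "'a set \<Rightarrow> 'a signed set \<Rightarrow> 'a mpoly set" where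
  "fgens I L = {f. \<exists>X\<in>circuits I L. opp X \<in> circuits I L \<and> is_f I X f}"

lemma Kgens_eq: "Kgens I L = Rgens I \<union> (ep ` circuits I L \<union> fgens I L)"
  by (auto simp: Kgens_def fgens_def)

lemma egens_polys: "ep ` circuits I L \<subseteq> polys I" and fgens_polys: "fgens I L \<subseteq> polys I"
  using Kgens_polys[of I L] by (auto simp: Kgens_eq)

lemma I_ideal_eq:
  assumes "finite I"
  shows "I_ideal I L = R_class I ` idl (polys I) (ep ` circuits I L)"
proof -
  have "{e_signed I X | X. X \<in> circuits I L} = R_class I ` ep ` circuits I L"
    unfolding Setcompr_eq_image image_image
    by (intro image_cong refl e_signed_eq[OF assms]) (simp add: circuits_def)
  then show ?thesis
    using presents_genideal[OF presents_R_ring egens_polys] by (simp add: I_ideal_def)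
qed

text \<open>Representatives exist by \<open>is_f_exists\<close> and all of them have the class f_X,
  so taking classes turns \<open>fgens\<close> into exactly the generators of J.\<close>

lemma J_ideal_eq:
  assumes "finite I"
  shows "J_ideal I L = R_class I ` idl (polys I) (fgens I L)"
proof -
  have sg: "X \<in> circuits I L \<Longrightarrow> signed_set I X" for X by (simp add: circuits_def)
  have "{f_signed I X | X. X \<in> circuits I L \<and> opp X \<in> circuits I L} = R_class I ` fgens I L"
  proof (intro equalityI subsetI)
    fix x assume "x \<in> {f_signed I X | X. X \<in> circuits I L \<and> opp X \<in> circuits I L}"
    then obtain X where X: "x = f_signed I X" "X \<in> circuits I L" "opp X \<in> circuits I L" by auto
    obtain f where f: "is_f I X f" using is_f_exists[OF assms sg[OF X(2)]] by auto
    then have "f \<in> fgens I L" using X unfolding fgens_def by blast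
    moreover have "x = R_class I f" using X f_signed_eq[OF assms sg[OF X(2)] f] by simp
    ultimately show "x \<in> R_class I ` fgens I L" by simp
  next
    fix x assume "x \<in> R_class I ` fgens I L"
    then obtain X f where X: "x = R_class I f" "X \<in> circuits I L" "opp X \<in> circuits I L" "is_f I X f"
      by (auto simp: fgens_def)
    then have "x = f_signed I X" using f_signed_eq[OF assms sg[OF X(2)]] by simp
    then show "x \<in> {f_signed I X | X. X \<in> circuits I L \<and> opp X \<in> circuits I L}" using X by blast
  qed
  then show ?thesis
    using presents_genideal[OF presents_R_ring fgens_polys] by (simp add: J_ideal_def)
qed

lemma presents_R_quot:
  assumes "finite I"
  shows "presents I (\<lambda>p. R_quot_class I L (R_class I p)) (R_quot I L) (Kgens I L)"
proof -
  have "I_ideal I L <+>\<^bsub>R_ring I\<^esub> J_ideal I L = R_class I ` idl (polys I) (ep ` circuits I L \<union> fgens I L)"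
    by (simp add: I_ideal_eq[OF assms] J_ideal_eq[OF assms]
        presents_set_add[OF presents_R_ring egens_polys fgens_polys])
  then show ?thesis
    using presents_quot[OF presents_R_ring Un_least[OF egens_polys fgens_polys], of I L L]
    by (simp add: R_quot_class_def R_quot_def Kgens_eq)
qed

lemma presents_R_at:
  "presents I (\<lambda>p. to_R_at I m (R_class I p)) (R_at I m) (Rgens I \<union> {uu - of_nat m})"
proof -
  note pres = presents_R_ring[of I]
  interpret R: cring "R_ring I" by (rule presents_cring[OF pres])
  have m_poly: "of_nat m \<in> polys I" for m using polys_of_int[of "int m" I] by simp
  have m: "[m] \<cdot>\<^bsub>R_ring I\<^esub> \<one>\<^bsub>R_ring I\<^esub> = R_class I (of_nat m)" for m
  proof (induction m)
    case 0
    show ?case by (simp add: presents_0[OF pres])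
  next
    case (Suc m)
    have "R_class I (of_nat m + 1) = R_class I (of_nat m) \<oplus>\<^bsub>R_ring I\<^esub> \<one>\<^bsub>R_ring I\<^esub>"
      using m_poly by (simp add: presents_add[OF pres] presents_1[OF pres])
    then show ?case using Suc by (simp add: add.commute)
  qed
  have "u_elem I \<ominus>\<^bsub>R_ring I\<^esub> [m] \<cdot>\<^bsub>R_ring I\<^esub> \<one>\<^bsub>R_ring I\<^esub> = R_class I (uu - of_nat m)"
    using m_poly by (simp add: m u_elem_def R_class_def[symmetric] presents_diff[OF pres])
  then have "u_ideal I m = R_class I ` idl (polys I) {uu - of_nat m}"
    using presents_genideal[OF pres, of "{uu - of_nat m}"] m_poly by (simp add: u_ideal_def)
  then show ?thesis
    using presents_quot[OF pres, of "{uu - of_nat m}"] m_poly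
    by (simp add: to_R_at_def R_at_def)
qed

text \<open>The ideals I and J are images of polynomial ideals, hence so are their images after
  specialisation, and adding these just joins the generators.\<close>

lemma presents_R_at_quot:
  assumes "finite I"
  shows "presents I (\<lambda>p. R_at_quot_class I L m (R_class I p)) (R_at_quot I L m)
    (Kgens I L \<union> {uu - of_nat m})"
proof -
  note pres = presents_R_at[of I m]
  have "IJ_at I L m = (\<lambda>p. to_R_at I m (R_class I p)) ` idl (polys I) (ep ` circuits I L \<union> fgens I L)"
    using presents_set_add[OF pres egens_polys fgens_polys]
    by (simp add: IJ_at_def I_ideal_eq[OF assms] J_ideal_eq[OF assms] image_image)
  moreover have "Rgens I \<union> {uu - of_nat m} \<union> (ep ` circuits I L \<union> fgens I L)
      = Kgens I L \<union> {uu - of_nat m}"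
    by (auto simp: Kgens_eq)
  ultimately show ?thesis
    using presents_quot[OF pres Un_least[OF egens_polys fgens_polys], of L L]
    by (simp only: R_at_quot_class_def R_at_quot_def)
qed

section \<open>The three target rings\<close>

lemma coeff_fun_eq_iff:
  "coeff_fun I L p k = coeff_fun I L q k \<longleftrightarrow> coeff_fun I L (p - q) k = \<zero>\<^bsub>GR I L\<^esub>"
  unfolding coeff_fun_diff by (rule minus_eq_zero_iff[symmetric]) (simp_all add: cring_GR)

lemma filt_carrier: "f \<in> filt I L k \<Longrightarrow> f \<in> carrier (GR I L)"
  by (simp add: filt_eq heav_poly_carrier)

lemma filt_zero: "\<zero>\<^bsub>GR I L\<^esub> \<in> filt I L k"
  by (simp only: filt_eq mem_Collect_eq heav_poly_zero)

lemma filt_mult: "f \<in> filt I L j \<Longrightarrow> g \<in> filt I L k \<Longrightarrow> f \<otimes>\<^bsub>GR I L\<^esub> g \<in> filt I L (j + k)"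
  by (simp only: filt_eq mem_Collect_eq heav_poly.prod)

section \<open>The ring of functions on the topes\<close>

lemma eval_one_hom: "eval_one I L \<in> ring_hom (poly_ring I) (GR I L)"
  by (rule ring_hom_memI) (auto simp: eval_one_def intro!: GR_eqI[of _ I L])

text \<open>A tope is determined by its positive part, so its indicator function is a product of
  Heaviside functions, one for each element, chosen by sign.\<close>

lemma eval_one_image:
  assumes fin: "finite I" and com: "conditional_oriented_matroid I L"
  shows "eval_one I L ` polys I = carrier (GR I L)"
proof
  show "eval_one I L ` polys I \<subseteq> carrier (GR I L)" by (auto simp: eval_one_def)
next
  have "topes I L \<subseteq> Pow I \<times> Pow I"
  proof
    fix X assume "X \<in> topes I L"
    then have "signed_set I X" using com_signed[OF com] by (simp add: topes_def)
    then show "X \<in> Pow I \<times> Pow I" by (cases X) (auto simp: signed_set_def)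
  qed
  then have finT: "finite (topes I L)" using fin by (auto intro: finite_subset)
  have sub: "fst X \<subseteq> I" and snd: "snd X = I - fst X" if "X \<in> topes I L" for X
    using that com_signed[OF com, of X]
    by (auto simp: topes_def sign_at_eq_0_iff supp_def signed_set_def)
  have same: "X = Y" if "X \<in> topes I L" "Y \<in> topes I L" "\<forall>i\<in>I. i \<in> fst X \<longleftrightarrow> i \<in> fst Y" for X Y
  proof -
    have "fst X = fst Y" using sub[OF that(1)] sub[OF that(2)] that(3) by blast
    then show ?thesis using snd[OF that(1)] snd[OF that(2)] by (intro signed_eqI) simp_all
  qed
  show "carrier (GR I L) \<subseteq> eval_one I L ` polys I"
  proof
    fix f assume f: "f \<in> carrier (GR I L)"
    define d where "d X = (\<Prod>i\<in>I. if i \<in> fst X then pp i else mm i)" for X :: "'a signed"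
    let ?p = "\<Sum>X\<in>topes I L. of_int (f X) * d X"
    have d: "Polynomial.poly (ev Y (d X)) 1 = (if X = Y then 1 else 0)"
      if "X \<in> topes I L" "Y \<in> topes I L" for X Y
    proof -
      have "Polynomial.poly (ev Y (d X)) 1 = (\<Prod>i\<in>I. if i \<in> fst X \<longleftrightarrow> i \<in> fst Y then 1 else 0)"
        by (auto simp: d_def poly_prod poly_monom intro!: prod.cong)
      also have "\<dots> = (if X = Y then 1 else 0)"
        using same[OF that] fin by (auto simp: prod_zero_iff)
      finally show ?thesis .
    qed
    have "eval_one I L ?p = f"
    proof (rule GR_eqI[OF _ f])
      fix Y assume Y: "Y \<in> topes I L"
      have "eval_one I L ?p Y = (\<Sum>X\<in>topes I L. f X * Polynomial.poly (ev Y (d X)) 1)"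
        using Y by (simp add: eval_one_def poly_sum)
      also have "\<dots> = (\<Sum>X\<in>topes I L. if X = Y then f X else 0)"
        using Y by (intro sum.cong) (auto simp: d)
      also have "\<dots> = f Y" using finT Y by simp
      finally show "eval_one I L ?p Y = f Y" .
    qed (simp add: eval_one_def)
    moreover have "?p \<in> polys I" by (auto simp: d_def intro!: polys_sum polys_mult polys_prod)
    ultimately show "f \<in> eval_one I L ` polys I" by (rule image_eqI[OF sym])
  qed
qed

lemma eval_one_eq_iff:
  assumes "finite I" "conditional_oriented_matroid I L" "p \<in> polys I" "q \<in> polys I"
  shows "eval_one I L p = eval_one I L q \<longleftrightarrow> p - q \<in> idl (polys I) (Kgens I L \<union> {uu - 1})"
proof -
  have "eval_one I L (p - q) = eval_one I L p \<ominus>\<^bsub>GR I L\<^esub> eval_one I L q"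
    by (subst GR_minus) (auto simp: eval_one_def intro!: GR_eqI[of _ I L])
  then have "eval_one I L p = eval_one I L q \<longleftrightarrow> eval_one I L (p - q) = \<zero>\<^bsub>GR I L\<^esub>"
    using minus_eq_zero_iff[OF cring_GR, of "eval_one I L p" I L "eval_one I L q"]
    by (simp add: eval_one_def del: GR_minus GR_simps)
  then show ?thesis using kernel_u1_iff[OF assms(1,2), of "p - q"] assms(3,4) by simp
qed

section \<open>The Rees ring\<close>

lemma up_GR: "coeff_fun I L p \<in> up (GR I L)"
proof -
  obtain N where "\<forall>k>N. coeff_fun I L p k = \<zero>\<^bsub>GR I L\<^esub>" using coeff_fun_bound by blast
  then have "bound \<zero>\<^bsub>GR I L\<^esub> N (coeff_fun I L p)" by (intro bound.intro) auto
  then show ?thesis by (intro mem_upI) auto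
qed

lemma UP_coeff: "q \<in> up A \<Longrightarrow> coeff (UP A) q k = q k"
  by (simp add: UP_def)

lemma rees_carrier:
  "carrier (rees_ring (GR I L) (filt I L)) = {q \<in> up (GR I L). \<forall>k. q k \<in> filt I L k}"
  by (auto simp: rees_ring_def UP_coeff) (auto simp: UP_def)

lemma rees_hom: "coeff_fun I L \<in> ring_hom (poly_ring I) (rees_ring (GR I L) (filt I L))"
proof (rule ring_hom_memI)
  fix p q assume "p \<in> carrier (poly_ring I)" "q \<in> carrier (poly_ring I)"
  then show "coeff_fun I L p \<in> carrier (rees_ring (GR I L) (filt I L))"
    by (auto simp: rees_carrier up_GR coeff_fun_filt)
  show "coeff_fun I L (p \<otimes>\<^bsub>poly_ring I\<^esub> q) = coeff_fun I L p \<otimes>\<^bsub>rees_ring (GR I L) (filt I L)\<^esub> coeff_fun I L q"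
    using up_GR[of I L p] up_GR[of I L q]
    by (auto simp: rees_ring_def UP_def coeff_fun_mult simp del: GR_simps)
  show "coeff_fun I L (p \<oplus>\<^bsub>poly_ring I\<^esub> q) = coeff_fun I L p \<oplus>\<^bsub>rees_ring (GR I L) (filt I L)\<^esub> coeff_fun I L q"
    using up_GR[of I L p] up_GR[of I L q]
    by (auto simp: rees_ring_def UP_def coeff_fun_add simp del: GR_simps)
next
  have "coeff_fun I L 1 k = (if k = 0 then \<one>\<^bsub>GR I L\<^esub> else \<zero>\<^bsub>GR I L\<^esub>)" for k
    using coeff_fun_of_int[of I L 1 k] by auto
  then show "coeff_fun I L \<one>\<^bsub>poly_ring I\<^esub> = \<one>\<^bsub>rees_ring (GR I L) (filt I L)\<^esub>"
    by (auto simp: rees_ring_def UP_def simp del: GR_simps)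
qed

lemma rees_image: "coeff_fun I L ` polys I = carrier (rees_ring (GR I L) (filt I L))"
proof
  show "coeff_fun I L ` polys I \<subseteq> carrier (rees_ring (GR I L) (filt I L))"
    by (auto simp: rees_carrier up_GR coeff_fun_filt)
  show "carrier (rees_ring (GR I L) (filt I L)) \<subseteq> coeff_fun I L ` polys I"
  proof
    fix q assume "q \<in> carrier (rees_ring (GR I L) (filt I L))"
    then have q: "q \<in> up (GR I L)" "\<And>k. q k \<in> filt I L k" by (auto simp: rees_carrier)
    obtain N where "bound \<zero>\<^bsub>GR I L\<^esub> N q" using q(1) by (auto simp: up_def)
    then have N: "\<And>k. k > N \<Longrightarrow> q k = \<zero>\<^bsub>GR I L\<^esub>" by (rule bound.bound)
    obtain p where "p \<in> polys I" "coeff_fun I L p = q"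
      using coeff_fun_surj[of q, OF q(2) N] .
    then show "q \<in> coeff_fun I L ` polys I" by blast
  qed
qed

lemma rees_eq_iff:
  assumes "finite I" "conditional_oriented_matroid I L" "p \<in> polys I" "q \<in> polys I"
  shows "coeff_fun I L p = coeff_fun I L q \<longleftrightarrow> p - q \<in> idl (polys I) (Kgens I L)"
proof -
  have "coeff_fun I L p = coeff_fun I L q \<longleftrightarrow> (\<forall>k. coeff_fun I L (p - q) k = \<zero>\<^bsub>GR I L\<^esub>)"
    unfolding fun_eq_iff[of "coeff_fun I L p"] coeff_fun_eq_iff ..
  then show ?thesis
    using kernel_ideal_iff[OF assms(1,2), of "p - q"] assms(3,4) by (simp add: kernel_ideal_def)
qed

lemma coeff_fun_monom:
  "coeff_fun I L uu = monom (UP (GR I L)) \<one>\<^bsub>GR I L\<^esub> 1"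
  "coeff_fun I L (pp i) = monom (UP (GR I L)) (heav_plus I L i) 1"
  "coeff_fun I L (mm i) = monom (UP (GR I L)) (heav_minus I L i) 1"
  by (auto simp: UP_def coeff_fun_heaviside heav_plus_eq heav_minus_eq)

text \<open>Homogeneous polynomials for the grading in which variables have degree 2; for odd d only
  0 remains.\<close>

definition dpolys :: "'a set \<Rightarrow> nat \<Rightarrow> 'a mpoly set" where
  "dpolys I d = {p \<in> polys I. \<forall>m\<in>Poly_Mapping.keys p. 2 * mon_degree m = d}"

lemma R_degree_eq: "R_degree I d = R_class I ` dpolys I d"
  by (simp add: R_degree_def R_class_def[abs_def] dpolys_def mon_degree_def)

lemma dpolys_even: "dpolys I (2 * k) = hpolys I k"
  by (auto simp: dpolys_def hpolys_def)

lemma coeff_fun_dpolys: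
  assumes "p \<in> dpolys I d" "2 * k \<noteq> d"
  shows "coeff_fun I L p k = \<zero>\<^bsub>GR I L\<^esub>"
proof -
  have "Polynomial.coeff (ev X p) k = 0" for X
    unfolding ev_eq_sum_monom using assms by (auto simp: dpolys_def coeff_sum intro!: sum.neutral)
  then show ?thesis by (simp add: coeff_fun_def)
qed

text \<open>At most the component at d / 2 is nonzero, so one homogeneous lift suffices; for odd d
  it is 0.\<close>

lemma dpolys_lift:
  assumes "\<And>k. 2 * k = d \<Longrightarrow> f k \<in> filt I L k" "\<And>k. 2 * k \<noteq> d \<Longrightarrow> f k = \<zero>\<^bsub>GR I L\<^esub>"
  obtains p where "p \<in> dpolys I d" "coeff_fun I L p = f"
proof (cases "even d")
  case True
  then obtain k where d: "d = 2 * k" by auto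
  obtain p where "p \<in> hpolys I k" "coeff_fun I L p = (\<lambda>j. if j = k then f k else \<zero>\<^bsub>GR I L\<^esub>)"
    using filt_lift_coeff[OF assms(1)[OF d[symmetric]]] by metis
  then show ?thesis using assms(2) d by (intro that[of p]) (auto simp: dpolys_even simp del: GR_simps)
next
  case False
  then have "2 * k \<noteq> d" for k by auto
  then have "f k = \<zero>\<^bsub>GR I L\<^esub>" for k by (rule assms(2))
  then show ?thesis by (intro that[of 0]) (auto simp: dpolys_def simp del: GR_simps)
qed

lemma rees_degree_image: "coeff_fun I L ` dpolys I d = rees_degree (GR I L) (filt I L) d"
proof
  show "coeff_fun I L ` dpolys I d \<subseteq> rees_degree (GR I L) (filt I L) d"
    using rees_image[of I L] coeff_fun_dpolys[of _ I d]
    by (auto simp: rees_degree_def dpolys_def UP_coeff[OF up_GR] simp del: GR_simps)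
  show "rees_degree (GR I L) (filt I L) d \<subseteq> coeff_fun I L ` dpolys I d"
  proof
    fix q assume "q \<in> rees_degree (GR I L) (filt I L) d"
    then have q: "\<And>k. q k \<in> filt I L k" "\<And>k. 2 * k \<noteq> d \<Longrightarrow> q k = \<zero>\<^bsub>GR I L\<^esub>"
      by (auto simp: rees_degree_def rees_carrier UP_coeff simp del: GR_simps)
    obtain p where "p \<in> dpolys I d" "coeff_fun I L p = q"
      using dpolys_lift[of d q, OF q] .
    then show "q \<in> coeff_fun I L ` dpolys I d" by blast
  qed
qed

section \<open>The associated graded ring\<close>

context
  fixes I :: "'a set" and L :: "'a signed set"
begin

interpretation GR: cring "GR I L" by (rule cring_GR)

lemma filt_subgroup: "subgroup (filt I L k) (add_monoid (GR I L))"
  unfolding filt_eq by (rule heav_poly_subgroup)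

lemma filt0_additive_subgroup: "additive_subgroup (filt0 I L k) (GR I L)"
proof (cases k)
  case 0
  have "additive_subgroup {\<zero>\<^bsub>GR I L\<^esub>} (GR I L)"
    by (rule ideal.axioms(1)[OF GR.zeroideal])
  then show ?thesis using 0 by (simp only: filt0_simps)
next
  case (Suc j)
  show ?thesis unfolding Suc filt0_simps by (rule additive_subgroupI[OF filt_subgroup])
qed

lemma filt0_abelian_subgroup: "abelian_subgroup (filt0 I L k) (GR I L)"
  by (rule abelian_subgroupI3[OF filt0_additive_subgroup GR.abelian_group_axioms])

lemma filt0_filt: "f \<in> filt0 I L k \<Longrightarrow> f \<in> filt I L k"
  by (cases k) (auto simp: filt0_simps filt_eq intro: heav_poly_zero[simplified] elim: heav_poly_mono)

lemma filt0_carrier: "f \<in> filt0 I L k \<Longrightarrow> f \<in> carrier (GR I L)"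
  by (intro filt_carrier filt0_filt)

text \<open>Behind the independence of products from representatives. Index 0 is separate because
  F_{-1} = 0 is not a term of \<open>filt\<close>.\<close>

lemma filt0_mult:
  assumes "f \<in> filt0 I L j" "g \<in> filt I L k"
  shows "f \<otimes>\<^bsub>GR I L\<^esub> g \<in> filt0 I L (j + k)"
proof (cases j)
  case 0
  then have "f = \<zero>\<^bsub>GR I L\<^esub>" using assms(1) by (simp only: filt0_simps singleton_iff)
  then have "f \<otimes>\<^bsub>GR I L\<^esub> g = \<zero>\<^bsub>GR I L\<^esub>" using filt_carrier[OF assms(2)] GR.l_null by blast
  then show ?thesis using filt0_zero[of I L] by (simp only:)
next
  case (Suc i)
  then show ?thesis using filt_mult[of f I L i g k] assms by (simp add: filt0_simps del: GR_simps)
qed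

definition coset :: "nat \<Rightarrow> ('a signed \<Rightarrow> int) \<Rightarrow> ('a signed \<Rightarrow> int) set" where
  "coset k f = filt0 I L k +>\<^bsub>GR I L\<^esub> f"

lemma coset_eq_iff:
  assumes "f \<in> carrier (GR I L)" "g \<in> carrier (GR I L)"
  shows "coset k f = coset k g \<longleftrightarrow> f \<ominus>\<^bsub>GR I L\<^esub> g \<in> filt0 I L k"
proof -
  interpret H: abelian_subgroup "filt0 I L k" "GR I L" by (rule filt0_abelian_subgroup)
  have "f \<in> coset k g \<longleftrightarrow> f \<ominus>\<^bsub>GR I L\<^esub> g \<in> filt0 I L k"
    unfolding coset_def using assms by (intro H.a_rcos_module_minus GR.ring_axioms)
  moreover have "coset k f = coset k g \<longleftrightarrow> f \<in> coset k g"
    unfolding coset_def using assms H.a_rcos_self[of f] H.a_repr_independence'[of f g] by metis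
  ultimately show ?thesis by blast
qed

lemma coset_eq_filt0_iff:
  assumes "f \<in> carrier (GR I L)"
  shows "coset k f = filt0 I L k \<longleftrightarrow> f \<in> filt0 I L k"
proof -
  interpret H: abelian_subgroup "filt0 I L k" "GR I L" by (rule filt0_abelian_subgroup)
  show ?thesis unfolding coset_def
    using assms H.a_rcos_self[of f] H.a_rcos_const[of f] by metis
qed

lemma gr_piece_simps:
  "carrier (gr_piece (GR I L) (filt I L) k) = coset k ` filt I L k"
  "\<one>\<^bsub>gr_piece (GR I L) (filt I L) k\<^esub> = filt0 I L k"
  by (auto simp: gr_piece_def FactGroup_def RCOSETS_def coset_def a_r_coset_def r_coset_def filt0_def)

lemma gr_piece_mult:
  assumes "f \<in> carrier (GR I L)" "g \<in> carrier (GR I L)"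
  shows "coset k f \<otimes>\<^bsub>gr_piece (GR I L) (filt I L) k\<^esub> coset k g = coset k (f \<oplus>\<^bsub>GR I L\<^esub> g)"
proof -
  interpret H: abelian_subgroup "filt0 I L k" "GR I L" by (rule filt0_abelian_subgroup)
  have "coset k f \<otimes>\<^bsub>gr_piece (GR I L) (filt I L) k\<^esub> coset k g = coset k f <+>\<^bsub>GR I L\<^esub> coset k g"
    by (simp add: gr_piece_def FactGroup_def set_add_def set_mult_def)
  then show ?thesis using H.a_rcos_sum[OF assms] by (simp add: coset_def)
qed

text \<open>The operation is addition of cosets. Commutativity is what makes the
  \<open>finprod\<close> in the product of \<open>gr_ring\<close> the expected finite sum.\<close>

lemma gr_piece_comm_monoid: "Group.comm_monoid (gr_piece (GR I L) (filt I L) k)"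
proof -
  have sub: "f \<oplus>\<^bsub>GR I L\<^esub> g \<in> filt I L k" if "f \<in> filt I L k" "g \<in> filt I L k" for f g
    using that heav_poly.sum[of I L k f g] by (simp only: filt_eq mem_Collect_eq)
  have zero: "filt0 I L k = coset k \<zero>\<^bsub>GR I L\<^esub>"
    using coset_eq_filt0_iff[OF GR.zero_closed, of k] filt0_zero by blast
  show ?thesis
  proof (rule comm_monoidI)
    show "\<one>\<^bsub>gr_piece (GR I L) (filt I L) k\<^esub> \<in> carrier (gr_piece (GR I L) (filt I L) k)"
      unfolding gr_piece_simps zero using filt_zero by (rule imageI)
  qed (auto simp: gr_piece_simps gr_piece_mult filt_carrier sub GR.a_ac zero
      simp del: GR_simps)
qed

lemma gr_piece_finprod:
  assumes "finite A" "\<And>a. a \<in> A \<Longrightarrow> f a \<in> filt I L k"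
  shows "finprod (gr_piece (GR I L) (filt I L) k) (\<lambda>a. coset k (f a)) A = coset k (finsum (GR I L) f A)"
    (is "finprod ?P _ _ = _")
proof -
  interpret P: Group.comm_monoid ?P by (rule gr_piece_comm_monoid)
  have zero: "filt0 I L k = coset k \<zero>\<^bsub>GR I L\<^esub>"
    using coset_eq_filt0_iff[OF GR.zero_closed, of k] filt0_zero by blast
  show ?thesis using assms
  proof (induction rule: finite_induct)
    case empty
    show ?case using zero by (simp add: gr_piece_simps del: GR_simps)
  next
    case (insert a A)
    have 1: "f \<in> A \<rightarrow> carrier (GR I L)" "f a \<in> carrier (GR I L)" using insert.prems by (auto intro: filt_carrier)
    have "(\<lambda>a. coset k (f a)) \<in> A \<rightarrow> carrier ?P" "coset k (f a) \<in> carrier ?P"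
      using insert.prems by (auto simp: gr_piece_simps)
    then show ?case
      using insert 1 by (simp add: P.finprod_insert GR.finsum_insert gr_piece_mult GR.finsum_closed del: GR_simps)
  qed
qed

lemma coset_mem_iff:
  "x \<in> coset k f \<longleftrightarrow> (\<exists>h\<in>filt0 I L k. x = h \<oplus>\<^bsub>GR I L\<^esub> f)"
  by (simp add: coset_def a_r_coset_def r_coset_def del: GR_simps)

text \<open>\<open>rcoset_mult\<close> is a union over all pairs of representatives, and all of them
  give one coset: (h + f)(h' + g) - f g = h (h' + g) + h' f lies in F_{i+j-1}.\<close>

lemma gr_rcoset_mult:
  assumes f: "f \<in> filt I L i" and g: "g \<in> filt I L j"
  shows "rcoset_mult (GR I L) (filt0 I L (i + j)) (coset i f) (coset j g) = coset (i + j) (f \<otimes>\<^bsub>GR I L\<^esub> g)"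
proof -
  note fc = filt_carrier[OF f] and gc = filt_carrier[OF g]
  have eq: "coset (i + j) (x \<otimes>\<^bsub>GR I L\<^esub> y) = coset (i + j) (f \<otimes>\<^bsub>GR I L\<^esub> g)"
    if "x \<in> coset i f" "y \<in> coset j g" for x y
  proof -
    from that obtain h h' where h: "h \<in> filt0 I L i" "x = h \<oplus>\<^bsub>GR I L\<^esub> f"
      and h': "h' \<in> filt0 I L j" "y = h' \<oplus>\<^bsub>GR I L\<^esub> g"
      unfolding coset_mem_iff by blast
    note hc = filt0_carrier[OF h(1)] and hc' = filt0_carrier[OF h'(1)]
    have yf: "y \<in> filt I L j"
      using heav_poly.sum[of I L j h' g] filt0_filt[OF h'(1)] g h'(2)
      by (simp only: filt_eq mem_Collect_eq)
    have "(x \<otimes>\<^bsub>GR I L\<^esub> y) \<ominus>\<^bsub>GR I L\<^esub> (f \<otimes>\<^bsub>GR I L\<^esub> g) = h \<otimes>\<^bsub>GR I L\<^esub> y \<oplus>\<^bsub>GR I L\<^esub> h' \<otimes>\<^bsub>GR I L\<^esub> f"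
      unfolding h(2) h'(2) using fc gc hc hc' by algebra
    moreover have "h \<otimes>\<^bsub>GR I L\<^esub> y \<oplus>\<^bsub>GR I L\<^esub> h' \<otimes>\<^bsub>GR I L\<^esub> f \<in> filt0 I L (i + j)"
      using filt0_mult[OF h(1) yf] filt0_mult[OF h'(1) f]
      by (intro filt0_add) (simp_all only: add.commute)
    moreover have "x \<in> carrier (GR I L)" "y \<in> carrier (GR I L)"
      unfolding h(2) h'(2) using fc gc hc hc' by (simp_all del: GR_simps)
    ultimately show ?thesis
      using fc gc by (subst coset_eq_iff) (simp_all del: GR_simps GR_minus)
  qed
  have ne: "f \<in> coset i f" "g \<in> coset j g"
    unfolding coset_mem_iff using filt0_zero fc gc by (metis GR.l_zero)+
  have "rcoset_mult (GR I L) (filt0 I L (i + j)) (coset i f) (coset j g)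
      = (\<Union>x\<in>coset i f. \<Union>y\<in>coset j g. coset (i + j) (x \<otimes>\<^bsub>GR I L\<^esub> y))"
    by (simp only: rcoset_mult_def coset_def)
  also have "\<dots> = (\<Union>x\<in>coset i f. \<Union>y\<in>coset j g. coset (i + j) (f \<otimes>\<^bsub>GR I L\<^esub> g))"
    by (intro SUP_cong refl eq)
  also have "\<dots> = coset (i + j) (f \<otimes>\<^bsub>GR I L\<^esub> g)" using ne by blast
  finally show ?thesis .
qed

definition gr_map :: "'a mpoly \<Rightarrow> nat \<Rightarrow> ('a signed \<Rightarrow> int) set" where
  "gr_map p k = coset k (coeff_fun I L p k)"

lemma gr_carrier:
  "carrier (gr_ring (GR I L) (filt I L)) =
    {x. (\<forall>k. x k \<in> coset k ` filt I L k) \<and> finite {k. x k \<noteq> filt0 I L k}}"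
  by (simp add: gr_ring_def gr_piece_simps)

lemma gr_map_carrier:
  assumes "p \<in> polys I"
  shows "gr_map p \<in> carrier (gr_ring (GR I L) (filt I L))"
proof -
  obtain N where N: "\<forall>k>N. coeff_fun I L p k = \<zero>\<^bsub>GR I L\<^esub>" using coeff_fun_bound by blast
  have "gr_map p k = filt0 I L k" if "k > N" for k
    using N that filt0_zero unfolding gr_map_def by (subst coset_eq_filt0_iff) (simp_all del: GR_simps)
  then have "{k. gr_map p k \<noteq> filt0 I L k} \<subseteq> {..N}" using not_le by blast
  then show ?thesis
    using coeff_fun_filt[OF assms] by (auto simp: gr_carrier gr_map_def intro: finite_subset)
qed

lemma gr_map_hom: "gr_map \<in> ring_hom (poly_ring I) (gr_ring (GR I L) (filt I L))"
proof (rule ring_hom_memI)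
  fix p q assume pq: "p \<in> carrier (poly_ring I)" "q \<in> carrier (poly_ring I)"
  then show "gr_map p \<in> carrier (gr_ring (GR I L) (filt I L))" by (simp add: gr_map_carrier)
  show "gr_map (p \<oplus>\<^bsub>poly_ring I\<^esub> q) = gr_map p \<oplus>\<^bsub>gr_ring (GR I L) (filt I L)\<^esub> gr_map q"
    by (auto simp: gr_ring_def gr_map_def gr_piece_mult coeff_fun_add simp del: GR_simps)
  show "gr_map (p \<otimes>\<^bsub>poly_ring I\<^esub> q) = gr_map p \<otimes>\<^bsub>gr_ring (GR I L) (filt I L)\<^esub> gr_map q"
  proof
    fix n
    let ?P = "gr_piece (GR I L) (filt I L) n"
    interpret P: Group.comm_monoid ?P by (rule gr_piece_comm_monoid)
    let ?c = "\<lambda>i. coeff_fun I L p i \<otimes>\<^bsub>GR I L\<^esub> coeff_fun I L q (n - i)"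
    have cf: "coeff_fun I L p i \<in> filt I L i" "coeff_fun I L q i \<in> filt I L i" for i
      using pq by (auto intro: coeff_fun_filt)
    have c: "?c i \<in> filt I L n" if "i \<le> n" for i
      using filt_mult[OF cf(1)[of i] cf(2)[of "n - i"]] that by (simp del: GR_simps)
    have rm: "rcoset_mult (GR I L) (filt0 I L n) (gr_map p i) (gr_map q (n - i)) = coset n (?c i)"
      if "i \<le> n" for i
      using gr_rcoset_mult[OF cf(1)[of i] cf(2)[of "n - i"]] that by (simp add: gr_map_def del: GR_simps)
    have "(gr_map p \<otimes>\<^bsub>gr_ring (GR I L) (filt I L)\<^esub> gr_map q) n =
        finprod ?P (\<lambda>i. rcoset_mult (GR I L) (filt0 I L n) (gr_map p i) (gr_map q (n - i))) {..n}"
      by (simp add: gr_ring_def filt0_def)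
    also have "\<dots> = finprod ?P (\<lambda>i. coset n (?c i)) {..n}"
      using c by (intro P.finprod_cong refl) (auto simp: rm gr_piece_simps simp_implies_def simp del: GR_simps)
    also have "\<dots> = coset n (finsum (GR I L) ?c {..n})"
      by (rule gr_piece_finprod) (use c in auto)
    finally show "gr_map (p \<otimes>\<^bsub>poly_ring I\<^esub> q) n = (gr_map p \<otimes>\<^bsub>gr_ring (GR I L) (filt I L)\<^esub> gr_map q) n"
      by (simp add: gr_map_def coeff_fun_mult del: GR_simps)
  qed
next
  have "gr_map 1 k = gr_class (GR I L) (filt I L) 0 \<one>\<^bsub>GR I L\<^esub> k" for k
  proof (cases "k = 0")
    case True
    then have "coeff_fun I L 1 k = \<one>\<^bsub>GR I L\<^esub>" using coeff_fun_of_int[of I L 1 k] by simp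
    then show ?thesis using True by (simp add: gr_map_def gr_class_def coset_def filt0_def del: GR_simps)
  next
    case False
    then have "coeff_fun I L 1 k = \<zero>\<^bsub>GR I L\<^esub>" using coeff_fun_of_int[of I L 1 k] by simp
    then have "gr_map 1 k = filt0 I L k"
      unfolding gr_map_def using filt0_zero by (subst coset_eq_filt0_iff) (simp_all del: GR_simps)
    then show ?thesis using False by (simp add: gr_class_def filt0_def)
  qed
  then show "gr_map \<one>\<^bsub>poly_ring I\<^esub> = \<one>\<^bsub>gr_ring (GR I L) (filt I L)\<^esub>"
    by (auto simp: gr_ring_def)
qed

text \<open>Zero classes get the representative 0, so that finite support passes from the cosets to
  the chosen functions.\<close>

lemma gr_lift:
  assumes "x \<in> carrier (gr_ring (GR I L) (filt I L))"
  obtains f N where "\<And>k. f k \<in> filt I L k" "\<And>k. x k = coset k (f k)"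
    "\<And>k. x k = filt0 I L k \<Longrightarrow> f k = \<zero>\<^bsub>GR I L\<^esub>" "\<And>k. k > N \<Longrightarrow> f k = \<zero>\<^bsub>GR I L\<^esub>"
proof -
  have x: "x k \<in> coset k ` filt I L k" for k using assms by (simp add: gr_carrier)
  have "\<exists>f. f \<in> filt I L k \<and> x k = coset k f \<and> (x k = filt0 I L k \<longrightarrow> f = \<zero>\<^bsub>GR I L\<^esub>)" for k
  proof (cases "x k = filt0 I L k")
    case True
    then have "x k = coset k \<zero>\<^bsub>GR I L\<^esub>"
      using coset_eq_filt0_iff[OF GR.zero_closed, of k] filt0_zero by blast
    then show ?thesis using filt_zero by blast
  next
    case False
    then show ?thesis using x[of k] by blast
  qed
  then obtain f where f: "\<And>k. f k \<in> filt I L k" "\<And>k. x k = coset k (f k)"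
    "\<And>k. x k = filt0 I L k \<Longrightarrow> f k = \<zero>\<^bsub>GR I L\<^esub>"
    by metis
  have "finite {k. x k \<noteq> filt0 I L k}" using assms by (simp add: gr_carrier)
  then obtain N where "\<forall>k\<in>{k. x k \<noteq> filt0 I L k}. k \<le> N" using finite_nat_set_iff_bounded_le by blast
  then have "f k = \<zero>\<^bsub>GR I L\<^esub>" if "k > N" for k using f(3)[of k] that by force
  then show ?thesis using f that by blast
qed

lemma gr_map_image: "gr_map ` polys I = carrier (gr_ring (GR I L) (filt I L))"
proof
  show "gr_map ` polys I \<subseteq> carrier (gr_ring (GR I L) (filt I L))" using gr_map_carrier by blast
  show "carrier (gr_ring (GR I L) (filt I L)) \<subseteq> gr_map ` polys I"
  proof
    fix x assume "x \<in> carrier (gr_ring (GR I L) (filt I L))"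
    then obtain f N where f: "\<And>k. f k \<in> filt I L k" "\<And>k. x k = coset k (f k)"
      "\<And>k. k > N \<Longrightarrow> f k = \<zero>\<^bsub>GR I L\<^esub>"
      using gr_lift by metis
    obtain p where "p \<in> polys I" "coeff_fun I L p = f" using coeff_fun_surj[of f, OF f(1,3)] .
    then have "x = gr_map p" using f(2) by (auto simp: gr_map_def)
    then show "x \<in> gr_map ` polys I" using \<open>p \<in> polys I\<close> by blast
  qed
qed

lemma gr_map_eq_iff:
  assumes "finite I" "conditional_oriented_matroid I L" "p \<in> polys I" "q \<in> polys I"
  shows "gr_map p = gr_map q \<longleftrightarrow> p - q \<in> idl (polys I) (Kgens I L \<union> {uu})"
proof -
  have "gr_map p = gr_map q \<longleftrightarrow> (\<forall>k. coeff_fun I L (p - q) k \<in> filt0 I L k)"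
    unfolding fun_eq_iff[of "gr_map p"] gr_map_def coeff_fun_diff
    by (subst coset_eq_iff) (simp_all del: GR_minus)
  then show ?thesis using kernel_u0_iff[OF assms(1,2), of "p - q"] assms(3,4) by simp
qed

lemma gr_map_heaviside:
  "gr_map (pp i) = gr_class (GR I L) (filt I L) 1 (heav_plus I L i)"
  "gr_map (mm i) = gr_class (GR I L) (filt I L) 1 (heav_minus I L i)"
proof -
  have zero: "coset k \<zero>\<^bsub>GR I L\<^esub> = filt0 I L k" for k
    using coset_eq_filt0_iff[OF GR.zero_closed, of k] filt0_zero by blast
  show "gr_map (pp i) = gr_class (GR I L) (filt I L) 1 (heav_plus I L i)"
    "gr_map (mm i) = gr_class (GR I L) (filt I L) 1 (heav_minus I L i)"
    by (rule ext, auto simp: gr_map_def coeff_fun_heaviside gr_class_def zero coset_def[symmetric]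
        filt0_def[symmetric] simp del: GR_simps)+
qed

lemma gr_degree_image: "gr_map ` dpolys I d = gr_degree (GR I L) (filt I L) d"
proof
  show "gr_map ` dpolys I d \<subseteq> gr_degree (GR I L) (filt I L) d"
  proof
    fix x assume "x \<in> gr_map ` dpolys I d"
    then obtain p where p: "p \<in> dpolys I d" "x = gr_map p" by blast
    have "gr_map p k = filt0 I L k" if "2 * k \<noteq> d" for k
      unfolding gr_map_def using coeff_fun_dpolys[OF p(1) that, of L] filt0_zero
      by (subst coset_eq_filt0_iff) (simp_all del: GR_simps)
    then show "x \<in> gr_degree (GR I L) (filt I L) d"
      using p gr_map_carrier by (auto simp: gr_degree_def gr_piece_simps dpolys_def)
  qed
  show "gr_degree (GR I L) (filt I L) d \<subseteq> gr_map ` dpolys I d"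
  proof
    fix x assume x: "x \<in> gr_degree (GR I L) (filt I L) d"
    then have xc: "x \<in> carrier (gr_ring (GR I L) (filt I L))"
      and x0: "\<And>k. 2 * k \<noteq> d \<Longrightarrow> x k = filt0 I L k"
      by (auto simp: gr_degree_def gr_piece_simps)
    obtain f where f: "\<And>k. f k \<in> filt I L k" "\<And>k. x k = coset k (f k)"
      "\<And>k. x k = filt0 I L k \<Longrightarrow> f k = \<zero>\<^bsub>GR I L\<^esub>"
      using gr_lift[OF xc] by metis
    obtain p where p: "p \<in> dpolys I d" "coeff_fun I L p = f"
      using dpolys_lift[of d f I L, OF f(1) f(3)[OF x0]] by metis
    then have "x = gr_map p" using f(2) by (auto simp: gr_map_def)
    then show "x \<in> gr_map ` dpolys I d" using p by blast
  qed
qed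

end

text \<open>Each isomorphism compares two surjections from the polynomial ring with the same kernel;
  the generators and the homogeneous parts are then traced through polynomials.\<close>

theorem theorem1p6:
  fixes I :: "'a set" and L :: "'a signed set"
  assumes "finite I" and "conditional_oriented_matroid I L"
  shows
    "(\<exists>\<phi> \<in> ring_iso (R_at_quot I L 1) (GR I L). \<forall>i\<in>I.
        \<phi> (R_at_quot_class I L 1 (e_plus I i)) = heav_plus I L i \<and>
        \<phi> (R_at_quot_class I L 1 (e_minus I i)) = heav_minus I L i) \<and>
     (\<exists>\<phi> \<in> ring_iso (R_at_quot I L 0) (gr_ring (GR I L) (filt I L)).
        (\<forall>i\<in>I.
          \<phi> (R_at_quot_class I L 0 (e_plus I i)) =
            gr_class (GR I L) (filt I L) 1 (heav_plus I L i) \<and>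
          \<phi> (R_at_quot_class I L 0 (e_minus I i)) =
            gr_class (GR I L) (filt I L) 1 (heav_minus I L i)) \<and>
        (\<forall>d. \<phi> ` R_at_quot_class I L 0 ` R_degree I d = gr_degree (GR I L) (filt I L) d)) \<and>
     (\<exists>\<phi> \<in> ring_iso (R_quot I L) (rees_ring (GR I L) (filt I L)).
        \<phi> (R_quot_class I L (u_elem I)) = monom (UP (GR I L)) \<one>\<^bsub>GR I L\<^esub> 1 \<and>
        (\<forall>i\<in>I.
          \<phi> (R_quot_class I L (e_plus I i)) = monom (UP (GR I L)) (heav_plus I L i) 1 \<and>
          \<phi> (R_quot_class I L (e_minus I i)) = monom (UP (GR I L)) (heav_minus I L i) 1) \<and>
        (\<forall>d. \<phi> ` R_quot_class I L ` R_degree I d = rees_degree (GR I L) (filt I L) d))"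
proof (intro conjI)
  note e_simps = e_plus_def e_minus_def u_elem_def R_class_def[symmetric]
  have dp: "p \<in> dpolys I d \<Longrightarrow> p \<in> polys I" for p d by (simp add: dpolys_def)
  have img: "\<phi> ` c ` R_degree I d = \<psi> ` dpolys I d"
    if "\<forall>p\<in>polys I. \<phi> (c (R_class I p)) = \<psi> p" for \<phi> c \<psi> d
    unfolding R_degree_eq image_image by (intro image_cong refl) (use that dp in blast)
  obtain \<phi> where \<phi>: "\<phi> \<in> ring_iso (R_at_quot I L 1) (GR I L)"
    "\<forall>p\<in>polys I. \<phi> (R_at_quot_class I L 1 (R_class I p)) = eval_one I L p"
    using presents_ring_iso[OF presents_R_at_quot[OF assms(1), of L 1] eval_one_hom eval_one_image[OF assms]]
      eval_one_eq_iff[OF assms] by auto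
  have "eval_one I L (pp i) = heav_plus I L i" "eval_one I L (mm i) = heav_minus I L i" for i
    by (auto simp: eval_one_def heav_plus_eq heav_minus_eq poly_monom intro!: restrict_ext)
  then show "\<exists>\<phi> \<in> ring_iso (R_at_quot I L 1) (GR I L). \<forall>i\<in>I.
        \<phi> (R_at_quot_class I L 1 (e_plus I i)) = heav_plus I L i \<and>
        \<phi> (R_at_quot_class I L 1 (e_minus I i)) = heav_minus I L i"
    using \<phi> by (intro bexI[OF _ \<phi>(1)]) (simp add: e_simps)
  obtain \<phi> where \<phi>: "\<phi> \<in> ring_iso (R_at_quot I L 0) (gr_ring (GR I L) (filt I L))"
    "\<forall>p\<in>polys I. \<phi> (R_at_quot_class I L 0 (R_class I p)) = gr_map I L p"
    using presents_ring_iso[OF presents_R_at_quot[OF assms(1), of L 0] gr_map_hom[of I L] gr_map_image[of I L]]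
      gr_map_eq_iff[OF assms] by auto
  show "\<exists>\<phi> \<in> ring_iso (R_at_quot I L 0) (gr_ring (GR I L) (filt I L)).
        (\<forall>i\<in>I.
          \<phi> (R_at_quot_class I L 0 (e_plus I i)) =
            gr_class (GR I L) (filt I L) 1 (heav_plus I L i) \<and>
          \<phi> (R_at_quot_class I L 0 (e_minus I i)) =
            gr_class (GR I L) (filt I L) 1 (heav_minus I L i)) \<and>
        (\<forall>d. \<phi> ` R_at_quot_class I L 0 ` R_degree I d = gr_degree (GR I L) (filt I L) d)"
    using \<phi>(2) img[of \<phi> "R_at_quot_class I L 0" "gr_map I L", OF \<phi>(2)] gr_degree_image[of I L]
    by (intro bexI[OF _ \<phi>(1)]) (simp add: e_simps gr_map_heaviside)
  obtain \<phi> where \<phi>: "\<phi> \<in> ring_iso (R_quot I L) (rees_ring (GR I L) (filt I L))"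
    "\<forall>p\<in>polys I. \<phi> (R_quot_class I L (R_class I p)) = coeff_fun I L p"
    using presents_ring_iso[OF presents_R_quot[OF assms(1), of L] rees_hom[of I L] rees_image[of I L]]
      rees_eq_iff[OF assms] by auto
  show "\<exists>\<phi> \<in> ring_iso (R_quot I L) (rees_ring (GR I L) (filt I L)).
        \<phi> (R_quot_class I L (u_elem I)) = monom (UP (GR I L)) \<one>\<^bsub>GR I L\<^esub> 1 \<and>
        (\<forall>i\<in>I.
          \<phi> (R_quot_class I L (e_plus I i)) = monom (UP (GR I L)) (heav_plus I L i) 1 \<and>
          \<phi> (R_quot_class I L (e_minus I i)) = monom (UP (GR I L)) (heav_minus I L i) 1) \<and>
        (\<forall>d. \<phi> ` R_quot_class I L ` R_degree I d = rees_degree (GR I L) (filt I L) d)"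
    using \<phi>(2) img[of \<phi> "R_quot_class I L" "coeff_fun I L", OF \<phi>(2)] rees_degree_image[of I L]
    by (intro bexI[OF _ \<phi>(1)]) (simp add: e_simps coeff_fun_monom del: GR_simps)
qed

end
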